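(* Let $\nabla$ be a (regular or rational) linear connection on the tangent bundle $TM$ of a smooth connected affine variety $M$ over $\mathbf C$. The following statements are equivalent: (1) $\nabla$ is a Lie connection; (2) $\nabla^{\rm rec}$ is a Lie connection; (3) $\nabla$ is flat and has constant torsion, $\nabla\operatorname{Tor}_\nabla=0$; (4) $\nabla$ and $\nabla^{\rm rec}$ are flat.
   Context: The reciprocal connection of $\nabla$ is $\nabla^{\rm rec}_XY=\nabla_YX+[X,Y]$. The torsion is $\operatorname{Tor}_\nabla(X,Y)=\nabla_XY-\nabla_YX-[X,Y]$. A (regular or rational) Lie connection on $M$ is a flat linear connection on $TM$ such that the Lie bracket of any two (local analytic) horizontal vector fields is a horizontal vector field. *)

theory Defs
  imports "HOL-Analysis.Analysis"
begin

section \<open>Affine varieties over the complex numbers\<close>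

inductive_set polys :: "(complex^'n \<Rightarrow> complex) set" where
  const: "(\<lambda>x. c) \<in> polys"
| coord: "(\<lambda>x. x $ i) \<in> polys"
| add: "f \<in> polys \<Longrightarrow> g \<in> polys \<Longrightarrow> (\<lambda>x. f x + g x) \<in> polys"
| mult: "f \<in> polys \<Longrightarrow> g \<in> polys \<Longrightarrow> (\<lambda>x. f x * g x) \<in> polys"

definition zariski_open :: "(complex^'n) set \<Rightarrow> bool" where
  "zariski_open W \<longleftrightarrow> (\<exists>S\<subseteq>polys. W = {x. \<exists>f\<in>S. f x \<noteq> 0})"

lemma zariski_openE:
  assumes "zariski_open W"
  obtains S where "S \<subseteq> polys" "W = {x. \<exists>f\<in>S. f x \<noteq> 0}"
  using assms unfolding zariski_open_def by (elim exE conjE)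

lemma istopology_zariski_open: "istopology zariski_open"
  unfolding istopology_def
proof (intro conjI allI impI)
  fix V W :: "(complex^'n) set"
  assume V: "zariski_open V" and W: "zariski_open W"
  obtain S where S: "S \<subseteq> polys" "V = {x. \<exists>f\<in>S. f x \<noteq> 0}" by (rule zariski_openE[OF V])
  obtain T where T: "T \<subseteq> polys" "W = {x. \<exists>f\<in>T. f x \<noteq> 0}" by (rule zariski_openE[OF W])
  define R where "R = {\<lambda>x. f x * g x |f g. f \<in> S \<and> g \<in> T}"
  have "R \<subseteq> polys"
  proof
    fix h assume "h \<in> R"
    then obtain f g where "h = (\<lambda>x. f x * g x)" "f \<in> S" "g \<in> T"
      unfolding R_def mem_Collect_eq by (elim exE conjE)
    then show "h \<in> polys" using S(1) T(1) polys.mult[of f g] by (simp add: subset_iff)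
  qed
  moreover have "x \<in> V \<inter> W \<longleftrightarrow> (\<exists>h\<in>R. h x \<noteq> 0)" for x
  proof
    assume "x \<in> V \<inter> W"
    then obtain f g where fg: "f \<in> S" "g \<in> T" "f x \<noteq> 0" "g x \<noteq> 0"
      unfolding S(2) T(2) Int_iff mem_Collect_eq by (elim conjE bexE)
    from fg(1,2) have "(\<lambda>x. f x * g x) \<in> R"
      unfolding R_def mem_Collect_eq by (intro exI[of _ f] exI[of _ g] conjI refl)
    moreover have "f x * g x \<noteq> 0" using fg(3,4) by simp
    ultimately show "\<exists>h\<in>R. h x \<noteq> 0"
      by (intro bexI[where x = "\<lambda>x. f x * g x"])
  next
    assume "\<exists>h\<in>R. h x \<noteq> 0"
    then obtain h where h: "h \<in> R" "h x \<noteq> 0" by (elim bexE)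
    then obtain f g where "h = (\<lambda>x. f x * g x)" "f \<in> S" "g \<in> T"
      unfolding R_def mem_Collect_eq by (elim exE conjE)
    with h(2) have "f \<in> S" "f x \<noteq> 0" "g \<in> T" "g x \<noteq> 0" by simp_all
    then show "x \<in> V \<inter> W" unfolding S(2) T(2) Int_iff mem_Collect_eq by (intro conjI bexI)
  qed
  then have "V \<inter> W = {x. \<exists>h\<in>R. h x \<noteq> 0}" by (intro set_eqI) simp
  ultimately show "zariski_open (V \<inter> W)" unfolding zariski_open_def by (intro exI conjI)
next
  fix \<K> :: "(complex^'n) set set"
  assume K: "\<forall>K\<in>\<K>. zariski_open K"
  define R where "R = {f \<in> polys. \<forall>x. f x \<noteq> 0 \<longrightarrow> x \<in> \<Union>\<K>}"
  have "R \<subseteq> polys" unfolding R_def by (rule Collect_restrict)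
  moreover have "x \<in> \<Union>\<K> \<longleftrightarrow> (\<exists>f\<in>R. f x \<noteq> 0)" for x
  proof
    assume "x \<in> \<Union>\<K>"
    then obtain K where KK: "K \<in> \<K>" "x \<in> K" by (elim UnionE)
    obtain S where S: "S \<subseteq> polys" "K = {x. \<exists>f\<in>S. f x \<noteq> 0}"
      by (rule zariski_openE[OF bspec[OF K KK(1)]])
    obtain f where f: "f \<in> S" "f x \<noteq> 0"
      using KK(2) unfolding S(2) mem_Collect_eq by (elim bexE)
    have "y \<in> \<Union>\<K>" if "f y \<noteq> 0" for y
      using that f(1) S(2) by (intro UnionI[OF KK(1)]) (simp, rule bexI)
    then have "f \<in> R" using f(1) S(1) unfolding R_def by (simp add: subset_iff)
    with f(2) show "\<exists>f\<in>R. f x \<noteq> 0" by (intro bexI)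
  next
    assume "\<exists>f\<in>R. f x \<noteq> 0"
    then obtain f where "f \<in> R" "f x \<noteq> 0" by (elim bexE)
    then show "x \<in> \<Union>\<K>" unfolding R_def by simp
  qed
  then have "\<Union>\<K> = {x. \<exists>f\<in>R. f x \<noteq> 0}" by (intro set_eqI) simp
  ultimately show "zariski_open (\<Union>\<K>)" unfolding zariski_open_def by (intro exI conjI)
qed

definition zariski :: "(complex^'n) topology" where
  "zariski = topology zariski_open"

lemma openin_zariski: "openin zariski W \<longleftrightarrow> zariski_open W"
  by (simp add: zariski_def istopology_zariski_open)

definition vanishing_ideal :: "(complex^'n) set \<Rightarrow> (complex^'n \<Rightarrow> complex) set" where
  "vanishing_ideal M = {f \<in> polys. \<forall>x\<in>M. f x = 0}"

definition tangent_space :: "(complex^'n) set \<Rightarrow> complex^'n \<Rightarrow> (complex^'n) set" where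
  "tangent_space M p = {v. \<forall>f\<in>vanishing_ideal M. frechet_derivative f (at p) v = 0}"

text \<open>Smoothness over the ground field: near each point, \<open>M\<close> is cut out inside a principal open
  set \<open>g \<noteq> 0\<close> by finitely many equations with linearly independent differentials.\<close>
definition smooth_at :: "(complex^'n) set \<Rightarrow> complex^'n \<Rightarrow> bool" where
  "smooth_at M p \<longleftrightarrow> (\<exists>g\<in>polys. \<exists>F. finite F \<and> F \<subseteq> vanishing_ideal M \<and> g p \<noteq> 0 \<and>
     {x. g x \<noteq> 0 \<and> (\<forall>f\<in>F. f x = 0)} \<subseteq> M \<and>
     (\<forall>c :: (complex^'n \<Rightarrow> complex) \<Rightarrow> complex.
        (\<forall>v. (\<Sum>f\<in>F. c f * frechet_derivative f (at p) v) = 0) \<longrightarrow> (\<forall>f\<in>F. c f = 0)))"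

definition smooth_connected_affine_variety :: "(complex^'n) set \<Rightarrow> bool" where
  "smooth_connected_affine_variety M \<longleftrightarrow>
     M \<noteq> {} \<and> closedin zariski M \<and> connectedin zariski M \<and> (\<forall>p\<in>M. smooth_at M p)"

section \<open>Regular and analytic functions and vector fields\<close>

text \<open>Functions and vector fields on a subset \<open>W\<close> of \<open>M\<close> are total functions on the ambient
  space of which only the values on \<open>W\<close> matter.\<close>

definition regular_on :: "(complex^'n) set \<Rightarrow> (complex^'n \<Rightarrow> complex) \<Rightarrow> bool" where
  "regular_on W f \<longleftrightarrow>
     (\<forall>p\<in>W. \<exists>a\<in>polys. \<exists>b\<in>polys. b p \<noteq> 0 \<and> (\<forall>x\<in>W. b x \<noteq> 0 \<longrightarrow> f x = a x / b x))"

definition holo_on :: "(complex^'n) set \<Rightarrow> (complex^'n \<Rightarrow> complex) \<Rightarrow> bool" where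
  "holo_on B F \<longleftrightarrow>
     (\<forall>x\<in>B. \<exists>F'. (F has_derivative F') (at x) \<and> (\<forall>c v. F' (c *s v) = c * F' v))"

definition analytic_fun_on :: "(complex^'n) set \<Rightarrow> (complex^'n \<Rightarrow> complex) \<Rightarrow> bool" where
  "analytic_fun_on V f \<longleftrightarrow>
     (\<forall>p\<in>V. \<exists>B F. open B \<and> p \<in> B \<and> holo_on B F \<and> (\<forall>x\<in>B \<inter> V. f x = F x))"

type_synonym 'n vfield = "complex^'n \<Rightarrow> complex^'n"

definition regular_vf :: "(complex^'n) set \<Rightarrow> (complex^'n) set \<Rightarrow> 'n vfield \<Rightarrow> bool" where
  "regular_vf M W X \<longleftrightarrow>
     (\<forall>i. regular_on W (\<lambda>x. X x $ i)) \<and> (\<forall>p\<in>W. X p \<in> tangent_space M p)"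

definition analytic_vf :: "(complex^'n) set \<Rightarrow> (complex^'n) set \<Rightarrow> 'n vfield \<Rightarrow> bool" where
  "analytic_vf M V X \<longleftrightarrow>
     (\<forall>i. analytic_fun_on V (\<lambda>x. X x $ i)) \<and> (\<forall>p\<in>V. X p \<in> tangent_space M p)"

text \<open>The derivative along \<open>M\<close> at \<open>p\<close> of a (scalar or vector valued) function in the direction
  \<open>v\<close>. The derivative within \<open>M\<close> is not unique as a linear map on the ambient space, but at a
  smooth point it is unique on tangent vectors, the only directions in which it is used. It only
  depends on the germ at \<open>p\<close> of the restriction of the function to \<open>M\<close>.\<close>
definition deriv_along ::
  "(complex^'n) set \<Rightarrow> (complex^'n \<Rightarrow> 'b::real_normed_vector) \<Rightarrow> complex^'n \<Rightarrow> complex^'n \<Rightarrow> 'b" where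
  "deriv_along M f p v = frechet_derivative f (at p within M) v"

definition lie_bracket :: "(complex^'n) set \<Rightarrow> 'n vfield \<Rightarrow> 'n vfield \<Rightarrow> 'n vfield" where
  "lie_bracket M X Y = (\<lambda>p. deriv_along M Y p (X p) - deriv_along M X p (Y p))"

section \<open>Linear connections on the tangent bundle\<close>

type_synonym 'n covder = "'n vfield \<Rightarrow> 'n vfield \<Rightarrow> 'n vfield"

text \<open>A linear connection on the restriction of the tangent bundle to the Zariski open \<open>U \<subseteq> M\<close>, as
  a covariant derivative on the sheaf of regular vector fields. Since fields are total functions,
  the single operator \<open>nabla\<close> stands for its values on all Zariski open \<open>W \<subseteq> U\<close> at once,
  compatibly with restriction.\<close>
definition linear_connection_on ::
  "(complex^'n) set \<Rightarrow> (complex^'n) set \<Rightarrow> 'n covder \<Rightarrow> bool" where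
  "linear_connection_on M U nabla \<longleftrightarrow> openin (subtopology zariski M) U \<and>
     (\<forall>W. openin (subtopology zariski M) W \<and> W \<subseteq> U \<longrightarrow>
       (\<forall>X Y. regular_vf M W X \<and> regular_vf M W Y \<longrightarrow>
          regular_vf M W (nabla X Y) \<and>
          (\<forall>X' Y'. (\<forall>p\<in>W. X' p = X p \<and> Y' p = Y p) \<longrightarrow> (\<forall>p\<in>W. nabla X' Y' p = nabla X Y p)) \<and>
          (\<forall>Z. regular_vf M W Z \<longrightarrow> (\<forall>p\<in>W.
             nabla (\<lambda>q. X q + Z q) Y p = nabla X Y p + nabla Z Y p \<and>
             nabla X (\<lambda>q. Y q + Z q) p = nabla X Y p + nabla X Z p)) \<and>
          (\<forall>f. regular_on W f \<longrightarrow> (\<forall>p\<in>W.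
             nabla (\<lambda>q. f q *s X q) Y p = f p *s nabla X Y p \<and>
             nabla X (\<lambda>q. f q *s Y q) p =
               deriv_along M f p (X p) *s Y p + f p *s nabla X Y p))))"

text \<open>A rational connection is a connection that is regular on some nonempty (hence dense) Zariski
  open set \<open>U\<close>, which is kept as part of the data.\<close>

definition regular_connection :: "(complex^'n) set \<Rightarrow> 'n covder \<Rightarrow> bool" where
  "regular_connection M nabla \<longleftrightarrow> linear_connection_on M M nabla"

definition rational_connection ::
  "(complex^'n) set \<Rightarrow> (complex^'n) set \<Rightarrow> 'n covder \<Rightarrow> bool" where
  "rational_connection M U nabla \<longleftrightarrow> U \<noteq> {} \<and> linear_connection_on M U nabla"

definition reciprocal :: "(complex^'n) set \<Rightarrow> 'n covder \<Rightarrow> 'n covder" where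
  "reciprocal M nabla = (\<lambda>X Y p. nabla Y X p + lie_bracket M X Y p)"

definition torsion :: "(complex^'n) set \<Rightarrow> 'n covder \<Rightarrow> 'n vfield \<Rightarrow> 'n vfield \<Rightarrow> 'n vfield" where
  "torsion M nabla = (\<lambda>X Y p. nabla X Y p - nabla Y X p - lie_bracket M X Y p)"

definition curvature ::
  "(complex^'n) set \<Rightarrow> 'n covder \<Rightarrow> 'n vfield \<Rightarrow> 'n vfield \<Rightarrow> 'n vfield \<Rightarrow> 'n vfield" where
  "curvature M nabla = (\<lambda>X Y Z p.
     nabla X (nabla Y Z) p - nabla Y (nabla X Z) p - nabla (lie_bracket M X Y) Z p)"

definition nabla_torsion ::
  "(complex^'n) set \<Rightarrow> 'n covder \<Rightarrow> 'n vfield \<Rightarrow> 'n vfield \<Rightarrow> 'n vfield \<Rightarrow> 'n vfield" where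
  "nabla_torsion M nabla = (\<lambda>X Y Z p.
     nabla X (torsion M nabla Y Z) p
       - torsion M nabla (nabla X Y) Z p - torsion M nabla Y (nabla X Z) p)"

definition flat :: "(complex^'n) set \<Rightarrow> (complex^'n) set \<Rightarrow> 'n covder \<Rightarrow> bool" where
  "flat M U nabla \<longleftrightarrow>
     (\<forall>W X Y Z. openin (subtopology zariski M) W \<and> W \<subseteq> U \<and>
        regular_vf M W X \<and> regular_vf M W Y \<and> regular_vf M W Z \<longrightarrow>
        (\<forall>p\<in>W. curvature M nabla X Y Z p = 0))"

definition constant_torsion :: "(complex^'n) set \<Rightarrow> (complex^'n) set \<Rightarrow> 'n covder \<Rightarrow> bool" where
  "constant_torsion M U nabla \<longleftrightarrow>
     (\<forall>W X Y Z. openin (subtopology zariski M) W \<and> W \<subseteq> U \<and>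
        regular_vf M W X \<and> regular_vf M W Y \<and> regular_vf M W Z \<longrightarrow>
        (\<forall>p\<in>W. nabla_torsion M nabla X Y Z p = 0))"

section \<open>Horizontal analytic vector fields and Lie connections\<close>

text \<open>The extension of \<open>nabla\<close> to analytic vector fields: \<open>w\<close> is the covariant derivative of \<open>Y\<close>
  at \<open>p\<close> in the direction \<open>v\<close> if, writing \<open>Y = \<Sum>i<k. f i *s E i\<close> near \<open>p\<close> with \<open>f i\<close> analytic and
  \<open>E i\<close> regular, and extending \<open>v\<close> to a regular vector field \<open>A\<close>, the Leibniz rule gives \<open>w\<close>.
  The value does not depend on these choices. Here \<open>Z\<close> is Zariski open and \<open>V\<close> is open in the
  analytic topology.\<close>
definition has_covariant_derivative ::
  "(complex^'n) set \<Rightarrow> (complex^'n) set \<Rightarrow> 'n covder \<Rightarrow>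
   'n vfield \<Rightarrow> complex^'n \<Rightarrow> complex^'n \<Rightarrow> complex^'n \<Rightarrow> bool" where
  "has_covariant_derivative M U nabla Y p v w \<longleftrightarrow>
     (\<exists>Z V A (k::nat) E f. openin (subtopology zariski M) Z \<and> Z \<subseteq> U \<and>
        openin (top_of_set M) V \<and> V \<subseteq> Z \<and> p \<in> V \<and>
        regular_vf M Z A \<and> A p = v \<and>
        (\<forall>i<k. regular_vf M Z (E i) \<and> analytic_fun_on V (f i)) \<and>
        (\<forall>q\<in>V. Y q = (\<Sum>i<k. f i q *s E i q)) \<and>
        w = (\<Sum>i<k. deriv_along M (f i) p v *s E i p + f i p *s nabla A (E i) p))"

definition horizontal ::
  "(complex^'n) set \<Rightarrow> (complex^'n) set \<Rightarrow> 'n covder \<Rightarrow> (complex^'n) set \<Rightarrow> 'n vfield \<Rightarrow> bool" where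
  "horizontal M U nabla V Y \<longleftrightarrow> analytic_vf M V Y \<and>
     (\<forall>p\<in>V. \<forall>v\<in>tangent_space M p. has_covariant_derivative M U nabla Y p v 0)"

definition lie_connection :: "(complex^'n) set \<Rightarrow> (complex^'n) set \<Rightarrow> 'n covder \<Rightarrow> bool" where
  "lie_connection M U nabla \<longleftrightarrow> linear_connection_on M U nabla \<and> flat M U nabla \<and>
     (\<forall>V X Y. openin (top_of_set M) V \<and> V \<subseteq> U \<and>
        horizontal M U nabla V X \<and> horizontal M U nabla V Y \<longrightarrow>
        horizontal M U nabla V (lie_bracket M X Y))"

end

(*
  The curvature of the reciprocal connection satisfies
    R^rec(X,Y)Z = (nabla_Z Tor)(X,Y) + R(X,Z)Y - R(Y,Z)X,
  by the Jacobi identity alone, so (3) and (4) are equivalent; and the reciprocal of the reciprocal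
  is the original connection. It remains to compare (1) with (3). For horizontal fields X, Y one has
  [X,Y] = -Tor(X,Y), whose covariant derivative along A is -(nabla_A Tor)(X,Y): constant torsion
  makes brackets of horizontal fields horizontal, and the converse holds because a flat connection
  has a horizontal field through every tangent vector.

  All of this is done in coordinates adapted to M: near a smooth point M is a graph over some of
  the ambient coordinates, and lifting the corresponding coordinate fields gives a regular
  commuting frame e of the tangent bundle in which X = sum X_a e_a, where X_a is the a-th ambient
  component of X. Horizontal fields come from a real C^1 Frobenius theorem for linear systems
  dy = A(x)(.) y; their holomorphy is automatic because A is complex linear in the direction.
*)

theory Submission
  imports Defs
begin

text \<open>The main obstacle is that \<open>nabla\<close> is known only on regular fields, whereas
  horizontal fields are merely analytic, so neither \<open>nabla\<close> nor \<open>torsion\<close>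
  may be applied to them. Horizontal fields are therefore handled through their components in an
  algebraic frame (\<open>frame_covd\<close>), and tensor identities reach them by expansion at a
  single point. This is why the frame has to be regular on a Zariski open set, and not just analytic
  in a chart. A second obstacle is \<open>deriv_along\<close>: a derivative within \<open>M\<close>
  is determined only on tangent vectors, so each rule of the calculus rests on uniqueness along
  curves in \<open>M\<close>. Symmetry of second derivatives is never invoked: the bracket is
  identified with a commutator of derivations by comparing both on coordinate functions. Analyticity
  of the bracket of horizontal fields is read off the torsion formula instead of being obtained by
  differentiating analytic components. In the Frobenius argument the solution is defined along rays
  from the base point, and flatness makes it satisfy the equation in the remaining directions
  too.\<close>

section \<open>Flat linear systems\<close>

text \<open>The equations along all rays are solved by one fixed point argument for
  \<open>y x = v + integral over t in {0..1} of A (t x) x (y (t x))\<close>, so that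
  \<open>y\<close> comes out continuous in \<open>x\<close>. The bound \<open>small\<close> makes
  this operator a contraction with constant 1/2.\<close>

lemma radial_integral_equation:
  fixes A :: "'a::euclidean_space \<Rightarrow> 'a \<Rightarrow> 'b::banach \<Rightarrow> 'b"
  assumes r: "0 < r"
    and contA: "continuous_on ({0..1} \<times> cball 0 r \<times> UNIV) (\<lambda>(t, x, h). A (t *\<^sub>R x) x h)"
    and diff: "\<And>x w h k. A x w (h - k) = A x w h - A x w k"
    and homog: "\<And>x w h c. A x (c *\<^sub>R w) h = c *\<^sub>R A x w h"
    and small: "\<And>x w h. x \<in> cball 0 r \<Longrightarrow> w \<in> cball 0 r \<Longrightarrow> norm (A x w h) \<le> norm h / 2"
  obtains y where "continuous_on (cball 0 r) y" "y 0 = v"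
    "\<And>x s. x \<in> cball 0 r \<Longrightarrow> s \<in> {0..1} \<Longrightarrow>
       ((\<lambda>t. y (t *\<^sub>R x)) has_vector_derivative A (s *\<^sub>R x) x (y (s *\<^sub>R x))) (at s within {0..1})"
proof -
  \<comment> \<open>The nearest point retraction onto the ball lets the operator act on bounded
    continuous functions of the whole space, where the contraction principle applies.\<close>
  define c where "c = closest_point (cball (0::'a) r)"
  have c_in: "c x \<in> cball 0 r" for x
    unfolding c_def using r by (intro closest_point_in_set) auto
  have norm_c: "norm (c x) \<le> r" for x using c_in[of x] by simp
  have c_id: "c x = x" if "x \<in> cball 0 r" for x
    unfolding c_def using that by (rule closest_point_self)
  have contc: "continuous_on S c" for S
    unfolding c_def using r by (intro continuous_on_closest_point) auto
  have tc: "t *\<^sub>R x \<in> cball 0 r" if "x \<in> cball 0 r" "t \<in> {0..1}" for t :: real and x :: 'a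
    using that mult_left_le_one_le[of "norm x" t] by auto
  have cont1: "continuous_on (UNIV \<times> {0..1}) (\<lambda>(x, t). A (t *\<^sub>R c x) (c x) (y (t *\<^sub>R c x)))"
    if y: "continuous_on UNIV y" for y
  proof -
    have "continuous_on (UNIV \<times> {0..1}) (\<lambda>z. (\<lambda>(t, x, h). A (t *\<^sub>R x) x h)
        (snd z, c (fst z), y (snd z *\<^sub>R c (fst z))))"
      by (rule continuous_on_compose2[OF contA])
        (use r in \<open>auto intro!: continuous_intros continuous_on_compose2[OF contc]
          continuous_on_compose2[OF y] simp: norm_c\<close>)
    then show ?thesis by (simp add: case_prod_unfold)
  qed
  have cont2: "continuous_on {0..1} (\<lambda>t. A (t *\<^sub>R x) x (y (t *\<^sub>R x)))"
    if y: "continuous_on UNIV y" and x: "x \<in> cball 0 r" for y x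
  proof -
    have "continuous_on {0..1} (\<lambda>t. (\<lambda>(x, t). A (t *\<^sub>R c x) (c x) (y (t *\<^sub>R c x))) (x, t))"
      by (rule continuous_on_compose2[OF cont1[OF y]]) (auto intro!: continuous_intros)
    then show ?thesis by (simp add: c_id[OF x])
  qed
  have bnd: "norm (A (t *\<^sub>R x) x h) \<le> norm h / 2" if "x \<in> cball 0 r" "t \<in> {0..1}" for t x h
    by (rule small[OF tc[OF that] that(1)])
  define T where "T y x = v + integral {0..1} (\<lambda>t. A (t *\<^sub>R c x) (c x) (y (t *\<^sub>R c x)))" for y x
  have T_bc: "T (apply_bcontfun f) \<in> bcontfun" for f :: "'a \<Rightarrow>\<^sub>C 'b"
  proof (rule bcontfun_normI)
    have "continuous_on UNIV (\<lambda>x. integral (cbox 0 1)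
        (\<lambda>t. A (t *\<^sub>R c x) (c x) (f (t *\<^sub>R c x))))"
      by (rule integral_continuous_on_param) (use cont1[of f] in simp)
    then show "continuous_on UNIV (T (apply_bcontfun f))"
      unfolding T_def by (auto intro!: continuous_intros)
    fix x
    have "norm (integral {0..1} (\<lambda>t. A (t *\<^sub>R c x) (c x) (f (t *\<^sub>R c x)))) \<le> norm f / 2 * (1 - 0)"
    proof (rule integral_bound)
      show "norm (A (t *\<^sub>R c x) (c x) (f (t *\<^sub>R c x))) \<le> norm f / 2" if "t \<in> {0..1}" for t
        using bnd[OF c_in that, of x "f (t *\<^sub>R c x)"] norm_bounded[of f "t *\<^sub>R c x"] by simp
    qed (use cont2[of f, OF _ c_in] in auto)
    then show "norm (T (apply_bcontfun f) x) \<le> norm v + norm f / 2"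
      unfolding T_def by (intro norm_triangle_le) simp
  qed
  have T_dist: "dist (T (apply_bcontfun f) x) (T (apply_bcontfun g) x) \<le> 1/2 * dist f g"
    for f g :: "'a \<Rightarrow>\<^sub>C 'b" and x
  proof -
    let ?I = "\<lambda>f t. A (t *\<^sub>R c x) (c x) (apply_bcontfun f (t *\<^sub>R c x))"
    have co: "continuous_on {0..1} (?I f)" for f
      by (rule cont2[OF _ c_in]) simp
    have "norm (integral {0..1} (\<lambda>t. ?I f t - ?I g t)) \<le> dist f g / 2 * (1 - 0)"
    proof (rule integral_bound)
      show "norm (?I f t - ?I g t) \<le> dist f g / 2" if "t \<in> {0..1}" for t
        using bnd[OF c_in that, of x "f (t *\<^sub>R c x) - g (t *\<^sub>R c x)"]
          dist_bounded[of f "t *\<^sub>R c x" g] by (simp add: diff dist_norm)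
    qed (use co in \<open>auto intro!: continuous_intros\<close>)
    then show ?thesis
      unfolding T_def dist_norm
      by (subst (asm) integral_diff) (auto intro: integrable_continuous_real co)
  qed
  have "\<exists>!f. Bcontfun (T (apply_bcontfun f)) = f"
  proof (rule banach_fix_type[where c = "1/2"]; (intro allI)?)
    show "dist (Bcontfun (T (apply_bcontfun f))) (Bcontfun (T (apply_bcontfun g))) \<le> 1/2 * dist f g"
      for f g
      by (rule dist_bound) (use T_dist[of f _ g] in \<open>simp add: Bcontfun_inverse[OF T_bc]\<close>)
  qed simp_all
  then obtain f where f: "Bcontfun (T (apply_bcontfun f)) = f" by blast
  define y where "y = apply_bcontfun f"
  have yT: "y x = T y x" for x
    using f Bcontfun_inverse[OF T_bc, of f] unfolding y_def by metis
  have cy: "continuous_on S y" for S unfolding y_def by simp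
  show ?thesis
  proof (rule that[of y])
    \<comment> \<open>By \<open>homog\<close> the integrand vanishes at \<open>x = 0\<close>, which
      leaves the initial value.\<close>
    have "A 0 0 h = 0" for h using homog[of 0 0 0 h] by simp
    then show "y 0 = v" using r by (subst yT) (simp add: T_def c_id)
    fix x :: 'a and s assume x: "x \<in> cball 0 r" and s: "s \<in> {0..1::real}"
    define \<phi> where "\<phi> = (\<lambda>t. A (t *\<^sub>R x) x (y (t *\<^sub>R x)))"
    have c\<phi>: "continuous_on {0..1} \<phi>" unfolding \<phi>_def by (rule cont2[OF cy x])
    have d: "((\<lambda>u. integral {0..u} \<phi>) has_vector_derivative \<phi> t) (at t within {0..1})"
      if "t \<in> {0..1}" for t
      using integral_has_vector_derivative[OF c\<phi> that] .
    have eq: "y (s *\<^sub>R x) = v + integral {0..s} \<phi>" if s: "s \<in> {0..1}" for s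
    proof -
      \<comment> \<open>Substitution \<open>t \<mapsto> t * s\<close>: the integrand along the ray
        to \<open>s x\<close> is the derivative of the primitive of \<open>\<phi>\<close> evaluated
        at \<open>t * s\<close>.\<close>
      have "((\<lambda>t. s *\<^sub>R \<phi> (t * s)) has_integral integral {0..1 * s} \<phi> - integral {0..0 * s} \<phi>) {0..1}"
      proof (rule fundamental_theorem_of_calculus)
        fix t assume t: "t \<in> {0..1::real}"
        have ts: "t * s \<in> {0..1}" if "t \<in> {0..1}" for t
          using that s by (auto simp: mult_le_one)
        have "((\<lambda>t. integral {0..t * s} \<phi>) has_derivative (\<lambda>h. (h * s) *\<^sub>R \<phi> (t * s))) (at t within {0..1})"
          by (rule has_derivative_in_compose2[where f = "\<lambda>t. t * s" and t = "{0..1}" and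
              g' = "\<lambda>t h. h *\<^sub>R \<phi> t"])
            (use ts t d in \<open>auto simp: has_vector_derivative_def intro!: derivative_eq_intros\<close>)
        then show "((\<lambda>t. integral {0..t * s} \<phi>) has_vector_derivative s *\<^sub>R \<phi> (t * s)) (at t within {0..1})"
          by (simp add: has_vector_derivative_def)
      qed simp
      then have "integral {0..1} (\<lambda>t. s *\<^sub>R \<phi> (t * s)) = integral {0..s} \<phi>"
        by (intro integral_unique) simp
      moreover have "y (s *\<^sub>R x) = v + integral {0..1} (\<lambda>t. s *\<^sub>R \<phi> (t * s))"
        by (subst yT) (simp add: T_def c_id[OF tc[OF x s]] \<phi>_def homog)
      ultimately show ?thesis by metis
    qed
    have "((\<lambda>t. v + integral {0..t} \<phi>) has_vector_derivative \<phi> s) (at s within {0..1})"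
      using d[OF s] by (auto intro!: derivative_eq_intros)
    then have "((\<lambda>t. y (t *\<^sub>R x)) has_vector_derivative \<phi> s) (at s within {0..1})"
      by (rule has_vector_derivative_transform[OF s, rotated]) (simp add: eq)
    then show "((\<lambda>t. y (t *\<^sub>R x)) has_vector_derivative A (s *\<^sub>R x) x (y (s *\<^sub>R x))) (at s within {0..1})"
      unfolding \<phi>_def .
  qed (rule cy)
qed

text \<open>At a maximum \<open>s\<close> of \<open>norm (u t)\<close> the mean value inequality
  gives \<open>norm (u s) \<le> norm (u s) / 2 + B\<close>, and half of the left side is absorbed.
  On the unit interval this takes the place of Gronwall's inequality.\<close>

lemma small_if_derivative_small:
  fixes u :: "real \<Rightarrow> 'b::real_normed_vector"
  assumes u: "\<And>t. t \<in> {0..1} \<Longrightarrow> (u has_vector_derivative u' t) (at t within {0..1})"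
    and "u 0 = 0" and bnd: "\<And>t. t \<in> {0..1} \<Longrightarrow> norm (u' t) \<le> norm (u t) / 2 + B" and t: "t \<in> {0..1}"
  shows "norm (u t) \<le> 2 * B"
proof -
  have "continuous_on {0..1} (\<lambda>t. norm (u t))"
    using u by (intro continuous_on_norm continuous_on_vector_derivative)
  then obtain s where s: "s \<in> {0..1}" "\<And>t. t \<in> {0..1} \<Longrightarrow> norm (u t) \<le> norm (u s)"
    using continuous_attains_sup[of "{0..1}" "\<lambda>t. norm (u t)"] by auto
  have B: "norm (u' x) \<le> norm (u s) / 2 + B" if "x \<in> {0..1}" for x
    using bnd[OF that] s(2)[OF that] by linarith
  have "norm (u s - u 0) \<le> (norm (u s) / 2 + B) * norm (s - 0)"
    by (rule differentiable_bound[where S = "{0..1}" and f' = "\<lambda>t h. h *\<^sub>R u' t"])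
      (use u s B in \<open>auto simp: has_vector_derivative_def onorm_scaleR_left onorm_id\<close>)
  also have "\<dots> \<le> (norm (u s) / 2 + B) * 1"
    using s(1) B[of 0] by (intro mult_left_mono) (auto intro: order_trans[OF norm_ge_zero])
  finally show ?thesis using s(2)[OF t] \<open>u 0 = 0\<close> by simp
qed

text \<open>The remainder must be small simultaneously at all points of a ray, so pointwise
  differentiability is not enough. Uniform continuity of \<open>G'\<close> on the compact set,
  together with the mean value inequality on segments, makes \<open>\<delta>\<close> independent of
  \<open>p\<close>.\<close>

lemma uniform_differentiability:
  fixes G :: "'a::euclidean_space \<Rightarrow> 'g::real_normed_vector" and G' :: "'a \<Rightarrow> 'a \<Rightarrow>\<^sub>L 'g"
  assumes der: "\<And>x. x \<in> S \<Longrightarrow> (G has_derivative G' x) (at x)" and cont: "continuous_on S G'"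
    and "compact S" "convex S" "\<eta> > 0"
  obtains \<delta> where "\<delta> > 0" "\<And>p k. p \<in> S \<Longrightarrow> p + k \<in> S \<Longrightarrow> norm k < \<delta> \<Longrightarrow>
    norm (G (p + k) - G p - G' p k) \<le> \<eta> * norm k"
proof -
  have "uniformly_continuous_on S G'"
    using compact_uniformly_continuous[OF cont \<open>compact S\<close>] .
  then obtain \<delta> where \<delta>: "\<delta> > 0"
    "\<And>x y. x \<in> S \<Longrightarrow> y \<in> S \<Longrightarrow> dist y x < \<delta> \<Longrightarrow> dist (G' y) (G' x) < \<eta>"
    using \<open>\<eta> > 0\<close> unfolding uniformly_continuous_on_def by metis
  have "norm (G (p + k) - G p - G' p k) \<le> \<eta> * norm k" if p: "p \<in> S" "p + k \<in> S" "norm k < \<delta>" for p k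
  proof -
    have seg: "p + t *\<^sub>R (p + k - p) \<in> S \<inter> ball p \<delta>" if "t \<in> {0..1}" for t
    proof
      show "p + t *\<^sub>R (p + k - p) \<in> S"
        using convexD_alt[OF \<open>convex S\<close> p(1,2), of t] that by (simp add: algebra_simps)
      show "p + t *\<^sub>R (p + k - p) \<in> ball p \<delta>"
        using that p(3) mult_left_le_one_le[of "norm k" t] by (simp add: dist_norm)
    qed
    have "norm (G (p + k) - G p - G' p (p + k - p)) \<le> norm (p + k - p) * \<eta>"
    proof (rule differentiable_bound_linearization[OF seg])
      fix x assume x: "x \<in> S \<inter> ball p \<delta>"
      then show "(G has_derivative G' x) (at x within S \<inter> ball p \<delta>)"
        using der[of x] has_derivative_at_withinI by blast
      have "onorm (blinfun_apply (G' x) - blinfun_apply (G' p)) = norm (G' x - G' p)"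
        by (simp add: norm_blinfun.rep_eq minus_blinfun.rep_eq fun_diff_def)
      also have "\<dots> \<le> \<eta>"
        using \<delta>(2)[OF p(1), of x] x by (simp add: dist_norm norm_minus_commute less_imp_le)
      finally show "onorm (blinfun_apply (G' x) - blinfun_apply (G' p)) \<le> \<eta>" .
    qed (use p(1) \<delta>(1) in auto)
    then show ?thesis by (simp add: mult.commute)
  qed
  with \<delta>(1) that show ?thesis by blast
qed

text \<open>Along each ray from \<open>a\<close> the system is an ordinary differential equation, which defines \<open>y\<close>.
  The defect \<open>u t = y (t (x + w)) - y (t x) - t A(t x) w (y (t x))\<close> satisfies \<open>u 0 = 0\<close> and, by
  flatness, \<open>u' = A (x + w) u + o(w)\<close>, so \<open>u 1 = o(w)\<close>.\<close>
lemma flat_linear_system: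
  fixes G :: "'a::euclidean_space \<Rightarrow> 'g::real_normed_vector" and G' :: "'a \<Rightarrow> 'a \<Rightarrow>\<^sub>L 'g"
    and \<alpha> :: "'g \<Rightarrow> 'a \<Rightarrow> 'm::real_normed_vector" and \<gamma> :: "'m \<Rightarrow> 'b \<Rightarrow> 'b::banach"
  assumes "bounded_bilinear \<alpha>" "bounded_bilinear \<gamma>" and S: "open S" "a \<in> S"
    and der: "\<And>x. x \<in> S \<Longrightarrow> (G has_derivative G' x) (at x)" and cont: "continuous_on S G'"
    and flat: "\<And>x u w h. x \<in> S \<Longrightarrow>
      \<gamma> (\<alpha> (G' x w) u) h + \<gamma> (\<alpha> (G x) u) (\<gamma> (\<alpha> (G x) w) h) =
      \<gamma> (\<alpha> (G' x u) w) h + \<gamma> (\<alpha> (G x) w) (\<gamma> (\<alpha> (G x) u) h)"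
  obtains r y where "r > 0" "ball a r \<subseteq> S" "y a = v"
    "\<And>x. x \<in> ball a r \<Longrightarrow> (y has_derivative (\<lambda>w. \<gamma> (\<alpha> (G x) w) (y x))) (at x)"
proof -
  interpret \<alpha>: bounded_bilinear \<alpha> by fact
  interpret \<gamma>: bounded_bilinear \<gamma> by fact
  define \<beta> where "\<beta> g w h = \<gamma> (\<alpha> g w) h" for g w h
  note lin = \<beta>_def \<alpha>.add_left \<alpha>.add_right \<gamma>.add_left \<gamma>.add_right \<alpha>.diff_left \<alpha>.diff_right
    \<gamma>.diff_left \<gamma>.diff_right \<alpha>.scaleR_left \<alpha>.scaleR_right \<gamma>.scaleR_left \<gamma>.scaleR_right
  obtain K1 where K1: "0 < K1" "\<And>g w. norm (\<alpha> g w) \<le> norm g * norm w * K1" using \<alpha>.pos_bounded by blast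
  obtain K2 where K2: "0 < K2" "\<And>m h. norm (\<gamma> m h) \<le> norm m * norm h * K2" using \<gamma>.pos_bounded by blast
  define K where "K = K1 * K2"
  have K: "0 < K" using K1 K2 by (simp add: K_def)
  have \<beta>: "norm (\<beta> g w h) \<le> K * norm g * norm w * norm h" for g w h
  proof -
    have "norm (\<beta> g w h) \<le> norm (\<alpha> g w) * norm h * K2" unfolding \<beta>_def by (rule K2)
    also have "\<dots> \<le> norm g * norm w * K1 * norm h * K2"
      using K2(1) by (intro mult_right_mono K1) auto
    finally show ?thesis by (simp add: K_def mult_ac)
  qed
  have \<beta>_le: "norm (\<beta> g w h) \<le> K * g0 * w0 * h0"
    if "norm g \<le> g0" "norm w \<le> w0" "norm h \<le> h0" for g w h g0 w0 h0
  proof -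
    have "0 \<le> g0" "0 \<le> w0" using that norm_ge_zero order_trans by blast+
    then show ?thesis
      using that K by (intro order_trans[OF \<beta>] mult_mono) auto
  qed
  obtain R where R: "R > 0" "cball a R \<subseteq> S" using S open_contains_cball by blast
  have cG: "continuous_on S G" using der by (meson differentiable_at_imp_differentiable_on differentiableI differentiable_imp_continuous_on differentiable_on_def has_derivative_at_withinI)
  have "compact (G ` cball a R)" "compact (G' ` cball a R)"
    using R by (auto intro!: compact_continuous_image intro: continuous_on_subset[OF cG] continuous_on_subset[OF cont])
  then obtain C C' where C: "\<And>x. x \<in> cball a R \<Longrightarrow> norm (G x) \<le> C"
    and C': "\<And>x. x \<in> cball a R \<Longrightarrow> norm (G' x) \<le> C'"
    using bounded_iff compact_imp_bounded by (metis image_eqI)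
  have C0: "0 \<le> C" "0 \<le> C'" using C[of a] C'[of a] R(1) norm_ge_zero order_trans by (auto intro: order_trans[OF norm_ge_zero])
  \<comment> \<open>The radius yields \<open>K * C * r \<le> 1/2\<close>, the smallness required
    both by the radial equation and by the estimate of the defect. The \<open>+ 1\<close> covers the
    case \<open>K * C = 0\<close>.\<close>
  define r where "r = min R (1 / (2 * (K * C + 1)))"
  have KC: "0 \<le> K * C" using K C0 by simp
  have r: "0 < r" "r \<le> R" using KC R(1) by (auto simp: r_def)
  have "K * C * r \<le> K * C * (1 / (2 * (K * C + 1)))" using KC by (intro mult_left_mono) (auto simp: r_def)
  also have "\<dots> \<le> 1/2" using KC by (simp add: divide_simps)
  finally have KCr: "K * C * r \<le> 1/2" .
  have sub: "a + x \<in> cball a R" if "x \<in> cball 0 r" for x using that r(2) by (simp add: dist_norm)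
  have subS: "a + x \<in> S" if "x \<in> cball 0 r" for x using sub[OF that] R(2) by blast
  have tr: "t *\<^sub>R x \<in> cball 0 r" if "x \<in> cball 0 r" "t \<in> {0..1}" for t :: real and x :: 'a
    using that mult_left_le_one_le[of "norm x" t] by auto
  obtain y where y: "continuous_on (cball 0 r) y" "y 0 = v"
    "\<And>x s. x \<in> cball 0 r \<Longrightarrow> s \<in> {0..1} \<Longrightarrow>
       ((\<lambda>t. y (t *\<^sub>R x)) has_vector_derivative \<beta> (G (a + s *\<^sub>R x)) x (y (s *\<^sub>R x))) (at s within {0..1})"
  proof (rule radial_integral_equation[OF r(1), where A = "\<lambda>x. \<beta> (G (a + x))" and v = v])
    have "(\<lambda>z. a + fst z *\<^sub>R fst (snd z)) ` ({0..1} \<times> cball 0 r \<times> (UNIV :: 'b set)) \<subseteq> S"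
      using subS tr by force
    then show "continuous_on ({0..1} \<times> cball 0 r \<times> UNIV) (\<lambda>(t, x, h). \<beta> (G (a + t *\<^sub>R x)) x h)"
      unfolding \<beta>_def case_prod_unfold
      by (intro \<alpha>.continuous_on \<gamma>.continuous_on continuous_on_compose2[OF cG] continuous_intros)
    show "norm (\<beta> (G (a + x)) w h) \<le> norm h / 2" if "x \<in> cball 0 r" "w \<in> cball 0 r" for x w h
    proof -
      have "norm (\<beta> (G (a + x)) w h) \<le> K * C * r * norm h"
        using that by (intro \<beta>_le C sub) auto
      also have "\<dots> \<le> 1/2 * norm h" by (intro mult_right_mono KCr) auto
      finally show ?thesis by simp
    qed
  qed (auto simp: lin intro: that)
  obtain Y where Y: "\<And>x. x \<in> cball 0 r \<Longrightarrow> norm (y x) \<le> Y"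
    using compact_imp_bounded[OF compact_continuous_image[OF y(1) compact_cball]] bounded_iff by (metis image_eqI)
  have Y0: "0 \<le> Y" using Y[of 0] r(1) by (auto intro: order_trans[OF norm_ge_zero])
  have der_y: "(y has_derivative (\<lambda>w. \<beta> (G (a + x)) w (y x))) (at x)" if x: "norm x < r" for x
    unfolding has_derivative_at_alt
  proof (intro conjI allI impI)
    show "bounded_linear (\<lambda>w. \<beta> (G (a + x)) w (y x))"
      unfolding \<beta>_def by (rule bounded_linear_compose[OF \<gamma>.bounded_linear_left \<alpha>.bounded_linear_right])
    fix e :: real assume e: "e > 0"
    \<comment> \<open>\<open>B1\<close> collects the coefficients of the three error terms quadratic
      in \<open>w\<close>, and \<open>B2\<close> that of the term coming from the Taylor remainder
      of \<open>G\<close>. With \<open>\<eta>\<close> and \<open>d\<close> chosen below, each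
      contributes at most \<open>e / 4\<close> per unit of \<open>norm w\<close>, and
      \<open>small_if_derivative_small\<close> doubles the sum.\<close>
    define B1 where "B1 = K * C * 1 * (K * C * 1 * Y) + K * C' * 1 * Y + K * C' * r * (K * C * 1 * Y)"
    define B2 where "B2 = K * 1 * r * (Y + K * C * r * Y)"
    have B: "0 \<le> B1" "0 \<le> B2" unfolding B1_def B2_def using K C0 Y0 r(1)
      by (auto intro!: add_nonneg_nonneg mult_nonneg_nonneg)
    define \<eta> where "\<eta> = e / (4 * (B2 + 1))"
    have \<eta>: "\<eta> > 0" using e B by (simp add: \<eta>_def)
    obtain \<delta> where \<delta>: "\<delta> > 0" "\<And>p k. p \<in> cball a R \<Longrightarrow> p + k \<in> cball a R \<Longrightarrow> norm k < \<delta> \<Longrightarrow>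
      norm (G (p + k) - G p - G' p k) \<le> \<eta> * norm k"
      by (rule uniform_differentiability[of "cball a R" G G' \<eta>])
        (use R(2) der \<eta> in \<open>auto intro: continuous_on_subset[OF cont]\<close>)
    define d where "d = min (min \<delta> (r - norm x)) (min r (e / (4 * (B1 + 1))))"
    have d: "d > 0" using \<delta>(1) x r(1) e B by (simp add: d_def)
    moreover have "norm (y z - y x - \<beta> (G (a + x)) (z - x) (y x)) \<le> e * norm (z - x)"
      if z: "norm (z - x) < d" for z
    proof -
      define w where "w = z - x"
      have w: "norm w < \<delta>" "norm w < r - norm x" "norm w < r" "norm w < e / (4 * (B1 + 1))"
        using z by (auto simp: w_def d_def)
      have xr: "x \<in> cball 0 r" "x + w \<in> cball 0 r"
        using x w(2) norm_triangle_ineq[of x w] by auto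
      define V where "V t = t *\<^sub>R \<beta> (G (a + t *\<^sub>R x)) w (y (t *\<^sub>R x))" for t
      define u where "u t = y (t *\<^sub>R (x + w)) - y (t *\<^sub>R x) - V t" for t
      define u' where "u' t = \<beta> (G (a + t *\<^sub>R (x + w))) (x + w) (y (t *\<^sub>R (x + w)))
        - \<beta> (G (a + t *\<^sub>R x)) x (y (t *\<^sub>R x))
        - (t *\<^sub>R (\<beta> (G (a + t *\<^sub>R x)) w (\<beta> (G (a + t *\<^sub>R x)) x (y (t *\<^sub>R x)))
          + \<beta> (G' (a + t *\<^sub>R x) x) w (y (t *\<^sub>R x))) + \<beta> (G (a + t *\<^sub>R x)) w (y (t *\<^sub>R x)))" for t
      have "norm (u 1) \<le> 2 * (norm w * (B1 * norm w + B2 * \<eta>))"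
      proof (rule small_if_derivative_small[where u' = u'])
        fix t assume t: "t \<in> {0..1::real}"
        have "((\<lambda>t. G (a + t *\<^sub>R x)) has_derivative (\<lambda>h. G' (a + t *\<^sub>R x) (h *\<^sub>R x))) (at t within {0..1})"
          by (rule has_derivative_compose[where g = G and f = "\<lambda>t. a + t *\<^sub>R x"])
            (auto intro!: derivative_eq_intros der subS tr[OF xr(1)] t)
        then have dG: "((\<lambda>t. G (a + t *\<^sub>R x)) has_vector_derivative G' (a + t *\<^sub>R x) x) (at t within {0..1})"
          by (simp add: has_vector_derivative_def blinfun.scaleR_right)
        have "((\<lambda>t. \<alpha> (G (a + t *\<^sub>R x)) w) has_vector_derivative \<alpha> (G' (a + t *\<^sub>R x) x) w) (at t within {0..1})"
          by (rule bounded_linear.has_vector_derivative[OF \<alpha>.bounded_linear_left dG])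
        from has_vector_derivative_scaleR[OF DERIV_ident \<gamma>.has_vector_derivative[OF this y(3)[OF xr(1) t]]]
        have dV: "(V has_vector_derivative t *\<^sub>R (\<beta> (G (a + t *\<^sub>R x)) w (\<beta> (G (a + t *\<^sub>R x)) x (y (t *\<^sub>R x)))
          + \<beta> (G' (a + t *\<^sub>R x) x) w (y (t *\<^sub>R x))) + \<beta> (G (a + t *\<^sub>R x)) w (y (t *\<^sub>R x))) (at t within {0..1})"
          unfolding V_def[abs_def] \<beta>_def by simp
        show "(u has_vector_derivative u' t) (at t within {0..1})"
          unfolding u_def[abs_def] u'_def
          by (intro has_vector_derivative_diff y(3) xr t dV)
        define p where "p = a + t *\<^sub>R x"
        define Yt where "Yt = y (t *\<^sub>R x)"
        define \<Delta> where "\<Delta> = G (a + t *\<^sub>R (x + w)) - G p - t *\<^sub>R G' p w"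
        have pS: "p \<in> S" "p \<in> cball a R" unfolding p_def by (intro subS sub tr xr t)+
        have yt: "y (t *\<^sub>R (x + w)) = u t + Yt + V t" by (simp add: u_def Yt_def)
        have Gt: "G (a + t *\<^sub>R (x + w)) = G p + t *\<^sub>R G' p w + \<Delta>" by (simp add: \<Delta>_def)
        have Vt: "V t = t *\<^sub>R \<beta> (G p) w Yt" by (simp add: V_def p_def Yt_def)
        \<comment> \<open>Flatness at \<open>p\<close> for the directions \<open>w\<close> and
          \<open>x\<close>. It cancels the terms of \<open>u'\<close> of first order in
          \<open>w\<close> that survive the subtraction of the derivative of
          \<open>V\<close>.\<close>
        have fl: "t *\<^sub>R (\<beta> (G' p w) x Yt + \<beta> (G p) x (\<beta> (G p) w Yt)) =
            t *\<^sub>R (\<beta> (G' p x) w Yt + \<beta> (G p) w (\<beta> (G p) x Yt))"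
          using flat[OF pS(1), of w x Yt] by (simp add: \<beta>_def)
        \<comment> \<open>Inserting \<open>y (t (x + w)) = u t + Yt + V t\<close> separates the part
          linear in \<open>u t\<close>, which carries the factor 1/2, from a rest that has to be
          \<open>o(w)\<close>.\<close>
        have "u' t = \<beta> (G (a + t *\<^sub>R (x + w))) (x + w) (u t) +
          (\<beta> (G (a + t *\<^sub>R (x + w))) (x + w) (Yt + V t) - \<beta> (G p) x Yt - t *\<^sub>R (\<beta> (G p) w (\<beta> (G p) x Yt)
          + \<beta> (G' p x) w Yt) - \<beta> (G p) w Yt)"
          unfolding u'_def yt p_def[symmetric] Yt_def[symmetric] by (simp add: lin)
        also have "\<beta> (G (a + t *\<^sub>R (x + w))) (x + w) (Yt + V t) - \<beta> (G p) x Yt - t *\<^sub>R (\<beta> (G p) w (\<beta> (G p) x Yt)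
          + \<beta> (G' p x) w Yt) - \<beta> (G p) w Yt =
          \<beta> (G p) w (V t) + t *\<^sub>R \<beta> (G' p w) w Yt + t *\<^sub>R \<beta> (G' p w) (x + w) (V t) + \<beta> \<Delta> (x + w) (Yt + V t)
          + (t *\<^sub>R (\<beta> (G' p w) x Yt + \<beta> (G p) x (\<beta> (G p) w Yt)) - t *\<^sub>R (\<beta> (G' p x) w Yt + \<beta> (G p) w (\<beta> (G p) x Yt)))"
          unfolding Gt Vt by (simp add: lin scaleR_add_right)
        finally have u'_eq: "u' t = \<beta> (G (a + t *\<^sub>R (x + w))) (x + w) (u t) + (\<beta> (G p) w (V t) +
          t *\<^sub>R \<beta> (G' p w) w Yt + t *\<^sub>R \<beta> (G' p w) (x + w) (V t) + \<beta> \<Delta> (x + w) (Yt + V t))"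
          unfolding fl by simp
        have nY: "norm Yt \<le> Y" unfolding Yt_def by (intro Y tr xr t)
        have nG: "norm (G p) \<le> C" by (intro C pS)
        have nG': "norm (G' p w) \<le> C' * norm w"
          using norm_blinfun[of "G' p" w] C'[OF pS(2)] by (meson mult_right_mono norm_ge_zero order_trans)
        have t1: "norm (t *\<^sub>R z) \<le> norm z" for z :: 'b
          using t mult_left_le_one_le[of "norm z" t] by simp
        have nV: "norm (V t) \<le> K * C * norm w * Y"
          unfolding Vt by (intro order_trans[OF t1] \<beta>_le nG nY order_refl)
        have nV': "norm (V t) \<le> K * C * r * Y"
          using w(3) K C0 Y0 by (intro order_trans[OF nV] mult_right_mono mult_left_mono) auto
        have nxw: "norm (x + w) \<le> r" using xr(2) by simp
        have n\<Delta>: "norm \<Delta> \<le> \<eta> * norm w"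
        proof -
          have tw: "norm (t *\<^sub>R w) \<le> norm w" using t mult_left_le_one_le[of "norm w" t] by simp
          have *: "p + t *\<^sub>R w = a + t *\<^sub>R (x + w)" by (simp add: p_def scaleR_add_right)
          have "norm (G (p + t *\<^sub>R w) - G p - G' p (t *\<^sub>R w)) \<le> \<eta> * norm (t *\<^sub>R w)"
            by (intro \<delta>(2) pS le_less_trans[OF tw w(1)]) (unfold *, intro sub tr xr t)
          also have "\<dots> \<le> \<eta> * norm w" using tw \<eta> by (intro mult_left_mono) auto
          finally show ?thesis unfolding * by (simp add: \<Delta>_def blinfun.scaleR_right)
        qed
        have "norm (\<beta> (G (a + t *\<^sub>R (x + w))) (x + w) (u t)) \<le> K * C * r * norm (u t)"
          by (intro \<beta>_le nxw order_refl C sub tr xr t)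
        also have "\<dots> \<le> 1/2 * norm (u t)" by (intro mult_right_mono KCr) simp
        finally have e0: "norm (\<beta> (G (a + t *\<^sub>R (x + w))) (x + w) (u t)) \<le> norm (u t) / 2" by simp
        have e1: "norm (\<beta> (G p) w (V t)) \<le> K * C * norm w * (K * C * norm w * Y)"
          by (intro \<beta>_le nG nV order_refl)
        have e2: "norm (t *\<^sub>R \<beta> (G' p w) w Yt) \<le> K * (C' * norm w) * norm w * Y"
          by (intro order_trans[OF t1] \<beta>_le nG' nY order_refl)
        have e3: "norm (t *\<^sub>R \<beta> (G' p w) (x + w) (V t)) \<le> K * (C' * norm w) * r * (K * C * norm w * Y)"
          by (intro order_trans[OF t1] \<beta>_le nG' nV nxw)
        have e4: "norm (\<beta> \<Delta> (x + w) (Yt + V t)) \<le> K * (\<eta> * norm w) * r * (Y + K * C * r * Y)"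
          by (intro \<beta>_le n\<Delta> nxw norm_triangle_mono nY nV')
        have "norm (u' t) \<le> norm (u t) / 2 + (K * C * norm w * (K * C * norm w * Y) + K * (C' * norm w) * norm w * Y
          + K * (C' * norm w) * r * (K * C * norm w * Y) + K * (\<eta> * norm w) * r * (Y + K * C * r * Y))"
          unfolding u'_eq by (intro norm_triangle_mono e0 e1 e2 e3 e4)
        also have "\<dots> = norm (u t) / 2 + norm w * (B1 * norm w + B2 * \<eta>)"
          unfolding B1_def B2_def by (simp add: algebra_simps)
        finally show "norm (u' t) \<le> norm (u t) / 2 + norm w * (B1 * norm w + B2 * \<eta>)" .
      qed (auto simp: u_def V_def)
      also have "\<dots> \<le> 2 * (norm w * (e / 4 + e / 4))"
      proof -
        have "B1 * norm w \<le> B1 * (e / (4 * (B1 + 1)))" using w(4) B by (intro mult_left_mono) auto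
        also have "\<dots> \<le> e / 4" using B e by (simp add: divide_simps)
        finally have "B1 * norm w \<le> e / 4" .
        moreover have "B2 * \<eta> \<le> e / 4" unfolding \<eta>_def using B e by (simp add: divide_simps)
        ultimately show ?thesis by (intro mult_left_mono add_mono) auto
      qed
      finally show ?thesis by (simp add: u_def V_def w_def mult.commute)
    qed
    ultimately show "\<exists>d>0. \<forall>z. norm (z - x) < d \<longrightarrow>
      norm (y z - y x - \<beta> (G (a + x)) (z - x) (y x)) \<le> e * norm (z - x)" by blast
  qed
  show ?thesis
  proof (rule that[of r "\<lambda>x. y (x - a)"])
    show "ball a r \<subseteq> S" using R(2) r(2) by force
    fix x assume "x \<in> ball a r"
    then have "norm (x - a) < r" by (simp add: dist_norm norm_minus_commute)
    from has_derivative_compose[OF has_derivative_diff[OF has_derivative_ident has_derivative_const] der_y[OF this]]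
    show "((\<lambda>x. y (x - a)) has_derivative (\<lambda>w. \<gamma> (\<alpha> (G x) w) (y (x - a)))) (at x)"
      by (simp add: \<beta>_def)
  qed (use r y(2) in auto)
qed

section \<open>Polynomials and their gradients\<close>

definition grad :: "(complex^'n \<Rightarrow> complex) \<Rightarrow> complex^'n \<Rightarrow> complex^'n" where
  "grad f x = (\<chi> i. frechet_derivative f (at x) (axis i 1))"

lemma sum_axis_mult: "(\<Sum>i\<in>UNIV. axis a 1 $ i * z i) = (z a :: complex)"
  by (subst sum.cong[OF refl, where h = "\<lambda>i. if i = a then z i else 0"]) (auto simp: axis_def)

lemma sum_mult_axis: "(\<Sum>i\<in>UNIV. z i * axis a 1 $ i) = (z a :: complex)"
  using sum_axis_mult[of a z] by (simp add: mult.commute)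

lemma polys_derivative:
  assumes "f \<in> polys"
  shows "\<exists>g. (\<forall>i. (\<lambda>x. g x $ i) \<in> polys) \<and> (\<forall>x. (f has_derivative (\<lambda>v. \<Sum>i\<in>UNIV. v $ i * g x $ i)) (at x))"
  using assms
proof induction
  case (const c)
  show ?case by (intro exI[of _ "\<lambda>x. 0"]) (auto intro: polys.const)
next
  case (coord i)
  have "(\<lambda>x. axis i 1 $ j) \<in> polys" for j by (rule polys.const)
  moreover have "(\<Sum>j\<in>UNIV. v $ j * (axis i 1 :: complex^'a) $ j) = v $ i" for v :: "complex^'a"
    by (simp add: axis_def if_distrib cong: if_cong)
  ultimately show ?case
    by (intro exI[of _ "\<lambda>x. axis i 1"])
      (auto intro!: bounded_linear.has_derivative[OF bounded_linear_vec_nth] derivative_eq_intros)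
next
  case (add f f')
  then obtain g g' where g: "\<forall>i. (\<lambda>x. g x $ i) \<in> polys" "\<forall>i. (\<lambda>x. g' x $ i) \<in> polys"
    "\<forall>x. (f has_derivative (\<lambda>v. \<Sum>i\<in>UNIV. v $ i * g x $ i)) (at x)"
    "\<forall>x. (f' has_derivative (\<lambda>v. \<Sum>i\<in>UNIV. v $ i * g' x $ i)) (at x)" by blast
  have "((\<lambda>x. f x + f' x) has_derivative (\<lambda>v. \<Sum>i\<in>UNIV. v $ i * (g x + g' x) $ i)) (at x)" for x
    using has_derivative_add[OF g(3)[rule_format, of x] g(4)[rule_format, of x]]
    by (simp add: sum.distrib distrib_left)
  then show ?case using g by (intro exI[of _ "\<lambda>x. g x + g' x"]) (auto intro: polys.add)
next
  case (mult f f')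
  then obtain g g' where g: "\<forall>i. (\<lambda>x. g x $ i) \<in> polys" "\<forall>i. (\<lambda>x. g' x $ i) \<in> polys"
    "\<forall>x. (f has_derivative (\<lambda>v. \<Sum>i\<in>UNIV. v $ i * g x $ i)) (at x)"
    "\<forall>x. (f' has_derivative (\<lambda>v. \<Sum>i\<in>UNIV. v $ i * g' x $ i)) (at x)" by blast
  have "((\<lambda>x. f x * f' x) has_derivative (\<lambda>v. \<Sum>i\<in>UNIV. v $ i * (f x *s g' x + f' x *s g x) $ i)) (at x)" for x
    using has_derivative_mult[OF g(3)[rule_format, of x] g(4)[rule_format, of x]]
    by (simp add: sum.distrib distrib_left sum_distrib_left sum_distrib_right mult_ac)
  moreover have "(\<lambda>x. (f x *s g' x + f' x *s g x) $ i) \<in> polys" for i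
    using g mult.hyps by (auto intro!: polys.add polys.mult)
  ultimately show ?case by (intro exI[of _ "\<lambda>x. f x *s g' x + f' x *s g x"]) blast
qed

lemma
  assumes "f \<in> polys"
  shows polys_has_derivative: "(f has_derivative (\<lambda>v. \<Sum>i\<in>UNIV. v $ i * grad f x $ i)) (at x within S)"
    and polys_grad: "(\<lambda>x. grad f x $ i) \<in> polys"
proof -
  obtain g where g: "\<And>i. (\<lambda>x. g x $ i) \<in> polys"
    "\<And>x. (f has_derivative (\<lambda>v. \<Sum>i\<in>UNIV. v $ i * g x $ i)) (at x)"
    using polys_derivative[OF assms] by blast
  have "grad f x = g x" for x
    by (simp add: grad_def vec_eq_iff frechet_derivative_at[OF g(2), symmetric] sum_axis_mult)
  then have "grad f = g" by blast
  then show "(f has_derivative (\<lambda>v. \<Sum>i\<in>UNIV. v $ i * grad f x $ i)) (at x within S)"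
    "(\<lambda>x. grad f x $ i) \<in> polys"
    using g has_derivative_at_withinI by blast+
qed

lemma frechet_derivative_polys:
  "f \<in> polys \<Longrightarrow> frechet_derivative f (at x) v = (\<Sum>i\<in>UNIV. v $ i * grad f x $ i)"
  using fun_cong[OF frechet_derivative_at[OF polys_has_derivative[of f x UNIV]], of v] by simp

lemma polys_continuous_on: "f \<in> polys \<Longrightarrow> continuous_on S f"
  by (meson has_derivative_continuous_on polys_has_derivative)

lemma polys_sum: "finite A \<Longrightarrow> (\<And>i. i \<in> A \<Longrightarrow> f i \<in> polys) \<Longrightarrow> (\<lambda>x. \<Sum>i\<in>A. f i x) \<in> polys"
  by (induction A rule: finite_induct) (auto intro: polys.intros)

lemma polys_prod: "finite A \<Longrightarrow> (\<And>i. i \<in> A \<Longrightarrow> f i \<in> polys) \<Longrightarrow> (\<lambda>x. \<Prod>i\<in>A. f i x) \<in> polys"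
  by (induction A rule: finite_induct) (auto intro: polys.intros)

lemma polys_det:
  assumes "\<And>i j. (\<lambda>x. A x $ i $ j) \<in> polys"
  shows "(\<lambda>x. det (A x :: complex^'m^'m)) \<in> polys"
  unfolding det_def by (intro polys_sum polys_prod polys.mult polys.const assms finite_permutations finite)

lemma zariski_open_imp_open:
  assumes "zariski_open W"
  shows "open W"
proof -
  obtain S where S: "S \<subseteq> polys" "W = {x. \<exists>f\<in>S. f x \<noteq> 0}" by (rule zariski_openE[OF assms])
  have "W = (\<Union>f\<in>S. f -` (- {0}))" unfolding S(2) by blast
  then show ?thesis
    using S(1) polys_continuous_on by (auto intro!: open_UN open_vimage)
qed

lemma zariski_openin_imp_openin:
  assumes "openin (subtopology zariski M) W"
  shows "openin (top_of_set M) W"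
  using assms zariski_open_imp_open by (auto simp: openin_subtopology openin_zariski openin_open)

lemma zariski_openin_principal:
  "openin (subtopology zariski M) W \<Longrightarrow> b \<in> polys \<Longrightarrow> openin (subtopology zariski M) {x \<in> W. b x \<noteq> 0}"
proof -
  assume W: "openin (subtopology zariski M) W" and b: "b \<in> polys"
  have "zariski_open {x. b x \<noteq> 0}"
    unfolding zariski_open_def using b by (intro exI[of _ "{b}"]) auto
  then have "openin (subtopology zariski M) (M \<inter> {x. b x \<noteq> 0})"
    by (auto simp: openin_subtopology openin_zariski)
  moreover have "{x \<in> W. b x \<noteq> 0} = W \<inter> (M \<inter> {x. b x \<noteq> 0})"
    using openin_subset[OF W] by auto
  ultimately show ?thesis using W by (simp add: openin_Int)
qed

section \<open>Charts and adapted frames\<close>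

text \<open>Coordinates on \<open>M\<close> stay in the ambient space, padded by zeros off
  \<open>D\<close>, because \<open>D\<close> depends on the point and its size cannot become a
  type.\<close>

definition coord_proj :: "'n set \<Rightarrow> 'a::zero^'n \<Rightarrow> 'a^'n" where
  "coord_proj D x = (\<chi> i. if i \<in> D then x $ i else 0)"

lemma coord_proj_nth [simp]: "coord_proj D x $ i = (if i \<in> D then x $ i else 0)"
  by (simp add: coord_proj_def)

lemma coord_proj_idem [simp]: "coord_proj D (coord_proj D x) = coord_proj D x"
  by (simp add: vec_eq_iff)

lemma bounded_linear_coord_proj: "bounded_linear (coord_proj D :: complex^'n \<Rightarrow> complex^'n)"
  by (intro linear_conv_bounded_linear[THEN iffD1] linearI) (auto simp: vec_eq_iff)

text \<open>Independent gradients are completed to a basis by standard vectors. The indices of the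
  added vectors form \<open>D\<close>, and a dimension count leaves exactly as many indices outside
  \<open>D\<close> as there are equations, so the gradients fill the remaining rows.\<close>

lemma gradients_extend_to_basis:
  fixes F :: "(complex^'n \<Rightarrow> complex) set"
  assumes F: "finite F" "F \<subseteq> polys"
    and indep: "\<And>c :: (complex^'n \<Rightarrow> complex) \<Rightarrow> complex.
      (\<And>v. (\<Sum>f\<in>F. c f * frechet_derivative f (at p) v) = 0) \<Longrightarrow> \<forall>f\<in>F. c f = 0"
  obtains D \<sigma> where "\<sigma> ` (- D) = F" "det (\<chi> i. if i \<in> D then axis i 1 else grad (\<sigma> i) p) \<noteq> 0"
proof -
  have comb: "\<forall>f\<in>F. c f = 0" if "(\<Sum>f\<in>F. c f *s grad f p) = 0" for c
  proof (rule indep)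
    fix v :: "complex^'n"
    have "(\<Sum>f\<in>F. c f * frechet_derivative f (at p) v) = (\<Sum>i\<in>UNIV. v $ i * (\<Sum>f\<in>F. c f *s grad f p) $ i)"
      using F(2) by (subst sum_component, subst sum_distrib_left, subst sum.swap)
        (auto simp: frechet_derivative_polys sum_distrib_left mult_ac intro!: sum.cong)
    then show "(\<Sum>f\<in>F. c f * frechet_derivative f (at p) v) = 0" by (simp add: that)
  qed
  have inj: "inj_on (\<lambda>f. grad f p) F"
  proof (rule inj_onI, rule ccontr)
    fix f g assume fg: "f \<in> F" "g \<in> F" "grad f p = grad g p" "f \<noteq> g"
    \<comment> \<open>Coefficient 1 at \<open>f\<close> and -1 at \<open>g\<close>: distinct
      equations with equal gradients would contradict \<open>comb\<close>.\<close>
    let ?c = "\<lambda>h. (if h = f then 1 else 0) - (if h = g then 1 else (0::complex))"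
    have "(\<Sum>h\<in>F. ?c h *s grad h p) = (\<Sum>h\<in>F. (if h = f then grad f p else 0)) - (\<Sum>h\<in>F. (if h = g then grad g p else 0))"
      by (subst sum_subtractf[symmetric]) (auto intro!: sum.cong)
    also have "\<dots> = 0" using fg F(1) by simp
    finally have "(\<Sum>h\<in>F. ?c h *s grad h p) = 0" .
    from comb[of ?c, OF this] fg show False by auto
  qed
  define R where "R = (\<lambda>f. grad f p) ` F"
  have "vec.independent R"
  proof (rule vec.independent_if_scalars_zero)
    show "finite R" using F(1) by (simp add: R_def)
    fix c x assume "(\<Sum>x\<in>R. c x *s x) = 0" "x \<in> R"
    then show "c x = 0"
      using comb[of "\<lambda>f. c (grad f p)"] inj by (auto simp: R_def sum.reindex)
  qed
  define Ax where "Ax = range (\<lambda>i. axis i (1::complex) :: complex^'n)"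
  obtain B where B: "R \<subseteq> B" "B \<subseteq> R \<union> Ax" "vec.independent B" "R \<union> Ax \<subseteq> vec.span B"
    using vec.maximal_independent_subset_extend[OF Un_upper1 \<open>vec.independent R\<close>, of Ax] by metis
  have "v \<in> vec.span B" for v
  proof -
    have "(\<Sum>i\<in>UNIV. (v $ i) *s axis i 1) \<in> vec.span B"
      using B(4) by (intro vec.span_sum vec.span_scale) (auto simp: Ax_def)
    then show ?thesis by (simp add: basis_expansion)
  qed
  then have span: "vec.span B = UNIV" by blast
  have finB: "finite B" using vec.finiteI_independent[OF B(3)] .
  have cardB: "card B = CARD('n)"
    using vec.dim_eq_card[of B UNIV] span B(3) vec_dim_card by (metis vec.span_UNIV)
  \<comment> \<open>A gradient may itself be a standard vector, so only the vectors added to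
    \<open>R\<close> are counted.\<close>
  define D where "D = {i. axis i 1 \<in> B - R}"
  have BR: "B - R = (\<lambda>i. axis i 1) ` D" using B(2) by (auto simp: D_def Ax_def)
  have "card (B - R) = card D" unfolding BR by (rule card_image) (auto simp: inj_on_def axis_eq_axis)
  moreover have "card (B - R) = card B - card R" using B(1) finB finite_subset by (intro card_Diff_subset) auto
  moreover have "card R = card F" unfolding R_def using inj by (rule card_image)
  moreover have "card R \<le> card B" using card_mono[OF finB B(1)] .
  ultimately have "card (- D) = card F" using cardB by (simp add: Compl_eq_Diff_UNIV card_Diff_subset)
  then obtain \<sigma> where \<sigma>: "bij_betw \<sigma> (- D) F"
    using finite_same_card_bij[of "- D" F] F(1) by auto
  define A :: "complex^'n^'n" where "A = (\<chi> i. if i \<in> D then axis i 1 else grad (\<sigma> i) p)"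
  have "B \<subseteq> rows A"
  proof
    fix b assume b: "b \<in> B"
    show "b \<in> rows A"
    proof (cases "b \<in> R")
      case True
      then obtain f where f: "f \<in> F" "b = grad f p" unfolding R_def by blast
      then obtain i where "i \<notin> D" "f = \<sigma> i" using \<sigma> unfolding bij_betw_def by blast
      then have "row i A = b" by (simp add: row_def A_def f vec_eq_iff)
      then show ?thesis unfolding rows_def by blast
    next
      case False
      with b BR obtain i where "i \<in> D" "b = axis i 1" by blast
      then have "row i A = b" by (simp add: row_def A_def vec_eq_iff)
      then show ?thesis unfolding rows_def by blast
    qed
  qed
  then have "vec.span (rows A) = UNIV" using vec.span_mono span by blast
  then have "invertible A" using matrix_left_invertible_span_rows_gen invertible_left_inverse by blast
  then have "det A \<noteq> 0" by (simp add: invertible_det_nz)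
  then show ?thesis using \<sigma> that[of \<sigma> D] by (simp add: A_def bij_betw_def)
qed

lemma has_derivative_vec:
  fixes f :: "'a::real_normed_vector \<Rightarrow> 'b::euclidean_space^'n"
  assumes "\<And>i. ((\<lambda>x. f x $ i) has_derivative (\<lambda>v. f' v $ i)) (at x within S)"
  shows "(f has_derivative f') (at x within S)"
proof (subst has_derivative_componentwise_within, intro ballI)
  fix b :: "'b^'n" assume "b \<in> Basis"
  then obtain i u where b: "b = axis i u" by (auto simp: Basis_vec_def)
  show "((\<lambda>x. f x \<bullet> b) has_derivative (\<lambda>v. f' v \<bullet> b)) (at x within S)"
    unfolding b inner_axis by (rule has_derivative_inner_left[OF assms])
qed

lemma has_derivative_vec_nth:
  "(f has_derivative f') (at x within S) \<Longrightarrow> ((\<lambda>x. f x $ i) has_derivative (\<lambda>v. f' v $ i)) (at x within S)"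
  by (rule bounded_linear.has_derivative[OF bounded_linear_vec_nth])

lemma bounded_linear_matrix_vector: "bounded_linear ((*v) (A :: complex^'n^'m))"
  by (intro linear_conv_bounded_linear[THEN iffD1] linearI)
    (auto simp: matrix_vector_right_distrib vec_eq_iff matrix_vector_mult_def scaleR_sum_right sum.distrib distrib_left)

lemma
  fixes A :: "'a::field^'n^'n"
  assumes "det A \<noteq> 0"
  shows matrix_inv_left: "matrix_inv A ** A = mat 1" and matrix_inv_right: "A ** matrix_inv A = mat 1"
proof -
  have "invertible A" using assms by (simp add: invertible_det_nz)
  from someI_ex[OF this[unfolded invertible_def]]
  show "matrix_inv A ** A = mat 1" "A ** matrix_inv A = mat 1" unfolding matrix_inv_def by blast+
qed

text \<open>Completes a system of equations \<open>\<sigma> i\<close>, \<open>i \<notin> D\<close>, of \<open>M\<close> to a local biholomorphism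
  of the ambient space.\<close>
definition straighten :: "'n set \<Rightarrow> ('n \<Rightarrow> complex^'n \<Rightarrow> complex) \<Rightarrow> complex^'n \<Rightarrow> complex^'n" where
  "straighten D \<sigma> x = (\<chi> i. if i \<in> D then x $ i else \<sigma> i x)"

definition straighten_jac :: "'n set \<Rightarrow> ('n \<Rightarrow> complex^'n \<Rightarrow> complex) \<Rightarrow> complex^'n \<Rightarrow> complex^'n^'n" where
  "straighten_jac D \<sigma> x = (\<chi> i. if i \<in> D then axis i 1 else grad (\<sigma> i) x)"

lemma polys_straighten_jac:
  assumes "\<And>i. i \<notin> D \<Longrightarrow> \<sigma> i \<in> polys"
  shows "(\<lambda>x. straighten_jac D \<sigma> x $ i $ j) \<in> polys"
  using assms polys_grad by (cases "i \<in> D") (auto simp: straighten_jac_def intro: polys.const)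

lemma straighten_has_derivative:
  assumes "\<And>i. i \<notin> D \<Longrightarrow> \<sigma> i \<in> polys"
  shows "(straighten D \<sigma> has_derivative (*v) (straighten_jac D \<sigma> x)) (at x)"
proof (rule has_derivative_vec)
  fix i
  show "((\<lambda>x. straighten D \<sigma> x $ i) has_derivative (\<lambda>v. (straighten_jac D \<sigma> x *v v) $ i)) (at x)"
  proof (cases "i \<in> D")
    case True
    then show ?thesis
      by (auto simp: straighten_def straighten_jac_def matrix_vector_mult_def sum_axis_mult
          intro!: bounded_linear.has_derivative[OF bounded_linear_vec_nth] derivative_eq_intros)
  next
    case False
    then show ?thesis
      using polys_has_derivative[OF assms[OF False]]
      by (simp add: straighten_def straighten_jac_def matrix_vector_mult_def mult.commute)
  qed
qed

text \<open>A parametrization of \<open>Z\<close> near \<open>q\<close> as a graph over the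
  coordinates in \<open>D\<close>, with the fields \<open>e a\<close> as partial derivatives. The
  domain is open in the full ambient space, so that ordinary derivatives can be taken there. The
  clause on \<open>N\<close> says that near \<open>q\<close> the graph exhausts
  \<open>Z\<close>.\<close>

definition submanifold_chart ::
  "(complex^'n) set \<Rightarrow> 'n set \<Rightarrow> ('n \<Rightarrow> 'n vfield) \<Rightarrow> complex^'n \<Rightarrow> (complex^'n) set \<Rightarrow> (complex^'n \<Rightarrow> complex^'n) \<Rightarrow> bool" where
  "submanifold_chart Z D e q B \<rho> \<longleftrightarrow> open B \<and> coord_proj D q \<in> B \<and> \<rho> (coord_proj D q) = q \<and>
     (\<forall>y\<in>B. \<rho> y \<in> Z \<and> coord_proj D (\<rho> y) = coord_proj D y \<and>
        (\<rho> has_derivative (\<lambda>w. \<Sum>a\<in>UNIV. w $ a *s e a (\<rho> y))) (at y)) \<and>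
     (\<exists>N. open N \<and> q \<in> N \<and> (\<forall>x\<in>Z \<inter> N. coord_proj D x \<in> B \<and> \<rho> (coord_proj D x) = x))"

text \<open>Inverse function theorem for \<open>straighten\<close>. On \<open>M\<close> this map is
  \<open>coord_proj D\<close>, because the equations vanish there. Conversely, the local inverse
  sends points of the coordinate plane to common zeros of the equations, and \<open>cut\<close>
  places these in \<open>M\<close>. The fields \<open>e a\<close> are columns of the inverse
  Jacobian.\<close>

lemma submanifold_chart_exists:
  fixes M :: "(complex^'n) set"
  assumes \<sigma>: "\<And>i. i \<notin> D \<Longrightarrow> \<sigma> i \<in> vanishing_ideal M" and q: "q \<in> W"
    and W: "openin (top_of_set M) W"
    and cut: "open O'" "q \<in> O'" "\<And>x. x \<in> O' \<Longrightarrow> \<forall>i. i \<notin> D \<longrightarrow> \<sigma> i x = 0 \<Longrightarrow> x \<in> M"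
    and det: "det (straighten_jac D \<sigma> q) \<noteq> 0"
    and e: "\<And>a x. x \<in> W \<Longrightarrow> det (straighten_jac D \<sigma> x) \<noteq> 0 \<Longrightarrow>
      e a x = (if a \<in> D then matrix_inv (straighten_jac D \<sigma> x) *v axis a 1 else 0)"
  obtains B \<rho> where "submanifold_chart W D e q B \<rho>"
proof -
  let ?\<Phi> = "straighten D \<sigma>" and ?J = "straighten_jac D \<sigma>"
  have pol: "\<And>i. i \<notin> D \<Longrightarrow> \<sigma> i \<in> polys" using \<sigma> by (auto simp: vanishing_ideal_def)
  define J' where "J' x = Blinfun ((*v) (?J x))" for x
  have J': "blinfun_apply (J' x) = (*v) (?J x)" for x
    unfolding J'_def by (rule bounded_linear_Blinfun_apply) (rule bounded_linear_matrix_vector)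
  have contJ: "continuous_on UNIV (\<lambda>x. ?J x *v v)" for v
    unfolding matrix_vector_mult_def
    by (intro continuous_on_vec_lambda continuous_intros polys_continuous_on polys_straighten_jac pol)
  note inv' = matrix_inv_left matrix_inv_right
  obtain U' V g g' where ift: "open U'" "q \<in> U'" "open V" "?\<Phi> q \<in> V" "homeomorphism U' V ?\<Phi> g"
    "\<And>y. y \<in> V \<Longrightarrow> (g has_derivative (g' y)) (at y)"
    "\<And>y. y \<in> V \<Longrightarrow> g' y = inv (blinfun_apply (J' (g y)))"
    "\<And>y. y \<in> V \<Longrightarrow> bij (blinfun_apply (J' (g y)))"
  proof (rule inverse_function_theorem[of UNIV ?\<Phi> J' q "Blinfun ((*v) (matrix_inv (?J q)))"])
    show "continuous_on UNIV J'"
      by (rule continuous_on_blinfun_componentwise) (simp add: J' contJ)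
    show "Blinfun ((*v) (matrix_inv (?J q))) o\<^sub>L J' q = id_blinfun"
      by (rule blinfun_eqI) (simp add: J' bounded_linear_Blinfun_apply[OF bounded_linear_matrix_vector]
        matrix_vector_mul_assoc inv' det)
  qed (auto simp: J' intro: straighten_has_derivative[OF pol])
  obtain O2 where O2: "open O2" "W = M \<inter> O2" using W by (auto simp: openin_open)
  \<comment> \<open>Confines the inverse to points where all the ingredients apply: the ambient open
    set defining \<open>W\<close>, the region of \<open>cut\<close>, the domain of the
    homeomorphism, and invertibility of the Jacobian.\<close>
  define O3 where "O3 = O2 \<inter> O' \<inter> U' \<inter> {x. det (?J x) \<noteq> 0}"
  have "(\<lambda>x. det (?J x)) \<in> polys" by (intro polys_det polys_straighten_jac pol)
  then have "open {x. det (?J x) \<noteq> 0}"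
    using open_Collect_neq[OF polys_continuous_on continuous_on_const] by blast
  then have O3: "open O3" "q \<in> O3" unfolding O3_def using O2 cut ift(1,2) det q by auto
  have straighten_M: "?\<Phi> x = coord_proj D x" if "x \<in> M" for x
    using that \<sigma> by (auto simp: vec_eq_iff straighten_def vanishing_ideal_def)
  define B where "B = coord_proj D -` (V \<inter> g -` O3)"
  define \<rho> where "\<rho> y = g (coord_proj D y)" for y
  have gV: "?\<Phi> (g y) = y" if "y \<in> V" for y using homeomorphism_apply2[OF ift(5) that] .
  have gU: "g (?\<Phi> x) = x" if "x \<in> U'" for x using homeomorphism_apply1[OF ift(5) that] .
  have "submanifold_chart W D e q B \<rho>"
    unfolding submanifold_chart_def
  proof (intro conjI ballI)
    have qM: "q \<in> M" using q O2 by auto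
    have "open (V \<inter> g -` O3)"
      using continuous_open_preimage[OF homeomorphism_cont2[OF ift(5)] ift(3) O3(1)] .
    then show "open B" unfolding B_def
      by (rule open_vimage) (rule linear_continuous_on[OF bounded_linear_coord_proj])
    show \<rho>q: "\<rho> (coord_proj D q) = q"
      using gU[OF ift(2)] straighten_M[OF qM] by (simp add: \<rho>_def)
    show "coord_proj D q \<in> B"
      using ift(4) O3(2) \<rho>q straighten_M[OF qM] by (simp add: B_def \<rho>_def)
    show "\<exists>N. open N \<and> q \<in> N \<and> (\<forall>x\<in>W \<inter> N. coord_proj D x \<in> B \<and> \<rho> (coord_proj D x) = x)"
    proof (intro exI[of _ O3] conjI ballI O3)
      fix x assume x: "x \<in> W \<inter> O3"
      then have *: "?\<Phi> x = coord_proj D x" using straighten_M O2 by blast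
      have xU: "x \<in> U'" using x by (auto simp: O3_def)
      show **: "\<rho> (coord_proj D x) = x" using gU[OF xU] * by (simp add: \<rho>_def)
      have "?\<Phi> x \<in> V" using ift(5) xU by (auto simp: homeomorphism_def)
      then show "coord_proj D x \<in> B" using x ** * by (simp add: B_def \<rho>_def)
    qed
    fix y assume y: "y \<in> B"
    then have yV: "coord_proj D y \<in> V" and \<rho>O: "\<rho> y \<in> O3" by (auto simp: B_def \<rho>_def)
    have \<Phi>\<rho>: "?\<Phi> (\<rho> y) = coord_proj D y" unfolding \<rho>_def by (rule gV[OF yV])
    then have comp: "(if i \<in> D then \<rho> y $ i else \<sigma> i (\<rho> y)) = (if i \<in> D then y $ i else 0)" for i
      by (auto simp: straighten_def vec_eq_iff)
    have "\<rho> y $ i = y $ i" if "i \<in> D" for i using comp[of i] that by simp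
    then show "coord_proj D (\<rho> y) = coord_proj D y" by (simp add: vec_eq_iff)
    have "\<forall>i. i \<notin> D \<longrightarrow> \<sigma> i (\<rho> y) = 0" using comp by (metis (full_types))
    then have "\<rho> y \<in> M" using cut(3) \<rho>O by (auto simp: O3_def)
    then show \<rho>W: "\<rho> y \<in> W" using \<rho>O O2 by (auto simp: O3_def)
    have dJ: "det (?J (\<rho> y)) \<noteq> 0" using \<rho>O by (simp add: O3_def)
    have "inv ((*v) (?J (\<rho> y))) = (*v) (matrix_inv (?J (\<rho> y)))"
      by (rule inv_equality) (simp_all add: matrix_vector_mul_assoc inv' dJ)
    then have "(g has_derivative (*v) (matrix_inv (?J (\<rho> y)))) (at (coord_proj D y))"
      using ift(6)[OF yV] ift(7)[OF yV] by (simp add: J' \<rho>_def)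
    from has_derivative_compose[OF bounded_linear_imp_has_derivative[OF bounded_linear_coord_proj] this]
    have "(\<rho> has_derivative (\<lambda>w. matrix_inv (?J (\<rho> y)) *v coord_proj D w)) (at y)"
      unfolding \<rho>_def[abs_def] .
    moreover have "matrix_inv (?J (\<rho> y)) *v coord_proj D w = (\<Sum>a\<in>UNIV. w $ a *s e a (\<rho> y))" for w
    proof -
      have "matrix_inv (?J (\<rho> y)) *v (\<Sum>a\<in>UNIV. coord_proj D w $ a *s axis a 1) = (\<Sum>a\<in>UNIV. w $ a *s e a (\<rho> y))"
        by (subst vec.linear_sum[OF matrix_vector_mul_linear_gen])
          (auto simp: e[OF \<rho>W dJ] vec.linear_scale[OF matrix_vector_mul_linear_gen] intro!: sum.cong)
      then show ?thesis by (simp only: basis_expansion)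
    qed
    ultimately show "(\<rho> has_derivative (\<lambda>w. \<Sum>a\<in>UNIV. w $ a *s e a (\<rho> y))) (at y)" by simp
  qed
  then show ?thesis by (rule that)
qed

text \<open>The fields are indexed by all ambient coordinates and vanish off \<open>D\<close>, so
  that every expansion is a sum over \<open>UNIV\<close> with ambient components as coefficients.
  The actual frame consists of the fields with index in \<open>D\<close>.\<close>

locale adapted_frame =
  fixes M Z :: "(complex^'n) set" and D :: "'n set" and e :: "'n \<Rightarrow> 'n vfield"
  assumes open_Z: "openin (subtopology zariski M) Z"
    and frame_regular: "regular_vf M Z (e a)"
    and frame_span: "q \<in> Z \<Longrightarrow> v \<in> tangent_space M q \<Longrightarrow> v = (\<Sum>a\<in>UNIV. v $ a *s e a q)"
    and frame_coord: "q \<in> Z \<Longrightarrow> a \<in> D \<Longrightarrow> b \<in> D \<Longrightarrow> e a q $ b = (if a = b then 1 else 0)"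
    and frame_off: "q \<in> Z \<Longrightarrow> a \<notin> D \<Longrightarrow> e a q = 0"
    and chart: "q \<in> Z \<Longrightarrow> \<exists>B \<rho>. submanifold_chart Z D e q B \<rho>"

text \<open>A polynomial vanishing on \<open>M\<close> is identically zero along the chart, so by
  the chain rule its differential annihilates the partial derivatives of
  \<open>\<rho>\<close>.\<close>

lemma tangent_space_frame:
  assumes chart: "submanifold_chart Z D e q B \<rho>" and "Z \<subseteq> M"
  shows "e a q \<in> tangent_space M q"
proof -
  have "frechet_derivative h (at q) (e a q) = 0" if h: "h \<in> vanishing_ideal M" for h
  proof -
    let ?y = "coord_proj D q"
    have hp: "h \<in> polys" using h by (simp add: vanishing_ideal_def)
    from chart have \<rho>: "open B" "?y \<in> B" "\<rho> ?y = q" "\<And>y. y \<in> B \<Longrightarrow> \<rho> y \<in> M"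
      "(\<rho> has_derivative (\<lambda>w. \<Sum>a\<in>UNIV. w $ a *s e a q)) (at ?y)"
      using \<open>Z \<subseteq> M\<close> unfolding submanifold_chart_def by auto
    have "((\<lambda>y. h (\<rho> y)) has_derivative (\<lambda>w. frechet_derivative h (at q) (\<Sum>a\<in>UNIV. w $ a *s e a q))) (at ?y)"
      using polys_has_derivative[OF hp, of q UNIV] \<rho>(3)
      by (intro has_derivative_compose[OF \<rho>(5)]) (simp add: frechet_derivative_polys[OF hp, abs_def])
    moreover have "((\<lambda>y. h (\<rho> y)) has_derivative (\<lambda>w. 0)) (at ?y)"
      by (rule has_derivative_transform_within_open[OF has_derivative_const[of 0] \<rho>(1,2)])
        (use \<rho>(4) h in \<open>auto simp: vanishing_ideal_def\<close>)
    ultimately have "(\<lambda>w. frechet_derivative h (at q) (\<Sum>a\<in>UNIV. w $ a *s e a q)) = (\<lambda>w. 0)"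
      by (rule has_derivative_unique)
    then have "frechet_derivative h (at q) (\<Sum>b\<in>UNIV. axis a 1 $ b *s e b q) = 0"
      by (rule fun_cong)
    moreover have "(\<Sum>b\<in>UNIV. axis a 1 $ b *s e b q) = e a q"
      by (simp add: vec_eq_iff sum_axis_mult)
    ultimately show ?thesis by simp
  qed
  then show ?thesis by (simp add: tangent_space_def)
qed

text \<open>The frame lives on the principal open set where \<open>g\<close> and the Jacobian
  determinant are both nonzero. There its entries are quotients of polynomials by Cramer's rule,
  with that determinant as denominator, while smoothness is needed at the single point
  \<open>p\<close> only.\<close>

lemma adapted_frame_exists:
  assumes smooth: "smooth_at M p" and U: "openin (subtopology zariski M) U" and p: "p \<in> U"
  obtains Z D e where "adapted_frame M Z D e" "Z \<subseteq> U" "p \<in> Z"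
proof -
  obtain g F where g: "g \<in> polys" "g p \<noteq> 0" and F: "finite F" "F \<subseteq> vanishing_ideal M"
    and cut: "{x. g x \<noteq> 0 \<and> (\<forall>f\<in>F. f x = 0)} \<subseteq> M"
    and ind: "\<forall>c :: (complex^'a \<Rightarrow> complex) \<Rightarrow> complex.
        (\<forall>v. (\<Sum>f\<in>F. c f * frechet_derivative f (at p) v) = 0) \<longrightarrow> (\<forall>f\<in>F. c f = 0)"
    using smooth unfolding smooth_at_def by auto
  have Fp: "F \<subseteq> polys" using F(2) by (auto simp: vanishing_ideal_def)
  have ind': "\<forall>f\<in>F. c f = 0" if "\<And>v. (\<Sum>f\<in>F. c f * frechet_derivative f (at p) v) = 0" for c
    using ind that by blast
  obtain D \<sigma> where \<sigma>: "\<sigma> ` (- D) = F" and det: "det (straighten_jac D \<sigma> p) \<noteq> 0"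
    unfolding straighten_jac_def by (rule gradients_extend_to_basis[OF F(1) Fp, of p, OF ind'])
  let ?J = "straighten_jac D \<sigma>"
  have \<sigma>I: "\<sigma> i \<in> vanishing_ideal M" if "i \<notin> D" for i using \<sigma> F(2) that by blast
  have pol: "\<And>i. i \<notin> D \<Longrightarrow> \<sigma> i \<in> polys" using \<sigma>I by (auto simp: vanishing_ideal_def)
  have dpol: "(\<lambda>x. det (?J x)) \<in> polys" by (intro polys_det polys_straighten_jac pol)
  define Z where "Z = {x \<in> U. g x * det (?J x) \<noteq> 0}"
  define e where "e a x = (if a \<in> D then matrix_inv (?J x) *v axis a 1 else 0)" for a x
  have Zo: "openin (subtopology zariski M) Z"
    unfolding Z_def by (rule zariski_openin_principal[OF U polys.mult[OF g(1) dpol]])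
  have ZM: "Z \<subseteq> M" using openin_subset[OF Zo] by auto
  have inv': "matrix_inv (?J x) ** ?J x = mat 1" "?J x ** matrix_inv (?J x) = mat 1" if "x \<in> Z" for x
    using that by (auto simp: Z_def intro: matrix_inv_left matrix_inv_right)
  have og: "open {x. g x \<noteq> 0}" using open_Collect_neq[OF polys_continuous_on[OF g(1)] continuous_on_const] .
  have ch: "\<exists>B \<rho>. submanifold_chart Z D e q B \<rho>" if q: "q \<in> Z" for q
  proof -
    have "g q \<noteq> 0" "det (?J q) \<noteq> 0" using q by (auto simp: Z_def)
    moreover have "x \<in> M" if "x \<in> {x. g x \<noteq> 0}" "\<forall>i. i \<notin> D \<longrightarrow> \<sigma> i x = 0" for x
      using that cut \<sigma> by (auto simp: image_def)
    ultimately obtain B \<rho> where "submanifold_chart Z D e q B \<rho>"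
      using submanifold_chart_exists[OF \<sigma>I q zariski_openin_imp_openin[OF Zo] og _ _ _ e_def] by blast
    then show ?thesis by blast
  qed
  have tang: "e a q \<in> tangent_space M q" if "q \<in> Z" for a q
    using ch[OF that] tangent_space_frame ZM by blast
  have Je: "?J q *v e a q = (if a \<in> D then axis a 1 else 0)" if "q \<in> Z" for a q
    by (simp add: e_def matrix_vector_mul_assoc inv' that)
  have "adapted_frame M Z D e"
  proof
    show "openin (subtopology zariski M) Z" by (rule Zo)
    fix a
    have "regular_on Z (\<lambda>x. e a x $ k)" for k
      unfolding regular_on_def
    proof
      fix q assume "q \<in> Z"
      \<comment> \<open>Cramer's numerator: column \<open>k\<close> is replaced by the right-hand
        side of the linear system solved by \<open>e a x\<close>.\<close>
      define num where "num x = det (\<chi> i j. if j = k then (if a \<in> D then axis a 1 else 0 :: complex^'a) $ i else ?J x $ i $ j)" for x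
      have "num \<in> polys"
        unfolding num_def[abs_def]
      proof (intro polys_det)
        show "(\<lambda>x. (\<chi> i j. if j = k then (if a \<in> D then axis a 1 else 0 :: complex^'a) $ i
            else ?J x $ i $ j) $ i $ j) \<in> polys" for i j
          by (cases "j = k") (auto intro: polys.const polys_straighten_jac[OF pol])
      qed
      moreover have "e a x $ k = num x / det (?J x)" if "x \<in> Z" for x
      proof -
        have d: "det (?J x) \<noteq> 0" using that by (simp add: Z_def)
        show ?thesis using Je[OF that, of a] unfolding cramer[OF d] num_def by simp
      qed
      ultimately show "\<exists>a'\<in>polys. \<exists>b\<in>polys. b q \<noteq> 0 \<and> (\<forall>x\<in>Z. b x \<noteq> 0 \<longrightarrow> e a x $ k = a' x / b x)"
        using dpol \<open>q \<in> Z\<close> by (intro bexI[of _ num] bexI[of _ "\<lambda>x. det (?J x)"]) (auto simp: Z_def)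
    qed
    then show "regular_vf M Z (e a)" using tang by (simp add: regular_vf_def)
  next
    fix q v assume q: "q \<in> Z" and v: "v \<in> tangent_space M q"
    \<comment> \<open>The rows off \<open>D\<close> are differentials of equations of
      \<open>M\<close> and annihilate the tangent vector, so only its coordinates in
      \<open>D\<close> survive.\<close>
    have "?J q *v v = coord_proj D v"
    proof (subst vec_eq_iff, intro allI)
      fix i
      show "(?J q *v v) $ i = coord_proj D v $ i"
        using v \<sigma>I[of i] frechet_derivative_polys[OF pol[of i], of q v]
        by (auto simp: matrix_vector_mult_def straighten_jac_def sum_mult_axis tangent_space_def mult.commute)
    qed
    then have "v = matrix_inv (?J q) *v coord_proj D v"
      by (metis inv'(1)[OF q] matrix_vector_mul_assoc matrix_vector_mul_lid)
    also have "\<dots> = matrix_inv (?J q) *v (\<Sum>a\<in>UNIV. coord_proj D v $ a *s axis a 1)"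
      by (simp only: basis_expansion)
    also have "\<dots> = (\<Sum>a\<in>UNIV. v $ a *s e a q)"
      by (subst vec.linear_sum[OF matrix_vector_mul_linear_gen])
        (auto simp: e_def vec.linear_scale[OF matrix_vector_mul_linear_gen] intro!: sum.cong)
    finally show "v = (\<Sum>a\<in>UNIV. v $ a *s e a q)" .
  next
    fix q a b assume q: "q \<in> Z" "a \<in> D" "b \<in> D"
    have "(?J q *v e a q) $ b = e a q $ b"
      using q(3) by (simp add: matrix_vector_mult_def straighten_jac_def sum_axis_mult)
    then show "e a q $ b = (if a = b then 1 else 0)" using Je[OF q(1), of a] q(2) by (auto simp: axis_def)
  next
    show "e a q = 0" if "a \<notin> D" for a q using that by (simp add: e_def)
  qed (rule ch)
  moreover have "p \<in> Z" "Z \<subseteq> U" using p g det by (auto simp: Z_def)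
  ultimately show ?thesis using that by blast
qed

section \<open>Differentiation along the variety\<close>

lemma openin_zariski_self: "openin (subtopology zariski M) M"
proof -
  have "zariski_open (UNIV :: (complex^'n) set)"
    unfolding zariski_open_def using polys.const[of 1] by (intro exI[of _ "{\<lambda>x. 1}"]) auto
  then show ?thesis unfolding openin_subtopology by (intro exI[of _ UNIV]) (simp add: openin_zariski)
qed

text \<open>A derivative within \<open>M\<close> need not be determined on all ambient vectors. A
  tangent vector, however, is the velocity of a curve in \<open>M\<close>, the image of a straight
  line under a chart, and composition with that curve gives a derivative in one real variable, which
  is unique.\<close>

lemma deriv_along_eq:
  assumes smooth: "smooth_at M p" and p: "p \<in> M" and v: "v \<in> tangent_space M p"
    and der: "(f has_derivative L) (at p within M)"
  shows "deriv_along M f p v = L v"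
proof -
  obtain Z D e where "adapted_frame M Z D e" "Z \<subseteq> M" "p \<in> Z"
    by (rule adapted_frame_exists[OF smooth openin_zariski_self p])
  then interpret adapted_frame M Z D e by simp
  obtain B \<rho> where ch: "submanifold_chart Z D e p B \<rho>" using chart[OF \<open>p \<in> Z\<close>] by blast
  let ?y = "coord_proj D p"
  have \<rho>: "open B" "?y \<in> B" "\<rho> ?y = p" "\<And>y. y \<in> B \<Longrightarrow> \<rho> y \<in> M"
      "(\<rho> has_derivative (\<lambda>w. \<Sum>a\<in>UNIV. w $ a *s e a p)) (at ?y)"
    using ch \<open>Z \<subseteq> M\<close> unfolding submanifold_chart_def by auto
  define S where "S = (\<lambda>t::real. ?y + t *\<^sub>R v) -` B"
  have S: "open S" "0 \<in> S" unfolding S_def using \<rho>(1,2) by (auto intro!: open_vimage continuous_intros)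
  have "((\<lambda>t. ?y + t *\<^sub>R v) has_derivative (\<lambda>h. h *\<^sub>R v)) (at 0 within S)"
    by (auto intro!: derivative_eq_intros)
  from has_derivative_compose[OF this, of \<rho> "\<lambda>w. \<Sum>a\<in>UNIV. w $ a *s e a p"] \<rho>(5)
  have "((\<lambda>t. \<rho> (?y + t *\<^sub>R v)) has_derivative (\<lambda>h. \<Sum>a\<in>UNIV. (h *\<^sub>R v) $ a *s e a p)) (at 0 within S)"
    by simp
  moreover have "(\<Sum>a\<in>UNIV. (h *\<^sub>R v) $ a *s e a p) = h *\<^sub>R v" for h :: real
    by (subst (2) frame_span[OF \<open>p \<in> Z\<close> v]) (simp add: scaleR_sum_right vec_eq_iff)
  ultimately have \<gamma>: "((\<lambda>t. \<rho> (?y + t *\<^sub>R v)) has_derivative (\<lambda>h. h *\<^sub>R v)) (at 0 within S)" by simp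
  have der': "(f has_derivative frechet_derivative f (at p within M)) (at p within M)"
    using der by (auto simp: frechet_derivative_works[symmetric] differentiable_def)
  have comp: "((\<lambda>t. f (\<rho> (?y + t *\<^sub>R v))) has_derivative (\<lambda>h. L' (h *\<^sub>R v))) (at 0)"
    if "(f has_derivative L') (at p within M)" for L'
  proof -
    have "(f has_derivative L') (at (\<rho> (?y + 0 *\<^sub>R v)) within (\<lambda>t. \<rho> (?y + t *\<^sub>R v)) ` S)"
      using \<rho>(3,4) that by (auto simp: S_def intro: has_derivative_subset)
    from has_derivative_in_compose[OF \<gamma> this]
    show ?thesis unfolding at_within_open[OF S(2,1)] .
  qed
  have "(\<lambda>h. frechet_derivative f (at p within M) (h *\<^sub>R v)) = (\<lambda>h. L (h *\<^sub>R v))"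
    by (rule has_derivative_unique[OF comp[OF der'] comp[OF der]])
  from fun_cong[OF this, of 1] show ?thesis by (simp add: deriv_along_def)
qed

section \<open>Complex differentiability along the variety\<close>

text \<open>Restrictions of regular and of analytic functions both satisfy this pointwise condition,
  so one calculus serves both. Complex linearity of some derivative is what makes
  \<open>deriv_along\<close> complex linear on tangent vectors.\<close>

definition cdiff_at :: "(complex^'n) set \<Rightarrow> (complex^'n \<Rightarrow> complex) \<Rightarrow> complex^'n \<Rightarrow> bool" where
  "cdiff_at M f p \<longleftrightarrow> (\<exists>L. (f has_derivative L) (at p within M) \<and> (\<forall>c v. L (c *s v) = c * L v))"

lemma cdiff_atI: "(f has_derivative L) (at p within M) \<Longrightarrow> (\<And>c v. L (c *s v) = c * L v) \<Longrightarrow> cdiff_at M f p"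
  unfolding cdiff_at_def by blast

lemma cdiff_atE:
  assumes "cdiff_at M f p"
  obtains L where "(f has_derivative L) (at p within M)" "\<And>c v. L (c *s v) = c * L v"
  using assms unfolding cdiff_at_def by blast

lemma has_derivative_transform_openin:
  assumes "(f has_derivative L) (at p within M)" "openin (top_of_set M) V" "p \<in> V" "\<And>x. x \<in> V \<Longrightarrow> f x = g x"
  shows "(g has_derivative L) (at p within M)"
proof -
  obtain T where T: "open T" "V = M \<inter> T" using assms(2) by (auto simp: openin_open)
  show ?thesis
  proof (rule has_derivative_transform_eventually[OF assms(1)])
    show "\<forall>\<^sub>F x in at p within M. f x = g x"
      unfolding eventually_at_topological using T assms(3,4) by (intro exI[of _ T]) auto
  qed (use assms T in auto)
qed

lemma cdiff_at_cong:
  assumes "cdiff_at M f p" "openin (top_of_set M) V" "p \<in> V" "\<And>x. x \<in> V \<Longrightarrow> f x = g x"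
  shows "cdiff_at M g p"
  using assms(1)
proof (rule cdiff_atE)
  fix L assume "(f has_derivative L) (at p within M)" and L: "\<And>c v. L (c *s v) = c * L v"
  then have "(g has_derivative L) (at p within M)"
    using has_derivative_transform_openin[of f L p M V g] assms(2-4) by blast
  then show ?thesis using L by (rule cdiff_atI)
qed

lemma cdiff_at_const: "cdiff_at M (\<lambda>x. c) p"
  by (rule cdiff_atI[OF has_derivative_const]) simp

lemma cdiff_at_add: "cdiff_at M f p \<Longrightarrow> cdiff_at M g p \<Longrightarrow> cdiff_at M (\<lambda>x. f x + g x) p"
  by (elim cdiff_atE, rule cdiff_atI[OF has_derivative_add]) (auto simp: distrib_left)

lemma cdiff_at_mult: "cdiff_at M f p \<Longrightarrow> cdiff_at M g p \<Longrightarrow> cdiff_at M (\<lambda>x. f x * g x) p"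
  by (elim cdiff_atE, rule cdiff_atI[OF has_derivative_mult]) (auto simp: algebra_simps)

lemma cdiff_at_polys: "f \<in> polys \<Longrightarrow> cdiff_at M f p"
  by (rule cdiff_atI[OF polys_has_derivative]) (auto simp: sum_distrib_left mult_ac)

lemma cdiff_at_uminus: "cdiff_at M f p \<Longrightarrow> cdiff_at M (\<lambda>x. - f x) p"
  using cdiff_at_mult[OF cdiff_at_const[of M "-1"]] by simp

lemma cdiff_at_sum: "finite A \<Longrightarrow> (\<And>i. i \<in> A \<Longrightarrow> cdiff_at M (f i) p) \<Longrightarrow> cdiff_at M (\<lambda>x. \<Sum>i\<in>A. f i x) p"
  by (induction A rule: finite_induct) (auto intro: cdiff_at_const cdiff_at_add)

section \<open>Tangent spaces as complex subspaces\<close>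

lemma tangent_space_zero: "0 \<in> tangent_space M p"
  by (auto simp: tangent_space_def vanishing_ideal_def frechet_derivative_polys)

lemma tangent_space_add: "v \<in> tangent_space M p \<Longrightarrow> w \<in> tangent_space M p \<Longrightarrow> v + w \<in> tangent_space M p"
  by (auto simp: tangent_space_def vanishing_ideal_def frechet_derivative_polys sum.distrib distrib_right)

lemma tangent_space_scale: "v \<in> tangent_space M p \<Longrightarrow> c *s v \<in> tangent_space M p"
proof -
  assume v: "v \<in> tangent_space M p"
  have "(\<Sum>i\<in>UNIV. (c *s v) $ i * grad f p $ i) = c * (\<Sum>i\<in>UNIV. v $ i * grad f p $ i)" for f
    by (simp add: sum_distrib_left mult.assoc)
  with v show "c *s v \<in> tangent_space M p"
    unfolding tangent_space_def vanishing_ideal_def by (simp add: frechet_derivative_polys)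
qed

lemma tangent_space_diff: "v \<in> tangent_space M p \<Longrightarrow> w \<in> tangent_space M p \<Longrightarrow> v - w \<in> tangent_space M p"
  using tangent_space_add[of v M p "(-1) *s w"] tangent_space_scale[of w M p "-1"] by simp

lemma tangent_space_sum: "(\<And>i. i \<in> A \<Longrightarrow> f i \<in> tangent_space M p) \<Longrightarrow> (\<Sum>i\<in>A. f i) \<in> tangent_space M p"
  by (induction A rule: infinite_finite_induct) (auto intro: tangent_space_zero tangent_space_add)

section \<open>Rules for derivatives along tangent vectors\<close>

locale smooth_variety =
  fixes M :: "(complex^'n) set"
  assumes smooth: "p \<in> M \<Longrightarrow> smooth_at M p"
begin

lemma deriv_along_has_derivative:
  "(f has_derivative L) (at p within M) \<Longrightarrow> p \<in> M \<Longrightarrow> v \<in> tangent_space M p \<Longrightarrow> deriv_along M f p v = L v"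
  using deriv_along_eq smooth by blast

lemma deriv_along_cong:
  assumes "cdiff_at M f p" "openin (top_of_set M) V" "p \<in> V" "\<And>x. x \<in> V \<Longrightarrow> g x = f x" "v \<in> tangent_space M p"
  shows "deriv_along M g p v = deriv_along M f p v"
proof -
  obtain L where L: "(f has_derivative L) (at p within M)" using assms(1) by (rule cdiff_atE)
  have "p \<in> M" using openin_subset[OF assms(2)] assms(3) by auto
  then show ?thesis
    using deriv_along_has_derivative[OF has_derivative_transform_openin[OF L assms(2,3)], of g]
      deriv_along_has_derivative[OF L] assms(4,5) by simp
qed

context
  fixes p v assumes p: "p \<in> M" and v: "v \<in> tangent_space M p"
begin

lemma deriv_along_const: "deriv_along M (\<lambda>x. c) p v = 0"
  by (rule deriv_along_has_derivative[OF has_derivative_const p v])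

lemma deriv_along_add: "cdiff_at M f p \<Longrightarrow> cdiff_at M g p \<Longrightarrow>
    deriv_along M (\<lambda>x. f x + g x) p v = deriv_along M f p v + deriv_along M g p v"
  by (elim cdiff_atE) (simp add: deriv_along_has_derivative[OF _ p v] deriv_along_has_derivative[OF has_derivative_add p v])

lemma deriv_along_mult: "cdiff_at M f p \<Longrightarrow> cdiff_at M g p \<Longrightarrow>
    deriv_along M (\<lambda>x. f x * g x) p v = deriv_along M f p v * g p + f p * deriv_along M g p v"
  by (elim cdiff_atE) (simp add: deriv_along_has_derivative[OF _ p v] deriv_along_has_derivative[OF has_derivative_mult p v])

lemma deriv_along_uminus: "cdiff_at M f p \<Longrightarrow> deriv_along M (\<lambda>x. - f x) p v = - deriv_along M f p v"
  by (elim cdiff_atE) (simp add: deriv_along_has_derivative[OF _ p v] deriv_along_has_derivative[OF has_derivative_minus p v])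

lemma deriv_along_diff: "cdiff_at M f p \<Longrightarrow> cdiff_at M g p \<Longrightarrow>
    deriv_along M (\<lambda>x. f x - g x) p v = deriv_along M f p v - deriv_along M g p v"
  by (elim cdiff_atE) (simp add: deriv_along_has_derivative[OF _ p v] deriv_along_has_derivative[OF has_derivative_diff p v])

lemma deriv_along_sum: "finite A \<Longrightarrow> (\<And>i. i \<in> A \<Longrightarrow> cdiff_at M (f i) p) \<Longrightarrow>
    deriv_along M (\<lambda>x. \<Sum>i\<in>A. f i x) p v = (\<Sum>i\<in>A. deriv_along M (f i) p v)"
  by (induction A rule: finite_induct) (auto simp: deriv_along_const deriv_along_add cdiff_at_sum)

lemma deriv_along_scale: "cdiff_at M f p \<Longrightarrow> deriv_along M f p (c *s v) = c * deriv_along M f p v"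
  by (elim cdiff_atE) (simp add: deriv_along_has_derivative[OF _ p] v tangent_space_scale)

lemma deriv_along_add_vector:
  assumes "cdiff_at M f p" and w: "w \<in> tangent_space M p"
  shows "deriv_along M f p (v + w) = deriv_along M f p v + deriv_along M f p w"
proof -
  obtain L where L: "(f has_derivative L) (at p within M)" using assms(1) by (rule cdiff_atE)
  show ?thesis
    using deriv_along_has_derivative[OF L p] v w tangent_space_add[OF v w]
      linear_add[OF has_derivative_linear[OF L]] by simp
qed

lemma deriv_along_polys: "f \<in> polys \<Longrightarrow> deriv_along M f p v = frechet_derivative f (at p) v"
  using deriv_along_has_derivative[OF polys_has_derivative p v, of f] by (simp add: frechet_derivative_polys)

text \<open>The derivative selected for a vector valued function is unrelated to those selected for
  its components. They agree because all of them are determined on tangent vectors.\<close>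

lemma deriv_along_nth:
  assumes "\<And>i. cdiff_at M (\<lambda>x. Y x $ i) p"
  shows "deriv_along M Y p v $ (i::'n) = deriv_along M (\<lambda>x. Y x $ i) p v"
proof -
  have "\<exists>L. \<forall>i. ((\<lambda>x. Y x $ i) has_derivative L i) (at p within M)"
    using assms unfolding cdiff_at_def by metis
  then obtain L where L: "\<And>i. ((\<lambda>x. Y x $ i) has_derivative L i) (at p within M)" by blast
  have Y: "(Y has_derivative (\<lambda>v. \<chi> i. L i v)) (at p within M)"
    by (rule has_derivative_vec) (simp add: L)
  then show ?thesis
    using deriv_along_has_derivative[OF Y p v] deriv_along_has_derivative[OF L[of i] p v] by simp
qed

end

lemma deriv_along_sum_vector:
  assumes "p \<in> M" "cdiff_at M f p" "finite A" "\<And>i. i \<in> A \<Longrightarrow> w i \<in> tangent_space M p"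
  shows "deriv_along M f p (\<Sum>i\<in>A. w i) = (\<Sum>i\<in>A. deriv_along M f p (w i))"
  using assms(3,4)
proof (induction A rule: finite_induct)
  case empty
  show ?case using deriv_along_scale[OF assms(1) tangent_space_zero assms(2), of 0] by simp
next
  case (insert x F)
  then show ?case by (simp add: deriv_along_add_vector[OF assms(1) _ assms(2)] tangent_space_sum)
qed

end

section \<open>Regular and analytic functions\<close>

lemma regular_onE:
  assumes "regular_on W f" "p \<in> W"
  obtains a b where "a \<in> polys" "b \<in> polys" "b p \<noteq> 0" "\<And>x. x \<in> W \<Longrightarrow> b x \<noteq> 0 \<Longrightarrow> f x = a x / b x"
proof -
  from assms(1)[unfolded regular_on_def, THEN bspec, OF assms(2)]
  obtain a b where "a \<in> polys" "b \<in> polys" "b p \<noteq> 0" "\<forall>x\<in>W. b x \<noteq> 0 \<longrightarrow> f x = a x / b x"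
    by (elim bexE conjE)
  then show thesis by (intro that[of a b]) simp_all
qed

lemma regular_on_subset:
  assumes "regular_on W f" and sub: "W' \<subseteq> W"
  shows "regular_on W' f"
  unfolding regular_on_def
proof
  fix p assume "p \<in> W'"
  then have p: "p \<in> W" using sub by blast
  obtain a b where ab: "a \<in> polys" "b \<in> polys" "b p \<noteq> 0" "\<And>x. x \<in> W \<Longrightarrow> b x \<noteq> 0 \<Longrightarrow> f x = a x / b x"
    using regular_onE[OF assms(1) p] by metis
  show "\<exists>a\<in>polys. \<exists>b\<in>polys. b p \<noteq> 0 \<and> (\<forall>x\<in>W'. b x \<noteq> 0 \<longrightarrow> f x = a x / b x)"
    by (rule bexI[of _ a], rule bexI[of _ b]) (use ab sub in auto)
qed

lemma regular_on_cong:
  assumes "regular_on W f" and eq: "\<And>x. x \<in> W \<Longrightarrow> g x = f x"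
  shows "regular_on W g"
  unfolding regular_on_def
proof
  fix p assume p: "p \<in> W"
  obtain a b where ab: "a \<in> polys" "b \<in> polys" "b p \<noteq> 0" "\<And>x. x \<in> W \<Longrightarrow> b x \<noteq> 0 \<Longrightarrow> f x = a x / b x"
    using regular_onE[OF assms(1) p] by metis
  show "\<exists>a\<in>polys. \<exists>b\<in>polys. b p \<noteq> 0 \<and> (\<forall>x\<in>W. b x \<noteq> 0 \<longrightarrow> g x = a x / b x)"
    by (rule bexI[of _ a], rule bexI[of _ b]) (use ab eq in simp_all)
qed

lemma regular_on_divide:
  assumes "a \<in> polys" "b \<in> polys" "\<And>x. x \<in> W \<Longrightarrow> b x \<noteq> 0"
  shows "regular_on W (\<lambda>x. a x / b x)"
  unfolding regular_on_def using assms by blast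

lemma regular_on_polys: "f \<in> polys \<Longrightarrow> regular_on W f"
  using regular_on_divide[OF _ polys.const[of 1], of f W] by simp

lemma regular_on_local:
  assumes "\<And>p. p \<in> W \<Longrightarrow> \<exists>b\<in>polys. b p \<noteq> 0 \<and> regular_on {x \<in> W. b x \<noteq> 0} f"
  shows "regular_on W f"
  unfolding regular_on_def
proof
  fix p assume p: "p \<in> W"
  obtain b where b: "b \<in> polys" "b p \<noteq> 0" "regular_on {x \<in> W. b x \<noteq> 0} f" using assms[OF p] by blast
  obtain a c where ac: "a \<in> polys" "c \<in> polys" "c p \<noteq> 0"
    "\<And>x. x \<in> {x \<in> W. b x \<noteq> 0} \<Longrightarrow> c x \<noteq> 0 \<Longrightarrow> f x = a x / c x"
    by (rule regular_onE[OF b(3), of p]) (use p b in auto)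
  \<comment> \<open>Multiplying numerator and denominator by \<open>b\<close> makes the new
    denominator vanish wherever the fraction is not known to represent \<open>f\<close>.\<close>
  then show "\<exists>a\<in>polys. \<exists>b\<in>polys. b p \<noteq> 0 \<and> (\<forall>x\<in>W. b x \<noteq> 0 \<longrightarrow> f x = a x / b x)"
    using b by (intro bexI[of _ "\<lambda>x. a x * b x"] bexI[of _ "\<lambda>x. c x * b x"]) (auto intro: polys.mult)
qed

lemma regular_on_add:
  assumes "regular_on W f" "regular_on W g"
  shows "regular_on W (\<lambda>x. f x + g x)"
  unfolding regular_on_def
proof
  fix p assume p: "p \<in> W"
  obtain a b where ab: "a \<in> polys" "b \<in> polys" "b p \<noteq> 0" "\<And>x. x \<in> W \<Longrightarrow> b x \<noteq> 0 \<Longrightarrow> f x = a x / b x"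
    using regular_onE[OF assms(1) p] by metis
  obtain c d where cd: "c \<in> polys" "d \<in> polys" "d p \<noteq> 0" "\<And>x. x \<in> W \<Longrightarrow> d x \<noteq> 0 \<Longrightarrow> g x = c x / d x"
    using regular_onE[OF assms(2) p] by metis
  show "\<exists>a\<in>polys. \<exists>b\<in>polys. b p \<noteq> 0 \<and> (\<forall>x\<in>W. b x \<noteq> 0 \<longrightarrow> f x + g x = a x / b x)"
    by (rule bexI[of _ "\<lambda>x. a x * d x + c x * b x"], rule bexI[of _ "\<lambda>x. b x * d x"])
      (use ab cd in \<open>auto intro!: polys.mult polys.add simp: add_frac_eq\<close>)
qed

lemma regular_on_mult:
  assumes "regular_on W f" "regular_on W g"
  shows "regular_on W (\<lambda>x. f x * g x)"
  unfolding regular_on_def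
proof
  fix p assume p: "p \<in> W"
  obtain a b where ab: "a \<in> polys" "b \<in> polys" "b p \<noteq> 0" "\<And>x. x \<in> W \<Longrightarrow> b x \<noteq> 0 \<Longrightarrow> f x = a x / b x"
    using regular_onE[OF assms(1) p] by metis
  obtain c d where cd: "c \<in> polys" "d \<in> polys" "d p \<noteq> 0" "\<And>x. x \<in> W \<Longrightarrow> d x \<noteq> 0 \<Longrightarrow> g x = c x / d x"
    using regular_onE[OF assms(2) p] by metis
  show "\<exists>a\<in>polys. \<exists>b\<in>polys. b p \<noteq> 0 \<and> (\<forall>x\<in>W. b x \<noteq> 0 \<longrightarrow> f x * g x = a x / b x)"
    using ab cd by (intro bexI[of _ "\<lambda>x. a x * c x"] bexI[of _ "\<lambda>x. b x * d x"]) (auto intro!: polys.mult)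
qed

lemma regular_on_const: "regular_on W (\<lambda>x. c)"
  by (rule regular_on_polys[OF polys.const])

lemma regular_on_uminus: "regular_on W f \<Longrightarrow> regular_on W (\<lambda>x. - f x)"
  using regular_on_mult[OF regular_on_const[of W "-1"]] by simp

lemma regular_on_diff: "regular_on W f \<Longrightarrow> regular_on W g \<Longrightarrow> regular_on W (\<lambda>x. f x - g x)"
  using regular_on_add[of W f "\<lambda>x. - g x"] regular_on_uminus[of W g] by simp

lemma regular_on_sum: "finite A \<Longrightarrow> (\<And>i. i \<in> A \<Longrightarrow> regular_on W (f i)) \<Longrightarrow> regular_on W (\<lambda>x. \<Sum>i\<in>A. f i x)"
  by (induction A rule: finite_induct) (auto intro: regular_on_const regular_on_add)

section \<open>Holomorphic and analytic functions\<close>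

lemma holo_on_polys_divide:
  assumes "a \<in> polys" "b \<in> polys" "\<And>x. x \<in> B \<Longrightarrow> b x \<noteq> 0"
  shows "holo_on B (\<lambda>x. a x / b x)"
  unfolding holo_on_def
proof
  fix x assume x: "x \<in> B"
  show "\<exists>F'. ((\<lambda>x. a x / b x) has_derivative F') (at x) \<and> (\<forall>c v. F' (c *s v) = c * F' v)"
    by (intro exI conjI, rule has_derivative_divide'[OF polys_has_derivative[OF assms(1)] polys_has_derivative[OF assms(2)] assms(3)[OF x]])
      (auto simp: sum_distrib_left sum_distrib_right sum_subtractf[symmetric] sum_divide_distrib algebra_simps
        intro!: sum.cong)
qed

lemma analytic_fun_on_regular:
  assumes "regular_on W f"
  shows "analytic_fun_on W f"
  unfolding analytic_fun_on_def
proof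
  fix p assume p: "p \<in> W"
  obtain a b where ab: "a \<in> polys" "b \<in> polys" "b p \<noteq> 0" "\<And>x. x \<in> W \<Longrightarrow> b x \<noteq> 0 \<Longrightarrow> f x = a x / b x"
    using regular_onE[OF assms(1) p] by metis
  have "open {x. b x \<noteq> 0}" using open_Collect_neq[OF polys_continuous_on[OF ab(2)] continuous_on_const] .
  then show "\<exists>B F. open B \<and> p \<in> B \<and> holo_on B F \<and> (\<forall>x\<in>B \<inter> W. f x = F x)"
    using ab by (intro exI[of _ "{x. b x \<noteq> 0}"] exI[of _ "\<lambda>x. a x / b x"]) (auto intro: holo_on_polys_divide)
qed

lemma holo_on_subset: "holo_on B F \<Longrightarrow> B' \<subseteq> B \<Longrightarrow> holo_on B' F"
  unfolding holo_on_def by blast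

lemma holo_on_add: "holo_on B F \<Longrightarrow> holo_on B G \<Longrightarrow> holo_on B (\<lambda>x. F x + G x)"
  unfolding holo_on_def
proof
  fix x assume "\<forall>x\<in>B. \<exists>F'. (F has_derivative F') (at x) \<and> (\<forall>c v. F' (c *s v) = c * F' v)"
    "\<forall>x\<in>B. \<exists>F'. (G has_derivative F') (at x) \<and> (\<forall>c v. F' (c *s v) = c * F' v)" "x \<in> B"
  then obtain F' G' where "(F has_derivative F') (at x)" "\<forall>c v. F' (c *s v) = c * F' v"
    "(G has_derivative G') (at x)" "\<forall>c v. G' (c *s v) = c * G' v" by blast
  then show "\<exists>F'. ((\<lambda>x. F x + G x) has_derivative F') (at x) \<and> (\<forall>c v. F' (c *s v) = c * F' v)"
    by (intro exI[of _ "\<lambda>v. F' v + G' v"] conjI has_derivative_add) (auto simp: distrib_left)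
qed

lemma holo_on_mult: "holo_on B F \<Longrightarrow> holo_on B G \<Longrightarrow> holo_on B (\<lambda>x. F x * G x)"
  unfolding holo_on_def
proof
  fix x assume "\<forall>x\<in>B. \<exists>F'. (F has_derivative F') (at x) \<and> (\<forall>c v. F' (c *s v) = c * F' v)"
    "\<forall>x\<in>B. \<exists>F'. (G has_derivative F') (at x) \<and> (\<forall>c v. F' (c *s v) = c * F' v)" "x \<in> B"
  then obtain F' G' where "(F has_derivative F') (at x)" "\<forall>c v. F' (c *s v) = c * F' v"
    "(G has_derivative G') (at x)" "\<forall>c v. G' (c *s v) = c * G' v" by blast
  then show "\<exists>F'. ((\<lambda>x. F x * G x) has_derivative F') (at x) \<and> (\<forall>c v. F' (c *s v) = c * F' v)"
    by (intro exI[of _ "\<lambda>v. F x * G' v + F' v * G x"] conjI has_derivative_mult) (auto simp: algebra_simps)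
qed

lemma analytic_fun_onE:
  assumes "analytic_fun_on V f" "p \<in> V"
  obtains B F where "open B" "p \<in> B" "holo_on B F" "\<And>x. x \<in> B \<Longrightarrow> x \<in> V \<Longrightarrow> f x = F x"
proof -
  from assms(1)[unfolded analytic_fun_on_def, THEN bspec, OF assms(2)]
  obtain B F where "open B" "p \<in> B" "holo_on B F" "\<forall>x\<in>B \<inter> V. f x = F x"
    by (elim exE conjE)
  then show thesis by (intro that[of B F]) simp_all
qed

lemma analytic_fun_on_add:
  assumes "analytic_fun_on V f" "analytic_fun_on V g"
  shows "analytic_fun_on V (\<lambda>x. f x + g x)"
  unfolding analytic_fun_on_def
proof
  fix p assume p: "p \<in> V"
  obtain B F where F: "open B" "p \<in> B" "holo_on B F" "\<And>x. x \<in> B \<Longrightarrow> x \<in> V \<Longrightarrow> f x = F x"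
    using analytic_fun_onE[OF assms(1) p] by metis
  obtain C G where G: "open C" "p \<in> C" "holo_on C G" "\<And>x. x \<in> C \<Longrightarrow> x \<in> V \<Longrightarrow> g x = G x"
    using analytic_fun_onE[OF assms(2) p] by metis
  show "\<exists>B F. open B \<and> p \<in> B \<and> holo_on B F \<and> (\<forall>x\<in>B \<inter> V. f x + g x = F x)"
    using F G by (intro exI[of _ "B \<inter> C"] exI[of _ "\<lambda>x. F x + G x"])
      (auto intro!: holo_on_add intro: holo_on_subset)
qed

lemma analytic_fun_on_mult:
  assumes "analytic_fun_on V f" "analytic_fun_on V g"
  shows "analytic_fun_on V (\<lambda>x. f x * g x)"
  unfolding analytic_fun_on_def
proof
  fix p assume p: "p \<in> V"
  obtain B F where F: "open B" "p \<in> B" "holo_on B F" "\<And>x. x \<in> B \<Longrightarrow> x \<in> V \<Longrightarrow> f x = F x"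
    using analytic_fun_onE[OF assms(1) p] by metis
  obtain C G where G: "open C" "p \<in> C" "holo_on C G" "\<And>x. x \<in> C \<Longrightarrow> x \<in> V \<Longrightarrow> g x = G x"
    using analytic_fun_onE[OF assms(2) p] by metis
  show "\<exists>B F. open B \<and> p \<in> B \<and> holo_on B F \<and> (\<forall>x\<in>B \<inter> V. f x * g x = F x)"
    using F G by (intro exI[of _ "B \<inter> C"] exI[of _ "\<lambda>x. F x * G x"])
      (auto intro!: holo_on_mult intro: holo_on_subset)
qed

lemma analytic_fun_on_sum:
  "finite A \<Longrightarrow> (\<And>i. i \<in> A \<Longrightarrow> analytic_fun_on V (f i)) \<Longrightarrow> analytic_fun_on V (\<lambda>x. \<Sum>i\<in>A. f i x)"
proof (induction A rule: finite_induct)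
  case empty
  show ?case using analytic_fun_on_regular[OF regular_on_const] by simp
next
  case (insert i A)
  then have "analytic_fun_on V (f i)" "analytic_fun_on V (\<lambda>x. \<Sum>i\<in>A. f i x)" by blast+
  from analytic_fun_on_add[OF this] show ?case using insert.hyps by simp
qed

lemma analytic_fun_on_subset:
  assumes f: "analytic_fun_on V f" and sub: "V' \<subseteq> V"
  shows "analytic_fun_on V' f"
  unfolding analytic_fun_on_def
proof
  fix p assume "p \<in> V'"
  then have p: "p \<in> V" using sub by blast
  obtain B F where F: "open B" "p \<in> B" "holo_on B F" "\<And>x. x \<in> B \<Longrightarrow> x \<in> V \<Longrightarrow> f x = F x"
    using analytic_fun_onE[OF f p] by metis
  show "\<exists>B F. open B \<and> p \<in> B \<and> holo_on B F \<and> (\<forall>x\<in>B \<inter> V'. f x = F x)"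
    by (intro exI[of _ B] exI[of _ F]) (use F sub in auto)
qed

lemma analytic_fun_on_cong: "analytic_fun_on V f \<Longrightarrow> (\<And>x. x \<in> V \<Longrightarrow> g x = f x) \<Longrightarrow> analytic_fun_on V g"
  unfolding analytic_fun_on_def by simp

lemma analytic_fun_on_local:
  assumes "\<And>p. p \<in> V \<Longrightarrow> \<exists>V'. openin (top_of_set M) V' \<and> p \<in> V' \<and> analytic_fun_on (V \<inter> V') f" and "V \<subseteq> M"
  shows "analytic_fun_on V f"
  unfolding analytic_fun_on_def
proof
  fix p assume p: "p \<in> V"
  obtain V' where V': "openin (top_of_set M) V'" "p \<in> V'" "analytic_fun_on (V \<inter> V') f"
    using assms(1)[OF p] by (elim exE conjE)
  obtain T where T: "open T" "V' = M \<inter> T" using V'(1) by (auto simp: openin_open)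
  obtain B F where F: "open B" "p \<in> B" "holo_on B F" "\<And>x. x \<in> B \<Longrightarrow> x \<in> V \<inter> V' \<Longrightarrow> f x = F x"
    by (rule analytic_fun_onE[OF V'(3), of p]) (use p V'(2) in auto)
  show "\<exists>B F. open B \<and> p \<in> B \<and> holo_on B F \<and> (\<forall>x\<in>B \<inter> V. f x = F x)"
    using F T V'(2) \<open>V \<subseteq> M\<close> by (intro exI[of _ "B \<inter> T"] exI[of _ F]) (auto intro: holo_on_subset)
qed

lemma cdiff_at_analytic:
  assumes f: "analytic_fun_on V f" and V: "openin (top_of_set M) V" and p: "p \<in> V"
  shows "cdiff_at M f p"
proof -
  obtain B F where F: "open B" "p \<in> B" "holo_on B F" "\<And>x. x \<in> B \<Longrightarrow> x \<in> V \<Longrightarrow> f x = F x"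
    using analytic_fun_onE[OF f p] by metis
  have "openin (top_of_set M) (V \<inter> B)" using V F(1) by (meson openin_Int_open)
  moreover have "cdiff_at M F p"
    using F(2,3) has_derivative_at_withinI unfolding holo_on_def cdiff_at_def by blast
  ultimately show ?thesis using cdiff_at_cong[of M F p "V \<inter> B" f] F p by simp
qed

lemma cdiff_at_regular:
  "regular_on W f \<Longrightarrow> openin (subtopology zariski M) W \<Longrightarrow> p \<in> W \<Longrightarrow> cdiff_at M f p"
  by (rule cdiff_at_analytic) (rule analytic_fun_on_regular zariski_openin_imp_openin | assumption)+

section \<open>Regular vector fields as a module over the regular functions\<close>

lemma regular_vf_subset: "regular_vf M W X \<Longrightarrow> W' \<subseteq> W \<Longrightarrow> regular_vf M W' X"
  using regular_on_subset[of W _ W'] unfolding regular_vf_def by (simp add: subset_iff)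

lemma regular_vf_regular: "regular_vf M W X \<Longrightarrow> regular_on W (\<lambda>x. X x $ i)"
  by (simp add: regular_vf_def)

lemma regular_vf_tangent: "regular_vf M W X \<Longrightarrow> p \<in> W \<Longrightarrow> X p \<in> tangent_space M p"
  by (simp add: regular_vf_def)

lemma regular_vf_add: "regular_vf M W X \<Longrightarrow> regular_vf M W Y \<Longrightarrow> regular_vf M W (\<lambda>x. X x + Y x)"
  unfolding regular_vf_def vector_add_component using regular_on_add tangent_space_add by metis

lemma regular_vf_diff: "regular_vf M W X \<Longrightarrow> regular_vf M W Y \<Longrightarrow> regular_vf M W (\<lambda>x. X x - Y x)"
  unfolding regular_vf_def vector_minus_component using regular_on_diff tangent_space_diff by metis

lemma regular_vf_scale: "regular_on W f \<Longrightarrow> regular_vf M W X \<Longrightarrow> regular_vf M W (\<lambda>x. f x *s X x)"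
  unfolding regular_vf_def vector_smult_component using regular_on_mult tangent_space_scale by metis

lemma regular_vf_zero: "regular_vf M W (\<lambda>x. 0)"
  unfolding regular_vf_def zero_index using regular_on_const tangent_space_zero by metis

lemma regular_vf_sum:
  "finite A \<Longrightarrow> (\<And>i. i \<in> A \<Longrightarrow> regular_vf M W (X i)) \<Longrightarrow> regular_vf M W (\<lambda>x. \<Sum>i\<in>A. X i x)"
proof (induction A rule: finite_induct)
  case empty
  show ?case using regular_vf_zero by simp
next
  case (insert i A)
  then have "regular_vf M W (X i)" "regular_vf M W (\<lambda>x. \<Sum>i\<in>A. X i x)" by blast+
  from regular_vf_add[OF this] show ?case using insert.hyps by simp
qed

section \<open>The Lie bracket\<close>

definition vf_apply :: "(complex^'n) set \<Rightarrow> 'n vfield \<Rightarrow> (complex^'n \<Rightarrow> complex) \<Rightarrow> complex^'n \<Rightarrow> complex" where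
  "vf_apply M X f = (\<lambda>q. deriv_along M f q (X q))"

text \<open>The bracket at \<open>p\<close> only involves first derivatives at \<open>p\<close>, so
  its rules are stated under this pointwise condition and then hold for regular and horizontal
  fields alike.\<close>

definition vdiff_at :: "(complex^'n) set \<Rightarrow> 'n vfield \<Rightarrow> complex^'n \<Rightarrow> bool" where
  "vdiff_at M X p \<longleftrightarrow> (\<forall>i. cdiff_at M (\<lambda>x. X x $ i) p) \<and> X p \<in> tangent_space M p"

lemma vdiff_at_tangent: "vdiff_at M X p \<Longrightarrow> X p \<in> tangent_space M p"
  and vdiff_at_nth: "vdiff_at M X p \<Longrightarrow> cdiff_at M (\<lambda>x. X x $ i) p"
  by (simp_all add: vdiff_at_def)

lemma vdiff_at_add: "vdiff_at M X p \<Longrightarrow> vdiff_at M Y p \<Longrightarrow> vdiff_at M (\<lambda>x. X x + Y x) p"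
  by (simp add: vdiff_at_def cdiff_at_add tangent_space_add)

lemma vdiff_at_scale: "cdiff_at M f p \<Longrightarrow> vdiff_at M X p \<Longrightarrow> vdiff_at M (\<lambda>x. f x *s X x) p"
  by (simp add: vdiff_at_def cdiff_at_mult tangent_space_scale)

lemma vdiff_at_zero: "vdiff_at M (\<lambda>x. 0) p"
  by (simp add: vdiff_at_def cdiff_at_const tangent_space_zero)

lemma vdiff_at_sum:
  assumes "finite A" "\<And>i. i \<in> A \<Longrightarrow> vdiff_at M (X i) p"
  shows "vdiff_at M (\<lambda>x. \<Sum>i\<in>A. X i x) p"
  using assms
proof (induction A rule: finite_induct)
  case empty
  show ?case using vdiff_at_zero by simp
next
  case (insert i A)
  then have "vdiff_at M (X i) p" "vdiff_at M (\<lambda>x. \<Sum>i\<in>A. X i x) p" by blast+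
  from vdiff_at_add[OF this] show ?case using insert.hyps by simp
qed

lemma vdiff_at_regular:
  assumes "regular_vf M W X" "openin (subtopology zariski M) W" "p \<in> W"
  shows "vdiff_at M X p"
  unfolding vdiff_at_def
  using cdiff_at_regular[OF regular_vf_regular[OF assms(1)] assms(2,3)] regular_vf_tangent[OF assms(1,3)] by blast

lemma lie_bracket_swap: "lie_bracket M X Y p = - lie_bracket M Y X p"
  by (simp add: lie_bracket_def)

context smooth_variety
begin

lemma openin_zariski_subset: "openin (subtopology zariski M) W \<Longrightarrow> p \<in> W \<Longrightarrow> p \<in> M"
  using openin_subset[of "subtopology zariski M" W] by auto

lemma vdiff_at_cong:
  assumes "vdiff_at M X p" "openin (top_of_set M) V" "p \<in> V" "\<And>x. x \<in> V \<Longrightarrow> X x = Y x"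
  shows "vdiff_at M Y p"
  unfolding vdiff_at_def
proof (intro conjI allI)
  show "cdiff_at M (\<lambda>x. Y x $ i) p" for i
    by (rule cdiff_at_cong[OF vdiff_at_nth[OF assms(1)] assms(2,3)]) (simp add: assms(4))
  show "Y p \<in> tangent_space M p" using vdiff_at_tangent[OF assms(1)] assms(3,4) by simp
qed

lemma lie_bracket_nth:
  assumes "p \<in> M" "vdiff_at M X p" "vdiff_at M Y p"
  shows "lie_bracket M X Y p $ i = deriv_along M (\<lambda>x. Y x $ i) p (X p) - deriv_along M (\<lambda>x. X x $ i) p (Y p)"
  using assms by (simp add: lie_bracket_def deriv_along_nth vdiff_at_nth vdiff_at_tangent)

lemma lie_bracket_cong:
  assumes V: "openin (top_of_set M) V" "p \<in> V" and X: "vdiff_at M X p" and Y: "vdiff_at M Y p"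
    and eq: "\<And>x. x \<in> V \<Longrightarrow> X' x = X x" "\<And>x. x \<in> V \<Longrightarrow> Y' x = Y x"
  shows "lie_bracket M X' Y' p = lie_bracket M X Y p"
proof -
  have p: "p \<in> M" using openin_subset[OF V(1)] V(2) by auto
  have "vdiff_at M X' p" "vdiff_at M Y' p"
    using vdiff_at_cong[OF X V, of X'] vdiff_at_cong[OF Y V, of Y'] eq by auto
  moreover have "deriv_along M (\<lambda>x. X' x $ i) p v = deriv_along M (\<lambda>x. X x $ i) p v"
    "deriv_along M (\<lambda>x. Y' x $ i) p v = deriv_along M (\<lambda>x. Y x $ i) p v"
    if "v \<in> tangent_space M p" for i v
    using deriv_along_cong[OF vdiff_at_nth[OF X, of i] V, of "\<lambda>x. X' x $ i"]
      deriv_along_cong[OF vdiff_at_nth[OF Y, of i] V, of "\<lambda>x. Y' x $ i"] that by (simp_all add: eq)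
  ultimately show ?thesis
    using eq X Y V(2) by (simp add: vec_eq_iff[of "lie_bracket M X' Y' p"] lie_bracket_nth[OF p] vdiff_at_tangent)
qed

lemma lie_bracket_add_right:
  assumes "p \<in> M" "vdiff_at M X p" "vdiff_at M Y p" "vdiff_at M Z p"
  shows "lie_bracket M X (\<lambda>q. Y q + Z q) p = lie_bracket M X Y p + lie_bracket M X Z p"
  using assms
  by (simp add: vec_eq_iff lie_bracket_nth vdiff_at_add deriv_along_add vdiff_at_nth
      vdiff_at_tangent deriv_along_add_vector)

lemma lie_bracket_scale_right:
  assumes "p \<in> M" "vdiff_at M X p" "vdiff_at M Y p" "cdiff_at M f p"
  shows "lie_bracket M X (\<lambda>q. f q *s Y q) p = deriv_along M f p (X p) *s Y p + f p *s lie_bracket M X Y p"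
  using assms
  by (simp add: vec_eq_iff lie_bracket_nth vdiff_at_scale deriv_along_mult vdiff_at_nth
      vdiff_at_tangent deriv_along_scale algebra_simps)

lemma lie_bracket_add_left:
  assumes "p \<in> M" "vdiff_at M X p" "vdiff_at M Y p" "vdiff_at M Z p"
  shows "lie_bracket M (\<lambda>q. Y q + Z q) X p = lie_bracket M Y X p + lie_bracket M Z X p"
  using lie_bracket_add_right[OF assms]
  by (simp add: lie_bracket_swap[of M _ X] lie_bracket_swap[of M "\<lambda>q. Y q + Z q"])

lemma lie_bracket_scale_left:
  assumes "p \<in> M" "vdiff_at M X p" "vdiff_at M Y p" "cdiff_at M f p"
  shows "lie_bracket M (\<lambda>q. f q *s Y q) X p = f p *s lie_bracket M Y X p - deriv_along M f p (X p) *s Y p"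
  using lie_bracket_scale_right[OF assms] lie_bracket_swap[of M "\<lambda>q. f q *s Y q" X p] lie_bracket_swap[of M Y X p]
  by (simp add: vec_eq_iff)

lemma lie_bracket_sum_right:
  assumes p: "p \<in> M" and X: "vdiff_at M X p" and "finite A" "\<And>i. i \<in> A \<Longrightarrow> vdiff_at M (Y i) p"
  shows "lie_bracket M X (\<lambda>q. \<Sum>i\<in>A. Y i q) p = (\<Sum>i\<in>A. lie_bracket M X (Y i) p)"
  using assms(3,4)
proof (induction A rule: finite_induct)
  case empty
  show ?case using lie_bracket_scale_right[OF p X vdiff_at_zero cdiff_at_const, of 0]
      deriv_along_const[OF p vdiff_at_tangent[OF X]] by simp
next
  case (insert i A)
  then show ?case using lie_bracket_add_right[OF p X, of "Y i" "\<lambda>q. \<Sum>i\<in>A. Y i q"] vdiff_at_sum[of A M Y p] by simp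
qed

text \<open>No quotient is differentiated: where \<open>f * b = a\<close> with polynomials
  \<open>a\<close> and \<open>b\<close>, the product rule gives
  \<open>X a = X f * b + f * X b\<close>, which is solved for \<open>X f\<close>. Polynomials are
  differentiated through their gradients.\<close>

lemma regular_on_vf_apply:
  assumes W: "openin (subtopology zariski M) W" and f: "regular_on W f" and X: "regular_vf M W X"
  shows "regular_on W (vf_apply M X f)"
proof (rule regular_on_local)
  fix p assume p: "p \<in> W"
  obtain a b where ab: "a \<in> polys" "b \<in> polys" "b p \<noteq> 0" "\<And>x. x \<in> W \<Longrightarrow> b x \<noteq> 0 \<Longrightarrow> f x = a x / b x"
    using regular_onE[OF f p] by metis
  define W' where "W' = {x \<in> W. b x \<noteq> 0}"
  have W': "openin (subtopology zariski M) W'"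
    unfolding W'_def by (rule zariski_openin_principal[OF W ab(2)])
  have sub: "W' \<subseteq> W" by (auto simp: W'_def)
  have inv: "regular_on W' (\<lambda>x. 1 / b x)"
    by (rule regular_on_divide[OF polys.const[of 1] ab(2)]) (simp add: W'_def)
  have poly: "regular_on W' (\<lambda>q. \<Sum>i\<in>UNIV. X q $ i * grad g q $ i)" if "g \<in> polys" for g
    by (intro regular_on_sum regular_on_mult regular_on_subset[OF regular_vf_regular[OF X] sub]
        regular_on_polys polys_grad that) simp
  have "regular_on W' (vf_apply M X f)"
  proof (rule regular_on_cong)
    show "regular_on W' (\<lambda>q. (\<Sum>i\<in>UNIV. X q $ i * grad a q $ i) * (1 / b q)
        - (f q * (1 / b q)) * (\<Sum>i\<in>UNIV. X q $ i * grad b q $ i))"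
      by (intro regular_on_diff regular_on_mult poly ab inv regular_on_subset[OF f sub])
    fix q assume q: "q \<in> W'"
    then have qM: "q \<in> M" and b0: "b q \<noteq> 0" using openin_zariski_subset[OF W'] by (auto simp: W'_def)
    have fd: "cdiff_at M f q" using cdiff_at_regular[OF f W] q sub by blast
    have Xq: "X q \<in> tangent_space M q" using regular_vf_tangent[OF X] q sub by blast
    have "(\<Sum>i\<in>UNIV. X q $ i * grad a q $ i) = deriv_along M a q (X q)"
      using deriv_along_polys[OF qM Xq ab(1)] frechet_derivative_polys[OF ab(1)] by simp
    also have "\<dots> = deriv_along M (\<lambda>x. f x * b x) q (X q)"
      by (rule deriv_along_cong[OF cdiff_at_mult[OF fd cdiff_at_polys[OF ab(2)]] zariski_openin_imp_openin[OF W'] q _ Xq])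
        (use ab in \<open>auto simp: W'_def\<close>)
    also have "\<dots> = deriv_along M f q (X q) * b q + f q * deriv_along M b q (X q)"
      by (rule deriv_along_mult[OF qM Xq fd cdiff_at_polys[OF ab(2)]])
    also have "deriv_along M b q (X q) = (\<Sum>i\<in>UNIV. X q $ i * grad b q $ i)"
      using deriv_along_polys[OF qM Xq ab(2)] frechet_derivative_polys[OF ab(2)] by simp
    finally show "vf_apply M X f q = (\<Sum>i\<in>UNIV. X q $ i * grad a q $ i) * (1 / b q)
        - (f q * (1 / b q)) * (\<Sum>i\<in>UNIV. X q $ i * grad b q $ i)"
      using b0 by (simp add: vf_apply_def field_simps)
  qed
  then show "\<exists>b\<in>polys. b p \<noteq> 0 \<and> regular_on {x \<in> W. b x \<noteq> 0} (vf_apply M X f)"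
    using ab unfolding W'_def by blast
qed

section \<open>The bracket as a commutator of derivations\<close>

context
  fixes W X Y
  assumes W: "openin (subtopology zariski M) W" and X: "regular_vf M W X" and Y: "regular_vf M W Y"
begin

definition commutator_at :: "complex^'n \<Rightarrow> (complex^'n \<Rightarrow> complex) \<Rightarrow> complex" where
  "commutator_at p f = vf_apply M X (vf_apply M Y f) p - vf_apply M Y (vf_apply M X f) p"

lemma vf_apply_mult:
  assumes f: "regular_on W f" and g: "regular_on W g" and q: "q \<in> W" and V: "regular_vf M W V"
  shows "vf_apply M V (\<lambda>x. f x * g x) q = vf_apply M V f q * g q + f q * vf_apply M V g q"
  unfolding vf_apply_def
  by (intro deriv_along_mult openin_zariski_subset[OF W q] regular_vf_tangent[OF V q] cdiff_at_regular[OF _ W q] f g)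

lemma vf_apply_add:
  assumes f: "regular_on W f" and g: "regular_on W g" and q: "q \<in> W" and V: "regular_vf M W V"
  shows "vf_apply M V (\<lambda>x. f x + g x) q = vf_apply M V f q + vf_apply M V g q"
  unfolding vf_apply_def
  by (intro deriv_along_add openin_zariski_subset[OF W q] regular_vf_tangent[OF V q] cdiff_at_regular[OF _ W q] f g)

lemma vf_apply_diff:
  assumes f: "regular_on W f" and g: "regular_on W g" and q: "q \<in> W" and V: "regular_vf M W V"
  shows "vf_apply M V (\<lambda>x. f x - g x) q = vf_apply M V f q - vf_apply M V g q"
  unfolding vf_apply_def
  by (intro deriv_along_diff openin_zariski_subset[OF W q] regular_vf_tangent[OF V q] cdiff_at_regular[OF _ W q] f g)

lemma vf_apply_cong:
  assumes f: "regular_on W f" and W': "openin (subtopology zariski M) W'" "W' \<subseteq> W" and q: "q \<in> W'"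
    and V: "regular_vf M W V" and eq: "\<And>x. x \<in> W' \<Longrightarrow> g x = f x"
  shows "vf_apply M V g q = vf_apply M V f q"
  unfolding vf_apply_def using W' q
  by (intro deriv_along_cong[OF cdiff_at_regular[OF f W] zariski_openin_imp_openin[OF W'(1)]]
      regular_vf_tangent[OF V] eq) auto

text \<open>The mixed products of first derivatives are symmetric in the two fields and drop out, so
  the commutator is a derivation at \<open>p\<close>.\<close>

lemma commutator_at_mult:
  assumes f: "regular_on W f" and g: "regular_on W g" and p: "p \<in> W"
  shows "commutator_at p (\<lambda>x. f x * g x) = commutator_at p f * g p + f p * commutator_at p g"
proof -
  have "vf_apply M A (vf_apply M B (\<lambda>x. f x * g x)) p =
    vf_apply M A (vf_apply M B f) p * g p + vf_apply M B f p * vf_apply M A g p +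
    (vf_apply M A f p * vf_apply M B g p + f p * vf_apply M A (vf_apply M B g) p)"
    if A: "regular_vf M W A" and B: "regular_vf M W B" for A B
  proof -
    note r = regular_on_vf_apply[OF W f B] regular_on_vf_apply[OF W g B]
    have "vf_apply M A (vf_apply M B (\<lambda>x. f x * g x)) p =
      vf_apply M A (\<lambda>q. vf_apply M B f q * g q + f q * vf_apply M B g q) p"
      by (rule vf_apply_cong[OF _ W order_refl p A])
        (use r f g vf_apply_mult[OF f g _ B] in \<open>auto intro!: regular_on_add regular_on_mult\<close>)
    then show ?thesis
      using vf_apply_add[OF regular_on_mult[OF r(1) g] regular_on_mult[OF f r(2)] p A]
        vf_apply_mult[OF r(1) g p A] vf_apply_mult[OF f r(2) p A] by simp
  qed
  from this[OF X Y] this[OF Y X] show ?thesis by (simp add: commutator_at_def algebra_simps)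
qed

lemma commutator_at_add:
  assumes f: "regular_on W f" and g: "regular_on W g" and p: "p \<in> W"
  shows "commutator_at p (\<lambda>x. f x + g x) = commutator_at p f + commutator_at p g"
proof -
  have "vf_apply M A (vf_apply M B (\<lambda>x. f x + g x)) p =
    vf_apply M A (vf_apply M B f) p + vf_apply M A (vf_apply M B g) p"
    if A: "regular_vf M W A" and B: "regular_vf M W B" for A B
  proof -
    note r = regular_on_vf_apply[OF W f B] regular_on_vf_apply[OF W g B]
    have "vf_apply M A (vf_apply M B (\<lambda>x. f x + g x)) p = vf_apply M A (\<lambda>q. vf_apply M B f q + vf_apply M B g q) p"
      by (rule vf_apply_cong[OF _ W order_refl p A])
        (use r vf_apply_add[OF f g _ B] in \<open>auto intro!: regular_on_add\<close>)
    then show ?thesis using vf_apply_add[OF r p A] by simp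
  qed
  from this[OF X Y] this[OF Y X] show ?thesis by (simp add: commutator_at_def)
qed

text \<open>As functions of \<open>f\<close> both sides are derivations at \<open>p\<close> and they
  agree on constants and coordinates, hence on all polynomials. The induction takes the place of
  symmetry of second derivatives.\<close>

lemma lie_bracket_polys:
  assumes "f \<in> polys" and p: "p \<in> W"
  shows "frechet_derivative f (at p) (lie_bracket M X Y p) = commutator_at p f"
  using assms(1)
proof induction
  note pM = openin_zariski_subset[OF W p]
  note vd = vdiff_at_regular[OF X W p] vdiff_at_regular[OF Y W p]
  {
    case (const c)
    have "vf_apply M A (vf_apply M B (\<lambda>x. c)) p = 0" if A: "regular_vf M W A" and B: "regular_vf M W B" for A B
    proof -
      have "vf_apply M A (vf_apply M B (\<lambda>x. c)) p = vf_apply M A (\<lambda>x. 0) p"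
        by (rule vf_apply_cong[OF regular_on_const W order_refl p A])
          (simp add: vf_apply_def deriv_along_const openin_zariski_subset[OF W] regular_vf_tangent[OF B])
      then show ?thesis by (simp add: vf_apply_def deriv_along_const pM regular_vf_tangent[OF A p])
    qed
    with X Y show ?case by (simp add: commutator_at_def)
  next
    case (coord i)
    have "vf_apply M A (vf_apply M B (\<lambda>x. x $ i)) p = vf_apply M A (\<lambda>x. B x $ i) p"
      if A: "regular_vf M W A" and B: "regular_vf M W B" for A B
    proof (rule vf_apply_cong[OF regular_vf_regular[OF B] W order_refl p A])
      fix q assume q: "q \<in> W"
      have "((\<lambda>x::complex^'n. x $ i) has_derivative (\<lambda>v. v $ i)) (at q within M)"
        by (rule bounded_linear_imp_has_derivative[OF bounded_linear_vec_nth])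
      from deriv_along_has_derivative[OF this openin_zariski_subset[OF W q] regular_vf_tangent[OF B q]]
      show "vf_apply M B (\<lambda>x. x $ i) q = B q $ i" by (simp add: vf_apply_def)
    qed
    from this[OF X Y] this[OF Y X]
    have "commutator_at p (\<lambda>x. x $ i) = lie_bracket M X Y p $ i"
      by (simp add: commutator_at_def lie_bracket_nth[OF pM vd] vf_apply_def)
    moreover have "((\<lambda>x::complex^'n. x $ i) has_derivative (\<lambda>v. v $ i)) (at p)"
      by (rule bounded_linear_imp_has_derivative[OF bounded_linear_vec_nth])
    ultimately show ?case using fun_cong[OF frechet_derivative_at] by metis
  next
    case (add f g)
    have "frechet_derivative (\<lambda>x. f x + g x) (at p) v = frechet_derivative f (at p) v + frechet_derivative g (at p) v" for v
      using fun_cong[OF frechet_derivative_at[OF has_derivative_add[OF polys_has_derivative[OF add.hyps(1)]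
        polys_has_derivative[OF add.hyps(2)], of p UNIV]], of v] add.hyps
      by (simp add: frechet_derivative_polys)
    then show ?case
      using add commutator_at_add[OF regular_on_polys regular_on_polys p, of f g] by simp
  next
    case (mult f g)
    have "frechet_derivative (\<lambda>x. f x * g x) (at p) v = frechet_derivative f (at p) v * g p + f p * frechet_derivative g (at p) v" for v
      using fun_cong[OF frechet_derivative_at[OF has_derivative_mult[OF polys_has_derivative[OF mult.hyps(1)]
        polys_has_derivative[OF mult.hyps(2)], of p UNIV]], of v, symmetric] mult.hyps
      by (simp add: frechet_derivative_polys)
    then show ?case
      using mult commutator_at_mult[OF regular_on_polys regular_on_polys p, of f g] by simp
  }
qed

text \<open>The components are differences of regular functions of the form \<open>X (Y_i)\<close>.
  For tangency, a polynomial vanishing on \<open>M\<close> has zero derivative along each field on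
  all of \<open>W\<close>, so its commutator vanishes.\<close>

lemma regular_vf_lie_bracket: "regular_vf M W (lie_bracket M X Y)"
  unfolding regular_vf_def
proof (intro conjI allI ballI)
  fix i
  have "regular_on W (\<lambda>x. vf_apply M X (\<lambda>x. Y x $ i) x - vf_apply M Y (\<lambda>x. X x $ i) x)"
    by (intro regular_on_diff regular_on_vf_apply W regular_vf_regular[OF X] regular_vf_regular[OF Y] X Y)
  then show "regular_on W (\<lambda>x. lie_bracket M X Y x $ i)"
    by (rule regular_on_cong)
      (simp add: lie_bracket_nth openin_zariski_subset[OF W] vdiff_at_regular[OF X W] vdiff_at_regular[OF Y W] vf_apply_def)
next
  fix p assume p: "p \<in> W"
  have "frechet_derivative f (at p) (lie_bracket M X Y p) = 0" if f: "f \<in> vanishing_ideal M" for f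
  proof -
    have fp: "f \<in> polys" and f0: "\<And>x. x \<in> M \<Longrightarrow> f x = 0" using f by (auto simp: vanishing_ideal_def)
    have "vf_apply M A (vf_apply M B f) p = 0" if A: "regular_vf M W A" and B: "regular_vf M W B" for A B
    proof -
      have "vf_apply M B f q = 0" if q: "q \<in> W" for q
        using regular_vf_tangent[OF B q] f deriv_along_polys[OF openin_zariski_subset[OF W q] regular_vf_tangent[OF B q] fp]
        by (simp add: vf_apply_def tangent_space_def)
      then have "vf_apply M A (vf_apply M B f) p = vf_apply M A (\<lambda>x. 0) p"
        by (intro vf_apply_cong[OF regular_on_const W order_refl p A])
      then show ?thesis by (simp add: vf_apply_def deriv_along_const openin_zariski_subset[OF W p] regular_vf_tangent[OF A p])
    qed
    with X Y show ?thesis by (simp add: lie_bracket_polys[OF fp p] commutator_at_def)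
  qed
  then show "lie_bracket M X Y p \<in> tangent_space M p" by (simp add: tangent_space_def)
qed

end

text \<open>Extends the commutator identity from polynomials to regular functions: apply it to both
  sides of \<open>f * b = a\<close>, where both operators are derivations, and cancel
  \<open>b p\<close>, which is nonzero.\<close>

lemma vf_apply_lie_bracket:
  assumes W: "openin (subtopology zariski M) W" and X: "regular_vf M W X" and Y: "regular_vf M W Y"
    and f: "regular_on W f" and p: "p \<in> W"
  shows "vf_apply M (lie_bracket M X Y) f p = vf_apply M X (vf_apply M Y f) p - vf_apply M Y (vf_apply M X f) p"
proof -
  obtain a b where ab: "a \<in> polys" "b \<in> polys" "b p \<noteq> 0" "\<And>x. x \<in> W \<Longrightarrow> b x \<noteq> 0 \<Longrightarrow> f x = a x / b x"
    using regular_onE[OF f p] by metis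
  define W' where "W' = {x \<in> W. b x \<noteq> 0}"
  have W': "openin (subtopology zariski M) W'"
    unfolding W'_def by (rule zariski_openin_principal[OF W ab(2)])
  have sub: "W' \<subseteq> W" and p': "p \<in> W'" using p ab by (auto simp: W'_def)
  note pM = openin_zariski_subset[OF W p]
  note r = regular_vf_subset[OF X sub] regular_vf_subset[OF Y sub]
  note f' = regular_on_subset[OF f sub] and b' = regular_on_polys[OF ab(2), of W']
    and a' = regular_on_polys[OF ab(1), of W']
  let ?v = "lie_bracket M X Y p"
  have v: "?v \<in> tangent_space M p" using regular_vf_tangent[OF regular_vf_lie_bracket[OF W X Y] p] .
  have fb: "f x * b x = a x" if "x \<in> W'" for x using ab(4) that by (simp add: W'_def)
  have cong: "vf_apply M B (\<lambda>x. f x * b x) q = vf_apply M B a q" if "regular_vf M W' B" "q \<in> W'" for B q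
    by (rule vf_apply_cong[OF W' r a' W' order_refl that(2) that(1)]) (simp add: fb)
  have "vf_apply M A (vf_apply M B (\<lambda>x. f x * b x)) p = vf_apply M A (vf_apply M B a) p"
    if A: "regular_vf M W' A" and B: "regular_vf M W' B" for A B
    by (rule vf_apply_cong[OF W' r regular_on_vf_apply[OF W' a' B] W' order_refl p' A]) (rule cong[OF B])
  from this[OF r] this[OF r(2,1)]
  have "commutator_at X Y p (\<lambda>x. f x * b x) = commutator_at X Y p a"
    by (simp add: commutator_at_def[OF W' r])
  then have "commutator_at X Y p f * b p + f p * frechet_derivative b (at p) ?v = frechet_derivative a (at p) ?v"
    using commutator_at_mult[OF W' r f' b' p'] lie_bracket_polys[OF W' r ab(1) p'] lie_bracket_polys[OF W' r ab(2) p'] by simp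
  also have "frechet_derivative a (at p) ?v = deriv_along M (\<lambda>x. f x * b x) p ?v"
    using deriv_along_polys[OF pM v ab(1)]
      deriv_along_cong[OF cdiff_at_polys[OF ab(1)] zariski_openin_imp_openin[OF W'] p', of "\<lambda>x. f x * b x"] fb v by simp
  also have "\<dots> = deriv_along M f p ?v * b p + f p * frechet_derivative b (at p) ?v"
    using deriv_along_mult[OF pM v cdiff_at_regular[OF f W p] cdiff_at_polys[OF ab(2)]] deriv_along_polys[OF pM v ab(2)]
    by simp
  finally have "commutator_at X Y p f = deriv_along M f p ?v" using ab(3) by simp
  then show ?thesis by (simp add: vf_apply_def[of M "lie_bracket M X Y"] commutator_at_def[OF W' r])
qed

text \<open>Applied to a coordinate function, each iterated bracket becomes four triple applications
  of the fields. In the combination of the three brackets these cancel in pairs.\<close>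

lemma lie_bracket_jacobi:
  assumes W: "openin (subtopology zariski M) W" and p: "p \<in> W"
    and X: "regular_vf M W X" and Y: "regular_vf M W Y" and Z: "regular_vf M W Z"
  shows "lie_bracket M X (lie_bracket M Y Z) p =
    lie_bracket M Y (lie_bracket M X Z) p + lie_bracket M (lie_bracket M X Y) Z p"
proof (subst vec_eq_iff, intro allI)
  fix i :: 'n
  note pM = openin_zariski_subset[OF W]
  let ?c = "\<lambda>V x. V x $ i"
  have nth: "lie_bracket M A B q $ i = vf_apply M A (?c B) q - vf_apply M B (?c A) q"
    if "regular_vf M W A" "regular_vf M W B" "q \<in> W" for A B q
    using lie_bracket_nth[OF pM[OF that(3)] vdiff_at_regular[OF that(1) W that(3)] vdiff_at_regular[OF that(2) W that(3)]]
    by (simp add: vf_apply_def)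
  have 1: "vf_apply M A (?c (lie_bracket M B C)) p = vf_apply M A (vf_apply M B (?c C)) p - vf_apply M A (vf_apply M C (?c B)) p"
    if A: "regular_vf M W A" and B: "regular_vf M W B" and C: "regular_vf M W C" for A B C
  proof -
    note r = regular_on_vf_apply[OF W regular_vf_regular[OF C] B] regular_on_vf_apply[OF W regular_vf_regular[OF B] C]
    have "vf_apply M A (?c (lie_bracket M B C)) p = vf_apply M A (\<lambda>q. vf_apply M B (?c C) q - vf_apply M C (?c B) q) p"
      by (rule vf_apply_cong[OF W A A regular_on_diff[OF r] W order_refl p A]) (rule nth[OF B C])
    also have "\<dots> = vf_apply M A (vf_apply M B (?c C)) p - vf_apply M A (vf_apply M C (?c B)) p"
      by (rule vf_apply_diff[OF W A A r p A])
    finally show ?thesis .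
  qed
  have 2: "vf_apply M (lie_bracket M B C) (?c A) p = vf_apply M B (vf_apply M C (?c A)) p - vf_apply M C (vf_apply M B (?c A)) p"
    if A: "regular_vf M W A" and B: "regular_vf M W B" and C: "regular_vf M W C" for A B C
    by (rule vf_apply_lie_bracket[OF W B C regular_vf_regular[OF A] p])
  note br = regular_vf_lie_bracket[OF W]
  have 3: "lie_bracket M A (lie_bracket M B C) p $ i =
      vf_apply M A (vf_apply M B (?c C)) p - vf_apply M A (vf_apply M C (?c B)) p
      - (vf_apply M B (vf_apply M C (?c A)) p - vf_apply M C (vf_apply M B (?c A)) p)"
    if A: "regular_vf M W A" and B: "regular_vf M W B" and C: "regular_vf M W C" for A B C
    using nth[OF A br[OF B C] p] 1[OF A B C] 2[OF A B C] by simp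
  have "lie_bracket M (lie_bracket M X Y) Z p $ i = - (lie_bracket M Z (lie_bracket M X Y) p $ i)"
    by (subst lie_bracket_swap) simp
  then show "lie_bracket M X (lie_bracket M Y Z) p $ i =
    (lie_bracket M Y (lie_bracket M X Z) p + lie_bracket M (lie_bracket M X Y) Z p) $ i"
    using 3[OF X Y Z] 3[OF Y X Z] 3[OF Z X Y] by simp
qed

end

section \<open>Linear connections\<close>

locale connection = smooth_variety M for M :: "(complex^'n) set" +
  fixes U :: "(complex^'n) set" and nabla :: "'n covder"
  assumes linear_connection: "linear_connection_on M U nabla"
begin

lemma open_U: "openin (subtopology zariski M) U"
  using linear_connection by (simp add: linear_connection_on_def)

context
  fixes W X Y
  assumes W: "openin (subtopology zariski M) W" and WU: "W \<subseteq> U"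
    and X: "regular_vf M W X" and Y: "regular_vf M W Y"
begin

lemmas nabla_axioms = linear_connection[unfolded linear_connection_on_def, THEN conjunct2, THEN spec, of W,
    THEN mp, OF conjI[OF W WU], THEN spec, THEN spec, of X Y, THEN mp, OF conjI[OF X Y]]

lemma nabla_regular: "regular_vf M W (nabla X Y)"
  by (rule nabla_axioms[THEN conjunct1])

lemma nabla_cong:
  assumes "p \<in> W" "\<And>p. p \<in> W \<Longrightarrow> X' p = X p" "\<And>p. p \<in> W \<Longrightarrow> Y' p = Y p"
  shows "nabla X' Y' p = nabla X Y p"
  using nabla_axioms[THEN conjunct2, THEN conjunct1, rule_format, of X' Y' p] assms by simp

context
  fixes Z p assumes Z: "regular_vf M W Z" and p: "p \<in> W"
begin

lemmas nabla_add_axioms = nabla_axioms[THEN conjunct2, THEN conjunct2, THEN conjunct1, THEN spec, of Z,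
    THEN mp, OF Z, THEN bspec, OF p]

lemma nabla_add_left: "nabla (\<lambda>q. X q + Z q) Y p = nabla X Y p + nabla Z Y p"
  by (rule nabla_add_axioms[THEN conjunct1])

lemma nabla_add_right: "nabla X (\<lambda>q. Y q + Z q) p = nabla X Y p + nabla X Z p"
  by (rule nabla_add_axioms[THEN conjunct2])

end

context
  fixes f p assumes f: "regular_on W f" and p: "p \<in> W"
begin

lemmas nabla_scale_axioms = nabla_axioms[THEN conjunct2, THEN conjunct2, THEN conjunct2, THEN spec, of f,
    THEN mp, OF f, THEN bspec, OF p]

lemma nabla_scale_left: "nabla (\<lambda>q. f q *s X q) Y p = f p *s nabla X Y p"
  by (rule nabla_scale_axioms[THEN conjunct1])

lemma nabla_scale_right:
  "nabla X (\<lambda>q. f q *s Y q) p = deriv_along M f p (X p) *s Y p + f p *s nabla X Y p"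
  by (rule nabla_scale_axioms[THEN conjunct2])

end

end

context
  fixes W assumes W: "openin (subtopology zariski M) W" and WU: "W \<subseteq> U"
begin

lemma nabla_zero_right:
  assumes X: "regular_vf M W X" and p: "p \<in> W"
  shows "nabla X (\<lambda>q. 0) p = 0"
  using nabla_scale_right[OF W WU X regular_vf_zero regular_on_const p, of 0]
    deriv_along_const[OF openin_zariski_subset[OF W p] regular_vf_tangent[OF X p]] by simp

lemma nabla_zero_left:
  assumes X: "regular_vf M W X" and p: "p \<in> W"
  shows "nabla (\<lambda>q. 0) X p = 0"
  using nabla_scale_left[OF W WU regular_vf_zero X regular_on_const p, of 0] by simp

lemma nabla_diff_right:
  assumes X: "regular_vf M W X" and Y: "regular_vf M W Y" and Z: "regular_vf M W Z" and p: "p \<in> W"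
  shows "nabla Z (\<lambda>q. X q - Y q) p = nabla Z X p - nabla Z Y p"
  using nabla_add_right[OF W WU Z regular_vf_diff[OF X Y] Y p] by simp

section \<open>Torsion and its covariant derivative as tensors\<close>

lemma torsion_regular:
  assumes X: "regular_vf M W X" and Y: "regular_vf M W Y"
  shows "regular_vf M W (torsion M nabla X Y)"
  unfolding torsion_def
  by (intro regular_vf_diff nabla_regular[OF W WU] regular_vf_lie_bracket[OF W] X Y)

lemma torsion_swap: "torsion M nabla X Y p = - torsion M nabla Y X p"
  using lie_bracket_swap[of M X Y p] by (simp add: torsion_def)

lemma torsion_cong:
  assumes X: "regular_vf M W X" and Y: "regular_vf M W Y" and p: "p \<in> W"
    and eq: "\<And>p. p \<in> W \<Longrightarrow> X' p = X p" "\<And>p. p \<in> W \<Longrightarrow> Y' p = Y p"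
  shows "torsion M nabla X' Y' p = torsion M nabla X Y p"
  using nabla_cong[OF W WU X Y p eq] nabla_cong[OF W WU Y X p eq(2,1)]
    lie_bracket_cong[OF zariski_openin_imp_openin[OF W] p vdiff_at_regular[OF X W p] vdiff_at_regular[OF Y W p] eq]
  by (simp add: torsion_def)

lemma torsion_add_right:
  assumes X: "regular_vf M W X" and Y: "regular_vf M W Y" and Z: "regular_vf M W Z" and p: "p \<in> W"
  shows "torsion M nabla X (\<lambda>q. Y q + Z q) p = torsion M nabla X Y p + torsion M nabla X Z p"
  using nabla_add_right[OF W WU X Y Z p] nabla_add_left[OF W WU Y X Z p]
    lie_bracket_add_right[OF openin_zariski_subset[OF W p] vdiff_at_regular[OF X W p]
      vdiff_at_regular[OF Y W p] vdiff_at_regular[OF Z W p]]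
  by (simp add: torsion_def)

lemma torsion_scale_right:
  assumes X: "regular_vf M W X" and Y: "regular_vf M W Y" and f: "regular_on W f" and p: "p \<in> W"
  shows "torsion M nabla X (\<lambda>q. f q *s Y q) p = f p *s torsion M nabla X Y p"
  using nabla_scale_right[OF W WU X Y f p] nabla_scale_left[OF W WU Y X f p]
    lie_bracket_scale_right[OF openin_zariski_subset[OF W p] vdiff_at_regular[OF X W p]
      vdiff_at_regular[OF Y W p] cdiff_at_regular[OF f W p]]
  by (simp add: torsion_def vec_eq_iff algebra_simps)

lemma nabla_torsion_swap:
  assumes X: "regular_vf M W X" and Y: "regular_vf M W Y" and Z: "regular_vf M W Z" and p: "p \<in> W"
  shows "nabla_torsion M nabla X Y Z p = - nabla_torsion M nabla X Z Y p"
proof -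
  have "nabla X (torsion M nabla Y Z) p = nabla X (\<lambda>q. 0 - torsion M nabla Z Y q) p"
    by (rule nabla_cong[OF W WU X regular_vf_diff[OF regular_vf_zero torsion_regular[OF Z Y]] p refl])
      (use torsion_swap[of Y Z] in simp)
  also have "\<dots> = - nabla X (torsion M nabla Z Y) p"
    using nabla_diff_right[OF regular_vf_zero torsion_regular[OF Z Y] X p] nabla_zero_right[OF X p] by simp
  finally show ?thesis
    using torsion_swap[of "nabla X Y" Z p] torsion_swap[of Y "nabla X Z" p] by (simp add: nabla_torsion_def)
qed

lemma nabla_torsion_add_right:
  assumes X: "regular_vf M W X" and Y: "regular_vf M W Y" and Z: "regular_vf M W Z"
    and V: "regular_vf M W V" and p: "p \<in> W"
  shows "nabla_torsion M nabla X Y (\<lambda>q. Z q + V q) p = nabla_torsion M nabla X Y Z p + nabla_torsion M nabla X Y V p"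
proof -
  note n = nabla_regular[OF W WU]
  have "nabla X (torsion M nabla Y (\<lambda>q. Z q + V q)) p = nabla X (\<lambda>q. torsion M nabla Y Z q + torsion M nabla Y V q) p"
    by (rule nabla_cong[OF W WU X regular_vf_add[OF torsion_regular[OF Y Z] torsion_regular[OF Y V]] p refl])
      (rule torsion_add_right[OF Y Z V])
  moreover have "torsion M nabla Y (nabla X (\<lambda>q. Z q + V q)) p = torsion M nabla Y (\<lambda>q. nabla X Z q + nabla X V q) p"
    by (rule torsion_cong[OF Y regular_vf_add[OF n[OF X Z] n[OF X V]] p refl]) (rule nabla_add_right[OF W WU X Z V])
  ultimately show ?thesis
    using nabla_add_right[OF W WU X torsion_regular[OF Y Z] torsion_regular[OF Y V] p]
      torsion_add_right[OF Y n[OF X Z] n[OF X V] p] torsion_add_right[OF n[OF X Y] Z V p]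
    by (simp add: nabla_torsion_def)
qed

text \<open>The outer derivative of \<open>f Tor(Y,Z)\<close> and the derivative of
  \<open>f Z\<close> inside the torsion both produce \<open>(X f) Tor(Y,Z)\<close>, with opposite
  signs.\<close>

lemma nabla_torsion_scale_right:
  assumes X: "regular_vf M W X" and Y: "regular_vf M W Y" and Z: "regular_vf M W Z"
    and f: "regular_on W f" and p: "p \<in> W"
  shows "nabla_torsion M nabla X Y (\<lambda>q. f q *s Z q) p = f p *s nabla_torsion M nabla X Y Z p"
proof -
  note n = nabla_regular[OF W WU]
  have df: "regular_on W (\<lambda>q. deriv_along M f q (X q))"
    using regular_on_vf_apply[OF W f X] by (simp add: vf_apply_def)
  have "nabla X (torsion M nabla Y (\<lambda>q. f q *s Z q)) p = nabla X (\<lambda>q. f q *s torsion M nabla Y Z q) p"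
    by (rule nabla_cong[OF W WU X regular_vf_scale[OF f torsion_regular[OF Y Z]] p refl])
      (rule torsion_scale_right[OF Y Z f])
  moreover have "torsion M nabla Y (nabla X (\<lambda>q. f q *s Z q)) p =
      torsion M nabla Y (\<lambda>q. deriv_along M f q (X q) *s Z q + f q *s nabla X Z q) p"
    by (rule torsion_cong[OF Y regular_vf_add[OF regular_vf_scale[OF df Z] regular_vf_scale[OF f n[OF X Z]]] p refl])
      (rule nabla_scale_right[OF W WU X Z f])
  moreover have "\<dots> = deriv_along M f p (X p) *s torsion M nabla Y Z p + f p *s torsion M nabla Y (nabla X Z) p"
    using torsion_add_right[OF Y regular_vf_scale[OF df Z] regular_vf_scale[OF f n[OF X Z]] p]
      torsion_scale_right[OF Y Z df p] torsion_scale_right[OF Y n[OF X Z] f p] by simp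
  ultimately show ?thesis
    using nabla_scale_right[OF W WU X torsion_regular[OF Y Z] f p]
      torsion_scale_right[OF n[OF X Y] Z f p]
    by (simp add: nabla_torsion_def vec_eq_iff algebra_simps)
qed

text \<open>Combined with the first Bianchi identity this is the usual formula for the curvature of
  \<open>nabla - Tor\<close>, but a direct expansion only needs the Jacobi identity.\<close>
lemma curvature_reciprocal:
  assumes X: "regular_vf M W X" and Y: "regular_vf M W Y" and Z: "regular_vf M W Z" and p: "p \<in> W"
  shows "curvature M (reciprocal M nabla) X Y Z p = nabla_torsion M nabla Z X Y p
    + curvature M nabla X Z Y p - curvature M nabla Y Z X p"
proof -
  note n = nabla_regular[OF W WU] and br = regular_vf_lie_bracket[OF W]
  note pM = openin_zariski_subset[OF W p]
  note vd = vdiff_at_regular[OF _ W p]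
  have 1: "reciprocal M nabla A (reciprocal M nabla B C) p = nabla (nabla C B) A p + nabla (lie_bracket M B C) A p
     + lie_bracket M A (nabla C B) p + lie_bracket M A (lie_bracket M B C) p"
    if A: "regular_vf M W A" and B: "regular_vf M W B" and C: "regular_vf M W C" for A B C
    using nabla_add_left[OF W WU n[OF C B] A br[OF B C] p]
      lie_bracket_add_right[OF pM vd[OF A] vd[OF n[OF C B]] vd[OF br[OF B C]]]
    by (simp add: reciprocal_def)
  have 2: "nabla Z (torsion M nabla X Y) p = nabla Z (nabla X Y) p - nabla Z (nabla Y X) p - nabla Z (lie_bracket M X Y) p"
    using nabla_diff_right[OF regular_vf_diff[OF n[OF X Y] n[OF Y X]] br[OF X Y] Z p]
      nabla_diff_right[OF n[OF X Y] n[OF Y X] Z p] by (simp add: torsion_def)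
  have 3: "reciprocal M nabla (lie_bracket M X Y) Z p = nabla Z (lie_bracket M X Y) p + lie_bracket M (lie_bracket M X Y) Z p"
    by (simp add: reciprocal_def)
  have 4: "torsion M nabla (nabla Z X) Y p = nabla (nabla Z X) Y p - nabla Y (nabla Z X) p - lie_bracket M (nabla Z X) Y p"
    and 5: "torsion M nabla X (nabla Z Y) p = nabla X (nabla Z Y) p - nabla (nabla Z Y) X p - lie_bracket M X (nabla Z Y) p"
    by (simp_all add: torsion_def)
  \<comment> \<open>Jacobi removes the iterated brackets. Derivatives in the directions
    \<open>nabla Z X\<close> and \<open>nabla Z Y\<close> belong to the torsion terms, those in
    bracket directions to the two curvatures of \<open>nabla\<close>.\<close>
  show ?thesis
    using 1[OF X Y Z] 1[OF Y X Z] 2 3 lie_bracket_jacobi[OF W p X Y Z]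
      lie_bracket_swap[of M "nabla Z X" Y p]
    by (simp add: curvature_def nabla_torsion_def 4 5)
qed

section \<open>The reciprocal as a connection\<close>

lemma reciprocal_regular:
  assumes X: "regular_vf M W X" and Y: "regular_vf M W Y"
  shows "regular_vf M W (reciprocal M nabla X Y)"
  unfolding reciprocal_def by (intro regular_vf_add nabla_regular[OF W WU] regular_vf_lie_bracket[OF W] X Y)

end

text \<open>Exchanging the arguments also exchanges the tensorial slot and the Leibniz slot. The
  bracket repairs this: its derivative term cancels the unwanted one in the first slot and supplies
  the missing one in the second.\<close>

lemma connection_reciprocal: "connection M U (reciprocal M nabla)"
proof
  show "linear_connection_on M U (reciprocal M nabla)"
    unfolding linear_connection_on_def
  proof (intro conjI allI impI ballI open_U; (elim conjE)?)
    fix W X Y assume W: "openin (subtopology zariski M) W" and WU: "W \<subseteq> U"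
      and X: "regular_vf M W X" and Y: "regular_vf M W Y"
    note vX = vdiff_at_regular[OF X W] and vY = vdiff_at_regular[OF Y W] and pM = openin_zariski_subset[OF W]
    show "regular_vf M W (reciprocal M nabla X Y)" by (rule reciprocal_regular[OF W WU X Y])
    {
      fix X' Y' p assume eq: "\<forall>p\<in>W. X' p = X p \<and> Y' p = Y p" and p: "p \<in> W"
      then show "reciprocal M nabla X' Y' p = reciprocal M nabla X Y p"
        using nabla_cong[OF W WU Y X p, of Y' X'] lie_bracket_cong[OF zariski_openin_imp_openin[OF W] p vX[OF p] vY[OF p], of X' Y']
        by (simp add: reciprocal_def)
    next
      fix Z p assume Z: "regular_vf M W Z" and p: "p \<in> W"
      note v = pM[OF p] vX[OF p] vY[OF p] vdiff_at_regular[OF Z W p]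
      show "reciprocal M nabla (\<lambda>q. X q + Z q) Y p = reciprocal M nabla X Y p + reciprocal M nabla Z Y p"
        using nabla_add_right[OF W WU Y X Z p] lie_bracket_add_left[OF v(1,3,2,4)] by (simp add: reciprocal_def)
      show "reciprocal M nabla X (\<lambda>q. Y q + Z q) p = reciprocal M nabla X Y p + reciprocal M nabla X Z p"
        using nabla_add_left[OF W WU Y X Z p] lie_bracket_add_right[OF v] by (simp add: reciprocal_def)
    next
      fix f p assume f: "regular_on W f" and p: "p \<in> W"
      note v = pM[OF p] vX[OF p] vY[OF p] cdiff_at_regular[OF f W p]
      show "reciprocal M nabla (\<lambda>q. f q *s X q) Y p = f p *s reciprocal M nabla X Y p"
        using nabla_scale_right[OF W WU Y X f p] lie_bracket_scale_left[OF v(1,3,2,4)]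
        by (simp add: reciprocal_def vec_eq_iff algebra_simps)
      show "reciprocal M nabla X (\<lambda>q. f q *s Y q) p =
          deriv_along M f p (X p) *s Y p + f p *s reciprocal M nabla X Y p"
        using nabla_scale_left[OF W WU Y X f p] lie_bracket_scale_right[OF v]
        by (simp add: reciprocal_def vec_eq_iff algebra_simps)
    }
  qed
qed

lemma constant_torsion_iff_flat_reciprocal:
  assumes flat: "flat M U nabla"
  shows "constant_torsion M U nabla \<longleftrightarrow> flat M U (reciprocal M nabla)"
proof -
  have "curvature M (reciprocal M nabla) X Y Z p = nabla_torsion M nabla Z X Y p"
    if "openin (subtopology zariski M) W" "W \<subseteq> U" "regular_vf M W X" "regular_vf M W Y" "regular_vf M W Z" "p \<in> W"
    for W X Y Z p
  proof -
    have "curvature M nabla X Z Y p = 0" "curvature M nabla Y Z X p = 0"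
      using flat that unfolding flat_def by blast+
    then show ?thesis using curvature_reciprocal[OF that] by simp
  qed
  then show ?thesis unfolding flat_def constant_torsion_def by metis
qed

end

text \<open>Antisymmetry of the bracket makes this an equality of operators on arbitrary total
  functions, so statements about one connection can be rewritten into statements about the
  other.\<close>

lemma reciprocal_reciprocal: "reciprocal M (reciprocal M nabla) = nabla"
  by (intro ext) (simp add: reciprocal_def lie_bracket_def)

section \<open>Horizontal vector fields in an adapted frame\<close>

locale framed_connection = connection M U nabla + adapted_frame M Z D e
  for M :: "(complex^'n) set" and U nabla Z D e +
  assumes ZU: "Z \<subseteq> U"
begin

lemma ZM: "p \<in> Z \<Longrightarrow> p \<in> M"
  by (rule openin_zariski_subset[OF open_Z])

lemma frame_tangent: "q \<in> Z \<Longrightarrow> e a q \<in> tangent_space M q"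
  by (rule regular_vf_tangent[OF frame_regular])

lemma vdiff_at_frame: "q \<in> Z \<Longrightarrow> vdiff_at M (e a) q"
  by (rule vdiff_at_regular[OF frame_regular open_Z])

section \<open>Expansions in the frame\<close>

text \<open>Kept abstract in the operator \<open>\<Phi>\<close> and its Leibniz term
  \<open>\<delta>\<close>, so that one induction over the index set serves the second slot of
  \<open>nabla\<close> and, with \<open>\<delta> = 0\<close>, the tensorial slots of
  \<open>nabla\<close>, \<open>torsion\<close> and \<open>nabla_torsion\<close>.\<close>

lemma frame_expansion:
  fixes \<Phi> :: "'n vfield \<Rightarrow> complex^'n"
  assumes W: "openin (subtopology zariski M) W" "W \<subseteq> Z" and p: "p \<in> W" and X: "regular_vf M W X"
    and add: "\<And>X Y. regular_vf M W X \<Longrightarrow> regular_vf M W Y \<Longrightarrow> \<Phi> (\<lambda>q. X q + Y q) = \<Phi> X + \<Phi> Y"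
    and scale: "\<And>f X. regular_on W f \<Longrightarrow> regular_vf M W X \<Longrightarrow> \<Phi> (\<lambda>q. f q *s X q) = \<delta> f *s X p + f p *s \<Phi> X"
    and zero: "\<delta> (\<lambda>q. 0) = 0"
    and cong: "\<And>X Y. regular_vf M W X \<Longrightarrow> (\<And>q. q \<in> W \<Longrightarrow> Y q = X q) \<Longrightarrow> \<Phi> Y = \<Phi> X"
  shows "\<Phi> X = (\<Sum>a\<in>UNIV. \<delta> (\<lambda>q. X q $ a) *s e a p + X p $ a *s \<Phi> (e a))"
proof -
  note eW = regular_vf_subset[OF frame_regular W(2)]
  have t: "regular_vf M W (\<lambda>q. X q $ a *s e a q)" for a
    by (rule regular_vf_scale[OF regular_vf_regular[OF X] eW])
  have sum: "\<Phi> (\<lambda>q. \<Sum>a\<in>A. X q $ a *s e a q) = (\<Sum>a\<in>A. \<Phi> (\<lambda>q. X q $ a *s e a q))" if "finite A" for A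
    using that
  proof (induction A rule: finite_induct)
    case empty
    have "\<Phi> (\<lambda>q. 0 *s 0) = \<delta> (\<lambda>q. 0) *s 0 + 0 *s \<Phi> (\<lambda>q. 0)"
      by (rule scale[OF regular_on_const regular_vf_zero])
    then show ?case by simp
  next
    case (insert a A)
    have "regular_vf M W (\<lambda>q. \<Sum>a\<in>A. X q $ a *s e a q)" by (rule regular_vf_sum[OF insert.hyps(1) t])
    from add[OF t this] insert show ?case by simp
  qed
  have "\<Phi> X = \<Phi> (\<lambda>q. \<Sum>a\<in>UNIV. X q $ a *s e a q)"
    by (rule cong[OF regular_vf_sum[OF finite t]]) (use W(2) frame_span[OF _ regular_vf_tangent[OF X]] in blast)
  also have "\<dots> = (\<Sum>a\<in>UNIV. \<Phi> (\<lambda>q. X q $ a *s e a q))" by (rule sum) simp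
  also have "\<dots> = (\<Sum>a\<in>UNIV. \<delta> (\<lambda>q. X q $ a) *s e a p + X p $ a *s \<Phi> (e a))"
    by (intro sum.cong refl scale[OF regular_vf_regular[OF X] eW])
  finally show ?thesis .
qed

lemma frame_expansion_tensorial:
  fixes \<Phi> :: "'n vfield \<Rightarrow> complex^'n"
  assumes W: "openin (subtopology zariski M) W" "W \<subseteq> Z" and p: "p \<in> W" and X: "regular_vf M W X"
    and add: "\<And>X Y. regular_vf M W X \<Longrightarrow> regular_vf M W Y \<Longrightarrow> \<Phi> (\<lambda>q. X q + Y q) = \<Phi> X + \<Phi> Y"
    and scale: "\<And>f X. regular_on W f \<Longrightarrow> regular_vf M W X \<Longrightarrow> \<Phi> (\<lambda>q. f q *s X q) = f p *s \<Phi> X"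
    and cong: "\<And>X Y. regular_vf M W X \<Longrightarrow> (\<And>q. q \<in> W \<Longrightarrow> Y q = X q) \<Longrightarrow> \<Phi> Y = \<Phi> X"
  shows "\<Phi> X = (\<Sum>a\<in>UNIV. X p $ a *s \<Phi> (e a))"
proof -
  have "\<Phi> X = (\<Sum>a\<in>UNIV. 0 *s e a p + X p $ a *s \<Phi> (e a))"
  proof (rule frame_expansion[OF W p X add, where \<delta> = "\<lambda>f. 0"])
    show "\<Phi> (\<lambda>q. f q *s X q) = 0 *s X p + f p *s \<Phi> X" if "regular_on W f" "regular_vf M W X" for f X
      using scale[OF that] by simp
  qed (assumption | rule refl | rule cong)+
  then show ?thesis by simp
qed

context
  fixes W p
  assumes W: "openin (subtopology zariski M) W" "W \<subseteq> Z" and p: "p \<in> W"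
begin

lemma WU: "W \<subseteq> U" using W(2) ZU by blast

lemma frame_regular_on: "regular_vf M W (e a)"
  by (rule regular_vf_subset[OF frame_regular W(2)])

lemma nabla_expand_right:
  assumes A: "regular_vf M W A" and X: "regular_vf M W X"
  shows "nabla A X p = (\<Sum>a\<in>UNIV. deriv_along M (\<lambda>q. X q $ a) p (A p) *s e a p + X p $ a *s nabla A (e a) p)"
  by (rule frame_expansion[OF W p X, where \<Phi> = "\<lambda>X. nabla A X p" and \<delta> = "\<lambda>f. deriv_along M f p (A p)"])
    (rule nabla_add_right[OF W(1) WU A _ _ p] nabla_scale_right[OF W(1) WU A _ _ p] nabla_cong[OF W(1) WU A _ p refl]
      deriv_along_const[OF openin_zariski_subset[OF W(1) p] regular_vf_tangent[OF A p]]; assumption)+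

lemma nabla_expand_left:
  assumes A: "regular_vf M W A" and X: "regular_vf M W X"
  shows "nabla A X p = (\<Sum>a\<in>UNIV. A p $ a *s nabla (e a) X p)"
  by (rule frame_expansion_tensorial[OF W p A, where \<Phi> = "\<lambda>A. nabla A X p"])
    (rule nabla_add_left[OF W(1) WU _ X _ p] nabla_scale_left[OF W(1) WU _ X _ p] nabla_cong[OF W(1) WU _ X p _ refl]; assumption)+

lemma torsion_expand_right:
  assumes A: "regular_vf M W A" and X: "regular_vf M W X"
  shows "torsion M nabla A X p = (\<Sum>a\<in>UNIV. X p $ a *s torsion M nabla A (e a) p)"
  by (rule frame_expansion_tensorial[OF W p X, where \<Phi> = "\<lambda>X. torsion M nabla A X p"])
    (rule torsion_add_right[OF W(1) WU A _ _ p] torsion_scale_right[OF W(1) WU A _ _ p] torsion_cong[OF W(1) WU A _ p refl]; assumption)+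

lemma torsion_expand_left:
  assumes A: "regular_vf M W A" and X: "regular_vf M W X"
  shows "torsion M nabla X A p = (\<Sum>a\<in>UNIV. X p $ a *s torsion M nabla (e a) A p)"
proof -
  have "torsion M nabla X A p = - torsion M nabla A X p" by (rule torsion_swap[OF W(1) WU])
  also have "\<dots> = - (\<Sum>a\<in>UNIV. X p $ a *s torsion M nabla A (e a) p)"
    using torsion_expand_right[OF A X] by simp
  also have "\<dots> = (\<Sum>a\<in>UNIV. X p $ a *s torsion M nabla (e a) A p)"
    by (simp add: torsion_swap[OF W(1) WU, of A] sum_negf[symmetric] vec_eq_iff)
  finally show ?thesis .
qed

lemma nabla_torsion_expand_right:
  assumes A: "regular_vf M W A" and B: "regular_vf M W B" and X: "regular_vf M W X"
  shows "nabla_torsion M nabla A B X p = (\<Sum>a\<in>UNIV. X p $ a *s nabla_torsion M nabla A B (e a) p)"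
proof -
  have cong: "nabla_torsion M nabla A B Y p = nabla_torsion M nabla A B X p"
    if X: "regular_vf M W X" and eq: "\<And>q. q \<in> W \<Longrightarrow> Y q = X q" for X Y
  proof -
    note tc = torsion_cong[OF W(1) WU] and nc = nabla_cong[OF W(1) WU] and n = nabla_regular[OF W(1) WU]
    have "nabla A (torsion M nabla B Y) p = nabla A (torsion M nabla B X) p"
      by (rule nc[OF A torsion_regular[OF W(1) WU B X] p refl]) (rule tc[OF B X _ refl eq])
    moreover have "torsion M nabla (nabla A B) Y p = torsion M nabla (nabla A B) X p"
      by (rule tc[OF n[OF A B] X p refl eq])
    moreover have "torsion M nabla B (nabla A Y) p = torsion M nabla B (nabla A X) p"
      by (rule tc[OF B n[OF A X] p refl]) (rule nc[OF A X _ refl eq])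
    ultimately show ?thesis by (simp add: nabla_torsion_def)
  qed
  show ?thesis
    by (rule frame_expansion_tensorial[OF W p X, where \<Phi> = "\<lambda>X. nabla_torsion M nabla A B X p"])
      (rule nabla_torsion_add_right[OF W(1) WU A B _ _ p] nabla_torsion_scale_right[OF W(1) WU A B _ _ p] cong; assumption)+
qed

lemma nabla_torsion_expand:
  assumes A: "regular_vf M W A" and X: "regular_vf M W X" and Y: "regular_vf M W Y"
  shows "nabla_torsion M nabla A X Y p =
    (\<Sum>a\<in>UNIV. \<Sum>b\<in>UNIV. (X p $ a * Y p $ b) *s nabla_torsion M nabla A (e a) (e b) p)"
proof -
  have "nabla_torsion M nabla A X (e b) p = (\<Sum>a\<in>UNIV. X p $ a *s nabla_torsion M nabla A (e a) (e b) p)" for b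
    using nabla_torsion_swap[OF W(1) WU A X frame_regular_on p, of b]
      nabla_torsion_expand_right[OF A frame_regular_on X, of b]
      nabla_torsion_swap[OF W(1) WU A frame_regular_on frame_regular_on p, of b]
    by (simp add: sum_negf[symmetric] vec_eq_iff)
  then have "nabla_torsion M nabla A X Y p =
      (\<Sum>b\<in>UNIV. \<Sum>a\<in>UNIV. (X p $ a * Y p $ b) *s nabla_torsion M nabla A (e a) (e b) p)"
    using nabla_torsion_expand_right[OF A X Y] by (simp add: vec_eq_iff sum_distrib_left mult_ac)
  also have "\<dots> = (\<Sum>a\<in>UNIV. \<Sum>b\<in>UNIV. (X p $ a * Y p $ b) *s nabla_torsion M nabla A (e a) (e b) p)"
    by (rule sum.swap)
  finally show ?thesis .
qed

end

section \<open>Covariant derivatives of analytic fields\<close>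

text \<open>The coordinate formula for the derivative of \<open>Y\<close> in direction
  \<open>v\<close>. Since \<open>nabla\<close> is applied to frame fields only, it is meaningful for
  analytic \<open>Y\<close>.\<close>

definition frame_covd :: "'n vfield \<Rightarrow> complex^'n \<Rightarrow> complex^'n \<Rightarrow> complex^'n" where
  "frame_covd Y p v = (\<Sum>b\<in>UNIV. deriv_along M (\<lambda>q. Y q $ b) p v *s e b p
     + Y p $ b *s (\<Sum>a\<in>UNIV. v $ a *s nabla (e a) (e b) p))"

text \<open>Independence of choices: every way of writing \<open>Y\<close> with regular fields gives
  the value of the frame formula. The coefficients need only be differentiable at \<open>p\<close>,
  and the index set is any finite set, because later uses range over frame indices and over pairs of
  them.\<close>

lemma frame_covd_representation:
  assumes Z': "openin (subtopology zariski M) Z'" "Z' \<subseteq> U"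
    and V: "openin (top_of_set M) V" "V \<subseteq> Z'" "p \<in> V" "p \<in> Z"
    and A: "regular_vf M Z' A" and I: "finite I"
    and E: "\<And>i. i \<in> I \<Longrightarrow> regular_vf M Z' (E i)" and f: "\<And>i. i \<in> I \<Longrightarrow> cdiff_at M (f i) p"
    and Y: "\<And>q. q \<in> V \<Longrightarrow> Y q = (\<Sum>i\<in>I. f i q *s E i q)"
  shows "frame_covd Y p (A p) = (\<Sum>i\<in>I. deriv_along M (f i) p (A p) *s E i p + f i p *s nabla A (E i) p)"
proof -
  \<comment> \<open>The fields \<open>E i\<close> are regular on \<open>Z'\<close> and the frame on
    \<open>Z\<close>, so the former are expanded on the intersection.\<close>
  define W where "W = Z \<inter> Z'"
  have W: "openin (subtopology zariski M) W" "W \<subseteq> Z" and p: "p \<in> W"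
    using openin_Int[OF open_Z Z'(1)] V by (auto simp: W_def)
  have pM: "p \<in> M" using ZM[OF V(4)] .
  have sub: "W \<subseteq> Z'" by (simp add: W_def)
  note AW = regular_vf_subset[OF A sub] and EW = regular_vf_subset[OF E sub]
  have Ap: "A p \<in> tangent_space M p" by (rule regular_vf_tangent[OF AW p])
  define N where "N b = (\<Sum>a\<in>UNIV. A p $ a *s nabla (e a) (e b) p)" for b
  have N: "nabla A (e b) p = N b" for b
    unfolding N_def by (rule nabla_expand_left[OF W p AW frame_regular_on[OF W p]])
  define d where "d g = deriv_along M g p (A p)" for g :: "complex^'n \<Rightarrow> complex"
  have nE: "nabla A (E i) p = (\<Sum>b\<in>UNIV. d (\<lambda>q. E i q $ b) *s e b p + E i p $ b *s N b)" if "i \<in> I" for i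
    using nabla_expand_right[OF W p AW EW[OF that]] by (simp add: N d_def)
  have Ed: "cdiff_at M (\<lambda>q. E i q $ b) p" if "i \<in> I" for i b
    by (rule cdiff_at_regular[OF regular_vf_regular[OF EW[OF that]] W(1) p])
  have dY: "d (\<lambda>q. Y q $ b) = (\<Sum>i\<in>I. d (f i) * E i p $ b + f i p * d (\<lambda>q. E i q $ b))" for b
  proof -
    have c: "cdiff_at M (\<lambda>q. f i q * E i q $ b) p" if "i \<in> I" for i
      by (rule cdiff_at_mult[OF f Ed]) (use that in auto)
    have "d (\<lambda>q. Y q $ b) = d (\<lambda>q. \<Sum>i\<in>I. f i q * E i q $ b)"
      unfolding d_def by (rule deriv_along_cong[OF cdiff_at_sum[OF I c] V(1,3) _ Ap]) (auto simp: Y)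
    also have "\<dots> = (\<Sum>i\<in>I. d (\<lambda>q. f i q * E i q $ b))"
      unfolding d_def by (rule deriv_along_sum[OF pM Ap I c])
    also have "\<dots> = (\<Sum>i\<in>I. d (f i) * E i p $ b + f i p * d (\<lambda>q. E i q $ b))"
      unfolding d_def by (intro sum.cong refl deriv_along_mult[OF pM Ap] f Ed)
    finally show ?thesis .
  qed
  have eE: "E i p = (\<Sum>b\<in>UNIV. E i p $ b *s e b p)" if "i \<in> I" for i
    by (rule frame_span[OF V(4) regular_vf_tangent[OF EW[OF that] p]])
  have Yp: "Y p $ b = (\<Sum>i\<in>I. f i p * E i p $ b)" for b using Y[OF V(3)] by simp
  have "frame_covd Y p (A p) = (\<Sum>b\<in>UNIV. d (\<lambda>q. Y q $ b) *s e b p + Y p $ b *s N b)"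
    by (simp add: frame_covd_def d_def N_def)
  also have "\<dots> = (\<Sum>b\<in>UNIV. \<Sum>i\<in>I. d (f i) *s (E i p $ b *s e b p) + f i p *s (d (\<lambda>q. E i q $ b) *s e b p + E i p $ b *s N b))"
    unfolding dY Yp
    by (intro sum.cong refl) (simp add: vec_eq_iff sum_distrib_left sum_distrib_right sum.distrib algebra_simps)
  also have "\<dots> = (\<Sum>i\<in>I. \<Sum>b\<in>UNIV. d (f i) *s (E i p $ b *s e b p) + f i p *s (d (\<lambda>q. E i q $ b) *s e b p + E i p $ b *s N b))"
    by (rule sum.swap)
  also have "\<dots> = (\<Sum>i\<in>I. d (f i) *s E i p + f i p *s nabla A (E i) p)"
  proof (intro sum.cong refl)
    fix i assume i: "i \<in> I"
    have "d (f i) *s E i p = (\<Sum>b\<in>UNIV. d (f i) *s (E i p $ b *s e b p))"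
      by (subst eE[OF i]) (simp add: vec.scale_sum_right)
    moreover have "f i p *s nabla A (E i) p = (\<Sum>b\<in>UNIV. f i p *s (d (\<lambda>q. E i q $ b) *s e b p + E i p $ b *s N b))"
      unfolding nE[OF i] by (simp add: vec.scale_sum_right)
    ultimately show "(\<Sum>b\<in>UNIV. d (f i) *s (E i p $ b *s e b p) + f i p *s (d (\<lambda>q. E i q $ b) *s e b p + E i p $ b *s N b))
        = d (f i) *s E i p + f i p *s nabla A (E i) p"
      by (simp add: sum.distrib)
  qed
  finally show ?thesis by (simp add: d_def)
qed

lemma has_covariant_derivative_frame_covd:
  assumes "has_covariant_derivative M U nabla Y p v w" "p \<in> Z"
  shows "w = frame_covd Y p v"
proof -
  obtain Z' V A and k :: nat and E f where r: "openin (subtopology zariski M) Z'" "Z' \<subseteq> U"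
      "openin (top_of_set M) V" "V \<subseteq> Z'" "p \<in> V" "regular_vf M Z' A" "A p = v"
      "\<forall>i<k. regular_vf M Z' (E i) \<and> analytic_fun_on V (f i)" "\<forall>q\<in>V. Y q = (\<Sum>i<k. f i q *s E i q)"
      "w = (\<Sum>i<k. deriv_along M (f i) p v *s E i p + f i p *s nabla A (E i) p)"
    using assms(1) unfolding has_covariant_derivative_def by (elim exE conjE) (rule that; assumption)
  have "cdiff_at M (f i) p" if "i < k" for i
    by (rule cdiff_at_analytic[OF _ r(3,5)]) (use r(8) that in simp)
  then show ?thesis
    using frame_covd_representation[OF r(1-5) assms(2) r(6), of "{..<k}" E f Y] r(7-10) by simp
qed

lemma frame_covd_has_covariant_derivative:
  assumes V: "openin (top_of_set M) V" "p \<in> V" "p \<in> Z" and Y: "analytic_vf M V Y" and v: "v \<in> tangent_space M p"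
  shows "has_covariant_derivative M U nabla Y p v (frame_covd Y p v)"
proof -
  \<comment> \<open>\<open>has_covariant_derivative\<close> numbers its fields by naturals, so the
    coordinate type has to be enumerated.\<close>
  obtain h :: "nat \<Rightarrow> 'n" where h: "bij_betw h {..<CARD('n)} UNIV"
    using ex_bij_betw_nat_finite[of "UNIV :: 'n set"] by (auto simp: lessThan_atLeast0)
  \<comment> \<open>Extends \<open>v\<close> to a regular field with constant coefficients in the
    frame.\<close>
  define A where "A q = (\<Sum>a\<in>UNIV. v $ a *s e a q)" for q
  have A: "regular_vf M Z A"
    unfolding A_def[abs_def] by (rule regular_vf_sum[OF finite regular_vf_scale[OF regular_on_const frame_regular]])
  have Av: "A p = v" unfolding A_def by (rule frame_span[OF V(3) v, symmetric])
  define V' where "V' = V \<inter> Z"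
  have V': "openin (top_of_set M) V'" "V' \<subseteq> Z" "p \<in> V'"
    using openin_Int[OF V(1) zariski_openin_imp_openin[OF open_Z]] V by (auto simp: V'_def)
  have an: "analytic_fun_on V' (\<lambda>q. Y q $ b)" for b
    using Y analytic_fun_on_subset[of V "\<lambda>q. Y q $ b" V'] by (simp add: analytic_vf_def V'_def)
  have Yq: "Y q = (\<Sum>i<CARD('n). Y q $ h i *s e (h i) q)" if "q \<in> V'" for q
  proof -
    have "Y q = (\<Sum>b\<in>UNIV. Y q $ b *s e b q)"
      by (rule frame_span) (use that Y in \<open>auto simp: V'_def analytic_vf_def\<close>)
    also have "\<dots> = (\<Sum>i<CARD('n). Y q $ h i *s e (h i) q)"
      by (rule sum.reindex_bij_betw[OF h, symmetric])
    finally show ?thesis .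
  qed
  have "frame_covd Y p (A p) = (\<Sum>i<CARD('n). deriv_along M (\<lambda>q. Y q $ h i) p (A p) *s e (h i) p + Y p $ h i *s nabla A (e (h i)) p)"
    by (rule frame_covd_representation[OF open_Z ZU V' V(3) A])
      (use frame_regular Yq cdiff_at_analytic[OF an V'(1,3)] in auto)
  then show ?thesis
    unfolding has_covariant_derivative_def
    using open_Z ZU V' A Av frame_regular an Yq
    by (intro exI[of _ Z] exI[of _ V'] exI[of _ A] exI[of _ "CARD('n)"] exI[of _ "\<lambda>i. e (h i)"]
        exI[of _ "\<lambda>i q. Y q $ h i"]) simp
qed

lemma horizontal_analytic: "horizontal M U nabla V Y \<Longrightarrow> analytic_vf M V Y"
  by (simp add: horizontal_def)

lemma horizontal_frame_covd:
  "horizontal M U nabla V Y \<Longrightarrow> p \<in> V \<Longrightarrow> p \<in> Z \<Longrightarrow> v \<in> tangent_space M p \<Longrightarrow> frame_covd Y p v = 0"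
  using has_covariant_derivative_frame_covd[of Y p v 0] by (simp add: horizontal_def)

section \<open>Brackets of horizontal fields\<close>

context
  fixes V X Y
  assumes V: "openin (top_of_set M) V"
    and X: "horizontal M U nabla V X" and Y: "horizontal M U nabla V Y"
begin

lemma horizontal_vdiff_at: "horizontal M U nabla V H \<Longrightarrow> q \<in> V \<Longrightarrow> vdiff_at M H q"
  using cdiff_at_analytic[OF _ V] by (simp add: vdiff_at_def horizontal_def analytic_vf_def)

lemma horizontal_expand:
  assumes "horizontal M U nabla V H" "q \<in> V" "q \<in> Z"
  shows "H q = (\<Sum>a\<in>UNIV. H q $ a *s e a q)"
  by (rule frame_span[OF assms(3) vdiff_at_tangent[OF horizontal_vdiff_at[OF assms(1,2)]]])

text \<open>This is \<open>-Tor(X,Y)\<close>, written in components because the rules for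
  \<open>torsion\<close> cover regular fields only. Both slots of the bracket are expanded over the
  frame, and horizontality replaces the derivatives of the components by connection
  coefficients.\<close>

lemma lie_bracket_horizontal:
  assumes q: "q \<in> V" "q \<in> Z"
  shows "lie_bracket M X Y q = (\<Sum>(a,b)\<in>UNIV. - (X q $ a * Y q $ b) *s torsion M nabla (e a) (e b) q)"
proof -
  note qM = ZM[OF q(2)]
  define V' where "V' = V \<inter> Z"
  have V': "openin (top_of_set M) V'" "q \<in> V'"
    using openin_Int[OF V zariski_openin_imp_openin[OF open_Z]] q by (auto simp: V'_def)
  have ex: "lie_bracket M B H q = (\<Sum>b\<in>UNIV. deriv_along M (\<lambda>x. H x $ b) q (B q) *s e b q + H q $ b *s lie_bracket M B (e b) q)"
    if B: "vdiff_at M B q" and H: "horizontal M U nabla V H" for B H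
  proof -
    note vH = vdiff_at_nth[OF horizontal_vdiff_at[OF H q(1)]]
    have t: "vdiff_at M (\<lambda>x. H x $ b *s e b x) q" for b
      by (rule vdiff_at_scale[OF vH vdiff_at_frame[OF q(2)]])
    have "lie_bracket M B H q = lie_bracket M B (\<lambda>x. \<Sum>b\<in>UNIV. H x $ b *s e b x) q"
      by (rule lie_bracket_cong[OF V' B vdiff_at_sum[OF finite t] refl]) (use horizontal_expand[OF H] in \<open>simp add: V'_def\<close>)
    also have "\<dots> = (\<Sum>b\<in>UNIV. lie_bracket M B (\<lambda>x. H x $ b *s e b x) q)"
      by (rule lie_bracket_sum_right[OF qM B finite t])
    finally show ?thesis
      by (simp add: lie_bracket_scale_right[OF qM B vdiff_at_frame[OF q(2)] vH])
  qed
  note vX = horizontal_vdiff_at[OF X q(1)] and vY = horizontal_vdiff_at[OF Y q(1)]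
  define N where "N a b = nabla (e a) (e b) q" for a b
  have covd: "(\<Sum>b\<in>UNIV. deriv_along M (\<lambda>x. H x $ b) q v *s e b q) = - (\<Sum>a\<in>UNIV. \<Sum>b\<in>UNIV. (v $ a * H q $ b) *s N a b)"
    if H: "horizontal M U nabla V H" and v: "v \<in> tangent_space M q" for H v
  proof -
    have "(\<Sum>b\<in>UNIV. deriv_along M (\<lambda>x. H x $ b) q v *s e b q) + (\<Sum>b\<in>UNIV. H q $ b *s (\<Sum>a\<in>UNIV. v $ a *s N a b)) = 0"
      using horizontal_frame_covd[OF H q v] by (simp add: frame_covd_def sum.distrib N_def)
    moreover have "(\<Sum>b\<in>UNIV. H q $ b *s (\<Sum>a\<in>UNIV. v $ a *s N a b)) = (\<Sum>a\<in>UNIV. \<Sum>b\<in>UNIV. (v $ a * H q $ b) *s N a b)"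
      by (subst sum.swap) (simp add: vec_eq_iff sum_distrib_left mult_ac)
    ultimately show ?thesis by (simp add: eq_neg_iff_add_eq_0)
  qed
  \<comment> \<open>The remaining slot: antisymmetry brings the frame field to the front, where
    \<open>ex\<close> expands \<open>X\<close>. Linearity in the direction then reassembles the
    derivatives along \<open>e b\<close> into one along \<open>Y q\<close>.\<close>
  have "(\<Sum>b\<in>UNIV. Y q $ b *s lie_bracket M X (e b) q) =
      - (\<Sum>a\<in>UNIV. deriv_along M (\<lambda>x. X x $ a) q (Y q) *s e a q) - (\<Sum>b\<in>UNIV. \<Sum>a\<in>UNIV. (Y q $ b * X q $ a) *s lie_bracket M (e b) (e a) q)"
  proof -
    have 1: "lie_bracket M X (e b) q = - (\<Sum>a\<in>UNIV. deriv_along M (\<lambda>x. X x $ a) q (e b q) *s e a q + X q $ a *s lie_bracket M (e b) (e a) q)" for b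
      using ex[OF vdiff_at_frame[OF q(2)] X, of b] lie_bracket_swap[of M X "e b" q] by simp
    have 2: "deriv_along M (\<lambda>x. X x $ a) q (Y q) = (\<Sum>b\<in>UNIV. Y q $ b * deriv_along M (\<lambda>x. X x $ a) q (e b q))" for a
      by (subst horizontal_expand[OF Y q], subst deriv_along_sum_vector[OF qM vdiff_at_nth[OF vX] finite])
        (auto intro: tangent_space_scale frame_tangent q simp: deriv_along_scale[OF qM frame_tangent[OF q(2)] vdiff_at_nth[OF vX]])
    have "(\<Sum>a\<in>UNIV. deriv_along M (\<lambda>x. X x $ a) q (Y q) *s e a q) =
       (\<Sum>b\<in>UNIV. \<Sum>a\<in>UNIV. (Y q $ b * deriv_along M (\<lambda>x. X x $ a) q (e b q)) *s e a q)"
      unfolding 2 by (subst sum.swap) (simp add: vec_eq_iff sum_distrib_right)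
    then show ?thesis
      unfolding 1 by (simp add: vec_eq_iff sum_distrib_left sum.distrib sum_negf sum_subtractf algebra_simps)
  qed
  then have "lie_bracket M X Y q = (\<Sum>b\<in>UNIV. deriv_along M (\<lambda>x. Y x $ b) q (X q) *s e b q)
      - (\<Sum>a\<in>UNIV. deriv_along M (\<lambda>x. X x $ a) q (Y q) *s e a q) - (\<Sum>b\<in>UNIV. \<Sum>a\<in>UNIV. (Y q $ b * X q $ a) *s lie_bracket M (e b) (e a) q)"
    using ex[OF vX Y] by (simp add: sum.distrib)
  also have "\<dots> = (\<Sum>a\<in>UNIV. \<Sum>b\<in>UNIV. - (X q $ a * Y q $ b) *s N a b) + (\<Sum>b\<in>UNIV. \<Sum>a\<in>UNIV. (Y q $ b * X q $ a) *s N b a)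
      - (\<Sum>b\<in>UNIV. \<Sum>a\<in>UNIV. (Y q $ b * X q $ a) *s lie_bracket M (e b) (e a) q)"
    unfolding covd[OF Y vdiff_at_tangent[OF vX]] covd[OF X vdiff_at_tangent[OF vY]]
    by (simp add: sum_negf vec_eq_iff)
  also have "\<dots> = (\<Sum>a\<in>UNIV. \<Sum>b\<in>UNIV. - (X q $ a * Y q $ b) *s torsion M nabla (e a) (e b) q)"
  proof -
    have sw: "(\<Sum>b\<in>UNIV. \<Sum>a\<in>UNIV. (Y q $ b * X q $ a) *s K b a) = (\<Sum>a\<in>UNIV. \<Sum>b\<in>UNIV. (Y q $ b * X q $ a) *s K b a)"
      for K :: "'n \<Rightarrow> 'n \<Rightarrow> complex^'n" by (rule sum.swap)
    have "- (X q $ a * Y q $ b) *s torsion M nabla (e a) (e b) q = - (X q $ a * Y q $ b) *s N a b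
        + (Y q $ b * X q $ a) *s N b a - (Y q $ b * X q $ a) *s lie_bracket M (e b) (e a) q" for a b
      using lie_bracket_swap[of M "e a" "e b" q]
      by (simp add: torsion_def N_def vec_eq_iff algebra_simps)
    then show ?thesis unfolding sw by (simp add: sum.distrib sum_subtractf sum_negf)
  qed
  finally show ?thesis by (simp add: sum.cartesian_product)
qed

text \<open>The Leibniz rule for \<open>-Tor(X,Y)\<close>: since \<open>X\<close> and
  \<open>Y\<close> have zero covariant derivative, only the derivative of the tensor remains. In
  components, this amounts to cancelling the derivatives of the coefficients against the terms
  \<open>nabla A (e a)\<close>.\<close>

lemma frame_covd_lie_bracket:
  assumes pV: "p \<in> V" and W: "openin (subtopology zariski M) W" "W \<subseteq> Z" and p: "p \<in> W" and A: "regular_vf M W A"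
  shows "frame_covd (lie_bracket M X Y) p (A p) =
    (\<Sum>a\<in>UNIV. \<Sum>b\<in>UNIV. - (X p $ a * Y p $ b) *s nabla_torsion M nabla A (e a) (e b) p)"
proof -
  have pZ: "p \<in> Z" using W p by blast
  note pM = ZM[OF pZ] and WU' = WU[OF W p] and eW = frame_regular_on[OF W p]
  have Ap: "A p \<in> tangent_space M p" by (rule regular_vf_tangent[OF A p])
  define V' where "V' = V \<inter> W"
  have V': "openin (top_of_set M) V'" "V' \<subseteq> W" "p \<in> V'"
    using openin_Int[OF V zariski_openin_imp_openin[OF W(1)]] pV p by (auto simp: V'_def)
  note vX = vdiff_at_nth[OF horizontal_vdiff_at[OF X pV]] and vY = vdiff_at_nth[OF horizontal_vdiff_at[OF Y pV]]
  define dX where "dX a = deriv_along M (\<lambda>x. X x $ a) p (A p)" for a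
  define dY where "dY a = deriv_along M (\<lambda>x. Y x $ a) p (A p)" for a
  define T where "T a b = torsion M nabla (e a) (e b) p" for a b
  define NT where "NT a b = nabla_torsion M nabla A (e a) (e b) p" for a b
  define nA where "nA a = nabla A (e a) p" for a
  have "frame_covd (lie_bracket M X Y) p (A p) = (\<Sum>i\<in>UNIV.
      deriv_along M (\<lambda>x. - (X x $ fst i * Y x $ snd i)) p (A p) *s torsion M nabla (e (fst i)) (e (snd i)) p +
      - (X p $ fst i * Y p $ snd i) *s nabla A (torsion M nabla (e (fst i)) (e (snd i))) p)"
  proof (rule frame_covd_representation[OF W(1) WU' V' pZ A finite])
    show "regular_vf M W (torsion M nabla (e (fst i)) (e (snd i)))" for i :: "'n \<times> 'n"
      by (rule torsion_regular[OF W(1) WU' eW eW])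
    show "cdiff_at M (\<lambda>x. - (X x $ fst i * Y x $ snd i)) p" for i :: "'n \<times> 'n"
      by (rule cdiff_at_uminus[OF cdiff_at_mult[OF vX vY]])
    show "lie_bracket M X Y q = (\<Sum>i\<in>UNIV. - (X q $ fst i * Y q $ snd i) *s torsion M nabla (e (fst i)) (e (snd i)) q)"
      if "q \<in> V'" for q
      using lie_bracket_horizontal[of q] that W(2) by (auto simp: V'_def case_prod_unfold)
  qed
  also have "\<dots> = (\<Sum>a\<in>UNIV. \<Sum>b\<in>UNIV. - (dX a * Y p $ b + X p $ a * dY b) *s T a b
      + - (X p $ a * Y p $ b) *s (NT a b + torsion M nabla (nabla A (e a)) (e b) p + torsion M nabla (e a) (nabla A (e b)) p))"
    unfolding sum.cartesian_product UNIV_Times_UNIV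
    by (intro sum.cong refl) (simp add: case_prod_unfold deriv_along_uminus[OF pM Ap cdiff_at_mult[OF vX vY]]
      deriv_along_mult[OF pM Ap vX vY] dX_def dY_def T_def NT_def nabla_torsion_def)
  also have "\<dots> = (\<Sum>a\<in>UNIV. \<Sum>b\<in>UNIV. - (X p $ a * Y p $ b) *s NT a b)"
  proof -
    note nr = nabla_regular[OF W(1) WU' A eW]
    have T1: "torsion M nabla (nabla A (e a)) (e b) p = (\<Sum>c\<in>UNIV. nA a $ c *s T c b)" for a b
      unfolding nA_def T_def by (rule torsion_expand_left[OF W p eW nr])
    have T2: "torsion M nabla (e a) (nabla A (e b)) p = (\<Sum>c\<in>UNIV. nA b $ c *s T a c)" for a b
      unfolding nA_def T_def by (rule torsion_expand_right[OF W p eW nr])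
    \<comment> \<open>A frame field also has ambient components off \<open>D\<close>. Expanding the
      torsion of the frame fields themselves brings the sum to the shape of \<open>covd\<close>,
      which is an identity between ambient components.\<close>
    have T3: "T a b = (\<Sum>c\<in>UNIV. e a p $ c *s T c b)" for a b
      unfolding T_def by (rule torsion_expand_left[OF W p eW eW])
    have T4: "T a b = (\<Sum>c\<in>UNIV. e b p $ c *s T a c)" for a b
      unfolding T_def by (rule torsion_expand_right[OF W p eW eW])
    have covd: "(\<Sum>a\<in>UNIV. deriv_along M (\<lambda>x. H x $ a) p (A p) * e a p $ c + H p $ a * nA a $ c) = 0"
      if H: "horizontal M U nabla V H" for H c
    proof -
      have "(\<Sum>a\<in>UNIV. deriv_along M (\<lambda>x. H x $ a) p (A p) *s e a p + H p $ a *s nA a) = 0"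
        using horizontal_frame_covd[OF H pV pZ Ap] nabla_expand_left[OF W p A eW]
        by (simp add: frame_covd_def nA_def)
      then show ?thesis by (simp add: vec_eq_iff)
    qed
    have P1: "(\<Sum>a\<in>UNIV. dX a *s T a b + X p $ a *s (\<Sum>c\<in>UNIV. nA a $ c *s T c b)) = 0" for b
    proof -
      have "(\<Sum>a\<in>UNIV. dX a *s T a b + X p $ a *s (\<Sum>c\<in>UNIV. nA a $ c *s T c b)) =
          (\<Sum>a\<in>UNIV. \<Sum>c\<in>UNIV. (dX a * e a p $ c + X p $ a * nA a $ c) *s T c b)"
        by (intro sum.cong refl, subst T3) (simp add: vec.scale_sum_right sum.distrib[symmetric] vec.scale_left_distrib)
      also have "\<dots> = (\<Sum>c\<in>UNIV. (\<Sum>a\<in>UNIV. dX a * e a p $ c + X p $ a * nA a $ c) *s T c b)"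
        by (subst sum.swap) (simp only: vec.scale_sum_left)
      finally show ?thesis using covd[OF X] by (simp add: dX_def)
    qed
    have P2: "(\<Sum>b\<in>UNIV. dY b *s T a b + Y p $ b *s (\<Sum>c\<in>UNIV. nA b $ c *s T a c)) = 0" for a
    proof -
      have "(\<Sum>b\<in>UNIV. dY b *s T a b + Y p $ b *s (\<Sum>c\<in>UNIV. nA b $ c *s T a c)) =
          (\<Sum>b\<in>UNIV. \<Sum>c\<in>UNIV. (dY b * e b p $ c + Y p $ b * nA b $ c) *s T a c)"
        by (intro sum.cong refl, subst T4) (simp add: vec.scale_sum_right sum.distrib[symmetric] vec.scale_left_distrib)
      also have "\<dots> = (\<Sum>c\<in>UNIV. (\<Sum>b\<in>UNIV. dY b * e b p $ c + Y p $ b * nA b $ c) *s T a c)"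
        by (subst sum.swap) (simp only: vec.scale_sum_left)
      finally show ?thesis using covd[OF Y] by (simp add: dY_def)
    qed
    let ?p1 = "\<lambda>a b. Y p $ b *s (dX a *s T a b + X p $ a *s (\<Sum>c\<in>UNIV. nA a $ c *s T c b))"
    let ?p2 = "\<lambda>a b. X p $ a *s (dY b *s T a b + Y p $ b *s (\<Sum>c\<in>UNIV. nA b $ c *s T a c))"
    have s1: "(\<Sum>a\<in>UNIV. \<Sum>b\<in>UNIV. ?p1 a b) = 0"
      by (subst sum.swap) (simp only: vec.scale_sum_right[symmetric] P1 vec.scale_zero_right sum.neutral_const)
    have s2: "(\<Sum>a\<in>UNIV. \<Sum>b\<in>UNIV. ?p2 a b) = 0"
      by (simp only: vec.scale_sum_right[symmetric] P2 vec.scale_zero_right sum.neutral_const)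
    \<comment> \<open>The Leibniz terms are regrouped into one package for each horizontal field,
      and \<open>s1\<close> and \<open>s2\<close> show that each package sums to zero.\<close>
    have "- (dX a * Y p $ b + X p $ a * dY b) *s T a b
      + - (X p $ a * Y p $ b) *s (NT a b + torsion M nabla (nabla A (e a)) (e b) p + torsion M nabla (e a) (nabla A (e b)) p)
      = - (X p $ a * Y p $ b) *s NT a b - ?p1 a b - ?p2 a b" for a b
      unfolding T1 T2 by (simp add: vec_eq_iff algebra_simps)
    then show ?thesis by (simp only: sum_subtractf s1 s2) simp
  qed
  finally show ?thesis by (simp add: NT_def)
qed

text \<open>\<open>holo_on\<close> records just one complex derivative, so analyticity of
  derivatives of the components is not immediate. The torsion formula avoids the question: its
  coefficients are analytic and its fields regular.\<close>

lemma analytic_lie_bracket: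
  "analytic_fun_on (V \<inter> Z) (\<lambda>q. lie_bracket M X Y q $ i)"
proof (rule analytic_fun_on_cong)
  have an: "analytic_fun_on (V \<inter> Z) (\<lambda>q. H q $ a)" if "horizontal M U nabla V H" for H a
    using horizontal_analytic[OF that] analytic_fun_on_subset[of V "\<lambda>q. H q $ a" "V \<inter> Z"] by (simp add: analytic_vf_def)
  have T: "analytic_fun_on (V \<inter> Z) (\<lambda>q. torsion M nabla (e a) (e b) q $ i)" for a b
    by (rule analytic_fun_on_subset[OF analytic_fun_on_regular[OF regular_vf_regular[OF torsion_regular[OF open_Z ZU
      frame_regular frame_regular]]]]) simp
  show "analytic_fun_on (V \<inter> Z) (\<lambda>q. \<Sum>ab\<in>UNIV.
      ((-1) * (X q $ fst ab * Y q $ snd ab)) * torsion M nabla (e (fst ab)) (e (snd ab)) q $ i)"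
    by (intro analytic_fun_on_sum analytic_fun_on_mult an[OF X] an[OF Y] T
        analytic_fun_on_regular[OF regular_on_const]) simp
qed (simp add: lie_bracket_horizontal case_prod_unfold)

lemma tangent_lie_bracket:
  assumes "q \<in> V" "q \<in> Z"
  shows "lie_bracket M X Y q \<in> tangent_space M q"
  unfolding lie_bracket_horizontal[OF assms]
proof (intro tangent_space_sum)
  fix ab :: "'n \<times> 'n"
  show "(case ab of (a, b) \<Rightarrow> - (X q $ a * Y q $ b) *s torsion M nabla (e a) (e b) q) \<in> tangent_space M q"
    unfolding case_prod_unfold
    by (intro tangent_space_scale regular_vf_tangent[OF torsion_regular[OF open_Z ZU frame_regular frame_regular] assms(2)])
qed

end

end

context connection
begin

lemma framed_connection_exists:
  assumes "p \<in> U"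
  obtains Z D e where "framed_connection M U nabla Z D e" "p \<in> Z"
proof -
  have "p \<in> M" by (rule openin_zariski_subset[OF open_U assms])
  obtain Z D e where Z: "adapted_frame M Z D e" "Z \<subseteq> U" "p \<in> Z"
    by (rule adapted_frame_exists[OF smooth[OF \<open>p \<in> M\<close>] open_U assms])
  have "framed_connection M U nabla Z D e"
    unfolding framed_connection_def framed_connection_axioms_def using Z connection_axioms by blast
  then show ?thesis using Z(3) by (rule that)
qed

text \<open>Analyticity, tangency and the derivative condition are all local, so each is checked in
  a frame around the point in question.\<close>

lemma horizontal_lie_bracket:
  assumes ct: "constant_torsion M U nabla" and V: "openin (top_of_set M) V" "V \<subseteq> U"
    and X: "horizontal M U nabla V X" and Y: "horizontal M U nabla V Y"
  shows "horizontal M U nabla V (lie_bracket M X Y)"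
  unfolding horizontal_def
proof (intro conjI ballI)
  have VM: "V \<subseteq> M" using openin_subset[OF V(1)] by simp
  show an: "analytic_vf M V (lie_bracket M X Y)"
    unfolding analytic_vf_def
  proof (intro conjI allI ballI)
    fix i
    show "analytic_fun_on V (\<lambda>q. lie_bracket M X Y q $ i)"
    proof (rule analytic_fun_on_local[OF _ VM])
      fix p assume p: "p \<in> V"
      obtain Z D e where F: "framed_connection M U nabla Z D e" "p \<in> Z"
        using framed_connection_exists V(2) p by (metis subsetD)
      interpret framed_connection M U nabla Z D e by (rule F(1))
      show "\<exists>V'. openin (top_of_set M) V' \<and> p \<in> V' \<and> analytic_fun_on (V \<inter> V') (\<lambda>q. lie_bracket M X Y q $ i)"
        by (intro exI[of _ Z] conjI zariski_openin_imp_openin[OF open_Z] F(2) analytic_lie_bracket[OF V(1) X Y])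
    qed
  next
    fix p assume p: "p \<in> V"
    obtain Z D e where F: "framed_connection M U nabla Z D e" "p \<in> Z"
      using framed_connection_exists V(2) p by (metis subsetD)
    interpret framed_connection M U nabla Z D e by (rule F(1))
    show "lie_bracket M X Y p \<in> tangent_space M p" by (rule tangent_lie_bracket[OF V(1) X Y p F(2)])
  qed
  fix p v assume p: "p \<in> V" and v: "v \<in> tangent_space M p"
  obtain Z D e where F: "framed_connection M U nabla Z D e" "p \<in> Z"
    using framed_connection_exists V(2) p by (metis subsetD)
  interpret framed_connection M U nabla Z D e by (rule F(1))
  define A where "A q = (\<Sum>a\<in>UNIV. v $ a *s e a q)" for q
  have A: "regular_vf M Z A"
    unfolding A_def[abs_def] by (rule regular_vf_sum[OF finite regular_vf_scale[OF regular_on_const frame_regular]])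
  have Av: "A p = v" unfolding A_def by (rule frame_span[OF F(2) v, symmetric])
  have "nabla_torsion M nabla A (e a) (e b) p = 0" for a b
    using ct open_Z ZU A frame_regular F(2) unfolding constant_torsion_def by blast
  then have "frame_covd (lie_bracket M X Y) p v = 0"
    using frame_covd_lie_bracket[OF V(1) X Y p open_Z order_refl F(2) A] Av by simp
  then show "has_covariant_derivative M U nabla (lie_bracket M X Y) p v 0"
    using frame_covd_has_covariant_derivative[OF V(1) p F(2) an v] by simp
qed

end

section \<open>Local horizontal vector fields of a flat connection\<close>

lemma bounded_bilinear_matrix_vector: "bounded_bilinear ((*v) :: complex^'n^'m \<Rightarrow> complex^'n \<Rightarrow> complex^'m)"
  unfolding bilinear_conv_bounded_bilinear[symmetric] bilinear_def
  by (auto intro!: linearI simp: vec_eq_iff matrix_vector_mult_def sum.distrib algebra_simps scaleR_sum_right)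

text \<open>Minus the connection matrix in direction \<open>w\<close>, with the upper index of the
  Christoffel symbols stored last in \<open>g\<close>. The equation
  \<open>dh = contract g w *v h\<close> says that the field with coefficients \<open>h\<close> is
  parallel. It is kept separate from the matrix product because \<open>flat_linear_system\<close>
  takes two bilinear maps.\<close>

definition contract :: "complex^'n^'n^'n \<Rightarrow> complex^'n \<Rightarrow> complex^'n^'n" where
  "contract g w = (\<chi> c b. - (\<Sum>a\<in>UNIV. w $ a * g $ a $ b $ c))"

lemma bounded_bilinear_contract: "bounded_bilinear (contract :: complex^'n^'n^'n \<Rightarrow> _)"
  unfolding bilinear_conv_bounded_bilinear[symmetric] bilinear_def
  by (auto intro!: linearI simp: vec_eq_iff contract_def sum.distrib algebra_simps scaleR_sum_right)

lemma contract_nth: "(contract g w *v h) $ c = - (\<Sum>b\<in>UNIV. \<Sum>a\<in>UNIV. w $ a * g $ a $ b $ c * h $ b)"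
  by (simp add: contract_def matrix_vector_mult_def sum_distrib_right sum_negf)

lemma sum_swap4:
  fixes t :: "'a \<Rightarrow> 'b \<Rightarrow> 'c \<Rightarrow> 'd \<Rightarrow> 'e::comm_monoid_add"
  shows "(\<Sum>k\<in>K. \<Sum>a\<in>A. \<Sum>b\<in>B. \<Sum>d\<in>D. t k a b d) = (\<Sum>a\<in>A. \<Sum>d\<in>D. \<Sum>b\<in>B. \<Sum>k\<in>K. t k a b d)"
proof -
  have "(\<Sum>k\<in>K. \<Sum>a\<in>A. \<Sum>b\<in>B. \<Sum>d\<in>D. t k a b d) = (\<Sum>a\<in>A. \<Sum>k\<in>K. \<Sum>b\<in>B. \<Sum>d\<in>D. t k a b d)"
    by (rule sum.swap)
  also have "\<dots> = (\<Sum>a\<in>A. \<Sum>k\<in>K. \<Sum>d\<in>D. \<Sum>b\<in>B. t k a b d)"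
    by (intro sum.cong refl sum.swap)
  also have "\<dots> = (\<Sum>a\<in>A. \<Sum>d\<in>D. \<Sum>k\<in>K. \<Sum>b\<in>B. t k a b d)"
    by (intro sum.cong refl) (rule sum.swap)
  also have "\<dots> = (\<Sum>a\<in>A. \<Sum>d\<in>D. \<Sum>b\<in>B. \<Sum>k\<in>K. t k a b d)"
    by (intro sum.cong refl) (rule sum.swap)
  finally show ?thesis .
qed

section \<open>Christoffel symbols and parallel fields\<close>

context framed_connection
begin

text \<open>The components of the frame fields with index in \<open>D\<close> are the constants 0
  and 1, so those components of the bracket vanish. A tangent vector is determined by its components
  in \<open>D\<close>.\<close>

lemma lie_bracket_frame:
  assumes q: "q \<in> Z"
  shows "lie_bracket M (e a) (e b) q = 0"
proof -
  have d0: "deriv_along M (\<lambda>x. e d x $ k) q v = 0" if k: "k \<in> D" and v: "v \<in> tangent_space M q" for d k v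
  proof -
    have "deriv_along M (\<lambda>x. e d x $ k) q v = deriv_along M (\<lambda>x. if d = k then 1 else 0) q v"
      by (rule deriv_along_cong[OF cdiff_at_const zariski_openin_imp_openin[OF open_Z] q _ v])
        (use k frame_coord frame_off in \<open>cases "d \<in> D"; auto\<close>)
    then show ?thesis by (simp add: deriv_along_const[OF ZM[OF q] v])
  qed
  have z: "lie_bracket M (e a) (e b) q $ k *s e k q = 0" for k
    using d0[of k] frame_tangent[OF q] frame_off[OF q, of k]
    by (cases "k \<in> D") (simp_all add: lie_bracket_nth[OF ZM[OF q] vdiff_at_frame[OF q] vdiff_at_frame[OF q]])
  have "lie_bracket M (e a) (e b) q = (\<Sum>k\<in>UNIV. lie_bracket M (e a) (e b) q $ k *s e k q)"
    by (rule frame_span[OF q regular_vf_tangent[OF regular_vf_lie_bracket[OF open_Z frame_regular frame_regular] q]])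
  then show ?thesis unfolding z by simp
qed

text \<open>The ambient components with \<open>c\<close> outside \<open>D\<close> may be nonzero but
  only ever multiply the zero field \<open>e c\<close>. The default 0 makes the flatness equations
  hold for every index.\<close>

definition christoffel :: "'n \<Rightarrow> 'n \<Rightarrow> 'n \<Rightarrow> complex^'n \<Rightarrow> complex" where
  "christoffel a b c x = (if c \<in> D then nabla (e a) (e b) x $ c else 0)"

lemma regular_christoffel: "regular_on Z (christoffel a b c)"
  unfolding christoffel_def[abs_def]
  using regular_vf_regular[OF nabla_regular[OF open_Z ZU frame_regular frame_regular]] regular_on_const
  by (cases "c \<in> D") simp_all

lemma nabla_frame_off:
  assumes "q \<in> Z" "a \<notin> D \<or> b \<notin> D"
  shows "nabla (e a) (e b) q = 0"
  using assms(2)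
proof
  assume "a \<notin> D"
  then have "nabla (e a) (e b) q = nabla (\<lambda>x. 0) (e b) q"
    by (intro nabla_cong[OF open_Z ZU regular_vf_zero frame_regular assms(1)]) (auto intro: frame_off)
  then show ?thesis using nabla_zero_left[OF open_Z ZU frame_regular assms(1)] by simp
next
  assume "b \<notin> D"
  then have "nabla (e a) (e b) q = nabla (e a) (\<lambda>x. 0) q"
    by (intro nabla_cong[OF open_Z ZU frame_regular regular_vf_zero assms(1)]) (auto intro: frame_off)
  then show ?thesis using nabla_zero_right[OF open_Z ZU frame_regular assms(1)] by simp
qed

lemma nabla_frame_eq:
  assumes q: "q \<in> Z"
  shows "nabla (e a) (e b) q = (\<Sum>c\<in>UNIV. christoffel a b c q *s e c q)"
proof -
  have "nabla (e a) (e b) q = (\<Sum>c\<in>UNIV. nabla (e a) (e b) q $ c *s e c q)"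
    by (rule frame_span[OF q regular_vf_tangent[OF nabla_regular[OF open_Z ZU frame_regular frame_regular] q]])
  also have "\<dots> = (\<Sum>c\<in>UNIV. christoffel a b c q *s e c q)"
    using frame_off[OF q] by (intro sum.cong) (auto simp: christoffel_def)
  finally show ?thesis .
qed

text \<open>This is the component \<open>c\<close> of vanishing curvature on three frame fields,
  where commutation of the frame removes the bracket term.\<close>

lemma christoffel_flat:
  assumes flat: "flat M U nabla" and q: "q \<in> Z"
  shows "vf_apply M (e a) (christoffel d b c) q + (\<Sum>k\<in>UNIV. christoffel d b k q * christoffel a k c q) =
    vf_apply M (e d) (christoffel a b c) q + (\<Sum>k\<in>UNIV. christoffel a b k q * christoffel d k c q)"
proof (cases "c \<in> D")
  case True
  note n = nabla_regular[OF open_Z ZU frame_regular frame_regular]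
  \<comment> \<open>As \<open>c\<close> lies in \<open>D\<close>, the field \<open>e k\<close> has
    component 1 at \<open>c\<close> for \<open>k = c\<close> and 0 otherwise, which singles out one
    derivative.\<close>
  have comp: "nabla (e a) (nabla (e d) (e b)) q $ c =
      vf_apply M (e a) (christoffel d b c) q + (\<Sum>k\<in>UNIV. christoffel d b k q * christoffel a k c q)" for a d
  proof -
    have "deriv_along M (\<lambda>x. nabla (e d) (e b) x $ k) q (e a q) * e k q $ c =
        (if k = c then vf_apply M (e a) (christoffel d b c) q else 0)" for k
      using frame_coord[OF q _ True, of k] frame_off[OF q, of k] True
      by (cases "k \<in> D") (auto simp: vf_apply_def christoffel_def[abs_def])
    moreover have "nabla (e d) (e b) q $ k * nabla (e a) (e k) q $ c = christoffel d b k q * christoffel a k c q" for k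
      using nabla_frame_off[OF q, of a k] True by (cases "k \<in> D") (simp_all add: christoffel_def)
    ultimately show ?thesis
      using nabla_expand_right[OF open_Z order_refl q frame_regular n, of a d b]
      by (simp add: sum.distrib)
  qed
  have "nabla (lie_bracket M (e a) (e d)) (e b) q = nabla (\<lambda>x. 0) (e b) q"
    by (rule nabla_cong[OF open_Z ZU regular_vf_zero frame_regular q]) (auto intro: lie_bracket_frame)
  also have "\<dots> = 0" by (rule nabla_zero_left[OF open_Z ZU frame_regular q])
  finally have "curvature M nabla (e a) (e d) (e b) q = nabla (e a) (nabla (e d) (e b)) q - nabla (e d) (nabla (e a) (e b)) q"
    by (simp add: curvature_def)
  moreover have "curvature M nabla (e a) (e d) (e b) q = 0"
    using flat open_Z ZU frame_regular q unfolding flat_def by blast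
  ultimately have "nabla (e a) (nabla (e d) (e b)) q = nabla (e d) (nabla (e a) (e b)) q" by simp
  then show ?thesis using comp[of a d] comp[of d a] by metis
next
  case False
  then show ?thesis
    by (simp add: christoffel_def[abs_def] vf_apply_def deriv_along_const[OF ZM[OF q] frame_tangent[OF q]])
qed

text \<open>In the chart the frame fields act as partial derivatives. The derivative of
  \<open>f\<close> exists only within \<open>M\<close>, so the chain rule is applied within the
  image of the chart, and its complex linearity pulls the components of \<open>w\<close>
  out.\<close>

lemma chart_has_derivative:
  assumes ch: "submanifold_chart Z D e p B \<rho>" and y: "y \<in> B" and f: "regular_on Z f"
  shows "((\<lambda>y. f (\<rho> y)) has_derivative (\<lambda>w. \<Sum>d\<in>UNIV. w $ d * vf_apply M (e d) f (\<rho> y))) (at y)"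
proof -
  from ch have B: "open B" and \<rho>Z: "\<And>y. y \<in> B \<Longrightarrow> \<rho> y \<in> Z"
    and d\<rho>: "(\<rho> has_derivative (\<lambda>w. \<Sum>a\<in>UNIV. w $ a *s e a (\<rho> y))) (at y within B)"
    using y has_derivative_at_withinI unfolding submanifold_chart_def by blast+
  obtain L where L: "(f has_derivative L) (at (\<rho> y) within M)" "\<And>c v. L (c *s v) = c * L v"
    using cdiff_at_regular[OF f open_Z \<rho>Z[OF y]] by (rule cdiff_atE) (rule that)
  have "(f has_derivative L) (at (\<rho> y) within \<rho> ` B)"
    by (rule has_derivative_subset[OF L(1)]) (use \<rho>Z ZM in auto)
  from has_derivative_in_compose[OF d\<rho> this]
  have "((\<lambda>y. f (\<rho> y)) has_derivative (\<lambda>w. L (\<Sum>a\<in>UNIV. w $ a *s e a (\<rho> y)))) (at y)"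
    unfolding at_within_open[OF y B] .
  moreover have "L (\<Sum>a\<in>UNIV. w $ a *s e a (\<rho> y)) = (\<Sum>d\<in>UNIV. w $ d * vf_apply M (e d) f (\<rho> y))" for w
    unfolding linear_sum[OF has_derivative_linear[OF L(1)]] L(2) vf_apply_def
    using deriv_along_has_derivative[OF L(1) ZM[OF \<rho>Z[OF y]] frame_tangent[OF \<rho>Z[OF y]]] by simp
  ultimately show ?thesis by simp
qed

lemma continuous_on_regular:
  assumes "regular_on Z f"
  shows "continuous_on Z f"
  unfolding continuous_on_eq_continuous_within
proof
  fix x assume x: "x \<in> Z"
  obtain L where L: "(f has_derivative L) (at x within M)"
    using cdiff_at_regular[OF assms open_Z x] by (rule cdiff_atE)
  have "(f has_derivative L) (at x within Z)" by (rule has_derivative_subset[OF L]) (use ZM in auto)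
  then show "continuous (at x within Z) f" by (rule has_derivative_continuous)
qed

text \<open>In chart coordinates, being horizontal is a linear system for the coefficients, with the
  Christoffel symbols as data. Its solution with initial value \<open>u\<close> is pulled back to
  \<open>M\<close> along \<open>coord_proj D\<close>.\<close>

lemma horizontal_local_solution:
  assumes flat: "flat M U nabla" and p: "p \<in> Z"
  obtains V H where "openin (top_of_set M) V" "p \<in> V" "V \<subseteq> Z" "horizontal M U nabla V H"
    "H p = (\<Sum>b\<in>UNIV. u $ b *s e b p)"
proof -
  obtain B \<rho> where ch: "submanifold_chart Z D e p B \<rho>" using chart[OF p] by blast
  then obtain N0 where B: "open B" "coord_proj D p \<in> B" and \<rho>Z: "\<And>y. y \<in> B \<Longrightarrow> \<rho> y \<in> Z"
    and N0: "open N0" "p \<in> N0" "\<And>x. x \<in> Z \<Longrightarrow> x \<in> N0 \<Longrightarrow> coord_proj D x \<in> B \<and> \<rho> (coord_proj D x) = x"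
    unfolding submanifold_chart_def by auto
  have "(\<rho> has_derivative (\<lambda>w. \<Sum>a\<in>UNIV. w $ a *s e a (\<rho> y))) (at y)" if "y \<in> B" for y
    using ch that unfolding submanifold_chart_def by blast
  then have c\<rho>: "continuous_on B \<rho>"
    by (meson continuous_at_imp_continuous_on has_derivative_continuous)
  define G where "G y = (\<chi> a b c. christoffel a b c (\<rho> y))" for y
  define G0 where "G0 y w = (\<chi> a b c. \<Sum>d\<in>UNIV. w $ d * vf_apply M (e d) (christoffel a b c) (\<rho> y))" for y w
  define G' where "G' y = Blinfun (G0 y)" for y
  have "bounded_linear (G0 y)" for y
    by (intro linear_conv_bounded_linear[THEN iffD1] linearI)
      (auto simp: G0_def vec_eq_iff sum.distrib algebra_simps scaleR_sum_right)
  then have G': "blinfun_apply (G' y) = G0 y" for y unfolding G'_def by (rule bounded_linear_Blinfun_apply)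
  have dG: "(G has_derivative G' y) (at y)" if y: "y \<in> B" for y
    unfolding G' G_def[abs_def] G0_def
    by (intro has_derivative_vec, unfold vec_lambda_beta) (rule chart_has_derivative[OF ch y regular_christoffel])
  have cG': "continuous_on B G'"
  proof (rule continuous_on_blinfun_componentwise)
    fix i
    show "continuous_on B (\<lambda>y. G' y i)"
      unfolding G' G0_def
      by (intro continuous_on_vec_lambda continuous_intros continuous_on_compose2[OF continuous_on_regular c\<rho>]
          regular_on_vf_apply[OF open_Z regular_christoffel frame_regular]) (use \<rho>Z in auto)
  qed
  have flatG: "contract (G' y w) u *v h + contract (G y) u *v (contract (G y) w *v h) =
      contract (G' y u) w *v h + contract (G y) w *v (contract (G y) u *v h)" if y: "y \<in> B" for y u w h
  proof (subst vec_eq_iff, intro allI)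
    fix c
    let ?x = "\<rho> y"
    \<comment> \<open>The coefficient of \<open>u $ a * w $ d * h $ b\<close>. Flatness is its
      symmetry in \<open>a\<close> and \<open>d\<close>, so exchanging \<open>u\<close> and
      \<open>w\<close> does not change the sum.\<close>
    define F where "F a d b = (\<Sum>k\<in>UNIV. christoffel d b k ?x * christoffel a k c ?x) - vf_apply M (e d) (christoffel a b c) ?x" for a d b
    have F: "F a d b = F d a b" for a d b
      using christoffel_flat[OF flat \<rho>Z[OF y], of a d b c] by (simp add: F_def algebra_simps)
    have "(contract (G' y w) u *v h + contract (G y) u *v (contract (G y) w *v h)) $ c =
        (\<Sum>a\<in>UNIV. \<Sum>d\<in>UNIV. \<Sum>b\<in>UNIV. u $ a * w $ d * h $ b * F a d b)" for u w
    proof -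
      have 1: "(contract (G' y w) u *v h) $ c =
         - (\<Sum>a\<in>UNIV. \<Sum>d\<in>UNIV. \<Sum>b\<in>UNIV. u $ a * w $ d * h $ b * vf_apply M (e d) (christoffel a b c) ?x)"
      proof -
        have "(contract (G' y w) u *v h) $ c =
          - (\<Sum>b\<in>UNIV. \<Sum>a\<in>UNIV. \<Sum>d\<in>UNIV. u $ a * w $ d * h $ b * vf_apply M (e d) (christoffel a b c) ?x)"
          unfolding contract_nth G' G0_def
          by (simp add: sum_distrib_left sum_distrib_right mult_ac)
        also have "(\<Sum>b\<in>UNIV. \<Sum>a\<in>UNIV. \<Sum>d\<in>UNIV. u $ a * w $ d * h $ b * vf_apply M (e d) (christoffel a b c) ?x) =
          (\<Sum>a\<in>UNIV. \<Sum>b\<in>UNIV. \<Sum>d\<in>UNIV. u $ a * w $ d * h $ b * vf_apply M (e d) (christoffel a b c) ?x)"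
          by (rule sum.swap)
        also have "\<dots> = (\<Sum>a\<in>UNIV. \<Sum>d\<in>UNIV. \<Sum>b\<in>UNIV. u $ a * w $ d * h $ b * vf_apply M (e d) (christoffel a b c) ?x)"
          by (intro sum.cong refl sum.swap)
        finally show ?thesis .
      qed
      have 2: "(contract (G y) u *v (contract (G y) w *v h)) $ c =
         (\<Sum>k\<in>UNIV. \<Sum>a\<in>UNIV. \<Sum>b\<in>UNIV. \<Sum>d\<in>UNIV. u $ a * w $ d * h $ b * (christoffel d b k ?x * christoffel a k c ?x))"
        unfolding contract_nth G_def
        by (simp add: sum_distrib_left sum_negf mult_ac)
      have 3: "(\<Sum>k\<in>UNIV. \<Sum>a\<in>UNIV. \<Sum>b\<in>UNIV. \<Sum>d\<in>UNIV. u $ a * w $ d * h $ b * (christoffel d b k ?x * christoffel a k c ?x)) =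
         (\<Sum>a\<in>UNIV. \<Sum>d\<in>UNIV. \<Sum>b\<in>UNIV. \<Sum>k\<in>UNIV. u $ a * w $ d * h $ b * (christoffel d b k ?x * christoffel a k c ?x))"
        by (rule sum_swap4)
      show ?thesis
        unfolding vector_add_component 1 2 3 F_def
        by (simp add: sum_distrib_left right_diff_distrib sum_subtractf)
    qed
    note S = this
    have "(\<Sum>a\<in>UNIV. \<Sum>d\<in>UNIV. \<Sum>b\<in>UNIV. u $ a * w $ d * h $ b * F a d b) =
        (\<Sum>a\<in>UNIV. \<Sum>d\<in>UNIV. \<Sum>b\<in>UNIV. w $ a * u $ d * h $ b * F a d b)"
      by (subst sum.swap) (subst F, simp add: mult_ac)
    then show "(contract (G' y w) u *v h + contract (G y) u *v (contract (G y) w *v h)) $ c =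
      (contract (G' y u) w *v h + contract (G y) w *v (contract (G y) u *v h)) $ c"
      unfolding S .
  qed
  obtain r h where r: "r > 0" "ball (coord_proj D p) r \<subseteq> B" and h0: "h (coord_proj D p) = u"
    and dh: "\<And>y. y \<in> ball (coord_proj D p) r \<Longrightarrow> (h has_derivative (\<lambda>w. contract (G y) w *v h y)) (at y)"
    using flat_linear_system[OF bounded_bilinear_contract bounded_bilinear_matrix_vector B dG cG' flatG] by metis
  define P where "P = (coord_proj D :: complex^'n \<Rightarrow> complex^'n) -` ball (coord_proj D p) r"
  have P: "open P" unfolding P_def
    by (intro open_vimage open_ball linear_continuous_on bounded_linear_coord_proj)
  \<comment> \<open>\<open>N0\<close> guarantees that \<open>\<rho>\<close> inverts the projection
    on \<open>V\<close>, and \<open>P\<close> that the projection lands where \<open>h\<close>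
    solves the system.\<close>
  define V where "V = Z \<inter> (N0 \<inter> P)"
  have V: "openin (top_of_set M) V" unfolding V_def
    by (rule openin_Int_open[OF zariski_openin_imp_openin[OF open_Z] open_Int[OF N0(1) P]])
  have pV: "p \<in> V" using p N0 r by (simp add: V_def P_def)
  have VZ: "V \<subseteq> Z" by (simp add: V_def)
  \<comment> \<open>Composition with the projection defines the coefficients on the ambient open set
    \<open>P\<close>, so each one serves as its own holomorphic extension.\<close>
  define f where "f b x = h (coord_proj D x) $ b" for b x
  have df: "(f b has_derivative (\<lambda>w. (contract (G (coord_proj D x)) (coord_proj D w) *v h (coord_proj D x)) $ b)) (at x)"
    if "x \<in> P" for x b
    unfolding f_def[abs_def]
    using has_derivative_vec_nth[OF has_derivative_compose[OF bounded_linear_imp_has_derivative[OF bounded_linear_coord_proj] dh]] that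
    by (simp add: P_def)
  have "(contract g (coord_proj D (c *s w)) *v k) $ b = c * (contract g (coord_proj D w) *v k) $ b" for c w g k b
  proof -
    have "coord_proj D (c *s w) = c *s coord_proj D w" by (simp add: vec_eq_iff)
    then show ?thesis unfolding contract_nth by (simp add: sum_distrib_left mult_ac del: coord_proj_nth)
  qed
  then have "holo_on P (f b)" for b
    unfolding holo_on_def using df by blast
  then have anf: "analytic_fun_on V (f b)" for b
    unfolding analytic_fun_on_def using P by (intro ballI exI[of _ P] exI[of _ "f b"]) (auto simp: V_def)
  define H where "H x = (\<Sum>b\<in>UNIV. f b x *s e b x)" for x
  have anH: "analytic_vf M V H"
    unfolding analytic_vf_def
  proof (intro conjI allI ballI)
    fix i
    have ane: "analytic_fun_on V (\<lambda>x. e b x $ i)" for b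
      by (rule analytic_fun_on_subset[OF analytic_fun_on_regular[OF regular_vf_regular[OF frame_regular]] VZ])
    have "analytic_fun_on V (\<lambda>x. \<Sum>b\<in>UNIV. f b x * e b x $ i)"
      by (intro analytic_fun_on_sum finite analytic_fun_on_mult anf ane)
    then show "analytic_fun_on V (\<lambda>x. H x $ i)" by (simp add: H_def)
    show "H x \<in> tangent_space M x" if "x \<in> V" for x
      unfolding H_def using VZ that by (intro tangent_space_sum tangent_space_scale frame_tangent) blast
  qed
  have "has_covariant_derivative M U nabla H q v 0" if q: "q \<in> V" and v: "v \<in> tangent_space M q" for q v
  proof -
    have qZ: "q \<in> Z" and qP: "q \<in> P" using q by (auto simp: V_def)
    have \<rho>q: "\<rho> (coord_proj D q) = q" using N0(3)[OF qZ] q by (simp add: V_def)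
    define A where "A x = (\<Sum>a\<in>UNIV. v $ a *s e a x)" for x
    have A: "regular_vf M Z A"
      unfolding A_def[abs_def] by (rule regular_vf_sum[OF finite regular_vf_scale[OF regular_on_const frame_regular]])
    have Av: "A q = v" unfolding A_def by (rule frame_span[OF qZ v, symmetric])
    \<comment> \<open>The solution is differentiated along the projected direction. The projection
      may be dropped because the symbols vanish for \<open>a\<close> outside
      \<open>D\<close>.\<close>
    have ca: "coord_proj D v $ a * christoffel a b c q = v $ a * christoffel a b c q" for a b c
      using nabla_frame_off[OF qZ, of a b] by (simp add: christoffel_def)
    have dfb: "deriv_along M (f c) q v = - (\<Sum>b\<in>UNIV. \<Sum>a\<in>UNIV. v $ a * christoffel a b c q * f b q)" for c
      using deriv_along_has_derivative[OF has_derivative_at_withinI[OF df[OF qP]] ZM[OF qZ] v, of c]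
      unfolding contract_nth G_def vec_lambda_beta \<rho>q ca by (simp add: f_def)
    have nA: "nabla A (e b) q = (\<Sum>a\<in>UNIV. \<Sum>c\<in>UNIV. (v $ a * christoffel a b c q) *s e c q)" for b
      using nabla_expand_left[OF open_Z order_refl qZ A frame_regular, of b] nabla_frame_eq[OF qZ]
      by (simp add: Av vec.scale_sum_right)
    have "frame_covd H q (A q) = (\<Sum>b\<in>UNIV. deriv_along M (f b) q (A q) *s e b q + f b q *s nabla A (e b) q)"
      by (rule frame_covd_representation[OF open_Z ZU V VZ q qZ A finite frame_regular cdiff_at_analytic[OF anf V q]])
        (simp add: H_def)
    also have "\<dots> = 0"
    proof -
      have "(\<Sum>b\<in>UNIV. f b q *s nabla A (e b) q) = (\<Sum>b\<in>UNIV. \<Sum>a\<in>UNIV. \<Sum>c\<in>UNIV. (v $ a * christoffel a b c q * f b q) *s e c q)"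
        unfolding nA by (simp add: vec.scale_sum_right mult_ac)
      also have "\<dots> = (\<Sum>b\<in>UNIV. \<Sum>c\<in>UNIV. \<Sum>a\<in>UNIV. (v $ a * christoffel a b c q * f b q) *s e c q)"
        by (intro sum.cong refl sum.swap)
      also have "\<dots> = (\<Sum>c\<in>UNIV. \<Sum>b\<in>UNIV. \<Sum>a\<in>UNIV. (v $ a * christoffel a b c q * f b q) *s e c q)"
        by (rule sum.swap)
      also have "\<dots> = - (\<Sum>c\<in>UNIV. deriv_along M (f c) q (A q) *s e c q)"
        unfolding Av dfb by (simp add: vec.scale_sum_left sum_negf)
      finally show ?thesis by (simp add: sum.distrib)
    qed
    finally show ?thesis
      using frame_covd_has_covariant_derivative[OF V q qZ anH v] Av by simp
  qed
  then have "horizontal M U nabla V H" using anH by (simp add: horizontal_def)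
  moreover have "H p = (\<Sum>b\<in>UNIV. u $ b *s e b p)" by (simp add: H_def f_def h0)
  ultimately show ?thesis using that V pV VZ by blast
qed

end

section \<open>Lie connections and constant torsion\<close>

context connection
begin

lemma horizontal_subset:
  assumes H: "horizontal M U nabla V H" and sub: "V' \<subseteq> V"
  shows "horizontal M U nabla V' H"
  unfolding horizontal_def analytic_vf_def
proof (intro conjI allI ballI)
  have an: "analytic_vf M V H" using H by (simp add: horizontal_def)
  show "analytic_fun_on V' (\<lambda>x. H x $ i)" for i
    using an analytic_fun_on_subset[OF _ sub, of "\<lambda>x. H x $ i"] by (simp add: analytic_vf_def)
  fix p assume "p \<in> V'"
  then have p: "p \<in> V" using sub by blast
  show "H p \<in> tangent_space M p" using an p by (simp add: analytic_vf_def)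
  show "has_covariant_derivative M U nabla H p v 0" if "v \<in> tangent_space M p" for v
    using H p that by (simp add: horizontal_def)
qed

lemma lie_connection_iff: "lie_connection M U nabla \<longleftrightarrow> flat M U nabla \<and> constant_torsion M U nabla"
proof
  assume lie: "lie_connection M U nabla"
  then have flat: "flat M U nabla" by (simp add: lie_connection_def)
  have "nabla_torsion M nabla X Y Y' p = 0"
    if W: "openin (subtopology zariski M) W" and WU: "W \<subseteq> U" and p: "p \<in> W"
      and X: "regular_vf M W X" and Y: "regular_vf M W Y" and Y': "regular_vf M W Y'" for W X Y Y' p
  proof -
    obtain Z D e where F: "framed_connection M U nabla Z D e" "p \<in> Z"
      using framed_connection_exists p WU by (metis subsetD)
    interpret framed_connection M U nabla Z D e by (rule F(1))
    define W' where "W' = W \<inter> Z"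
    have W': "openin (subtopology zariski M) W'" "W' \<subseteq> Z" "p \<in> W'" and sub: "W' \<subseteq> W"
      using openin_Int[OF W open_Z] p F(2) by (auto simp: W'_def)
    note r = regular_vf_subset[OF X sub] regular_vf_subset[OF Y sub] regular_vf_subset[OF Y' sub]
    note pX = regular_vf_tangent[OF X p] and expand = nabla_torsion_expand[OF W' r(1)]
    have "nabla_torsion M nabla X (e i) (e j) p = 0" for i j
    \<comment> \<open>Horizontal fields with values \<open>e i p\<close> and \<open>e j p\<close> at
      \<open>p\<close> stand in for the frame fields, which need not be horizontal
      themselves.\<close>
    proof -
      have axis: "(\<Sum>b\<in>UNIV. axis k 1 $ b *s e b p) = e k p" for k
        by (simp add: vec_eq_iff sum_axis_mult)
      obtain Vi H where H: "openin (top_of_set M) Vi" "p \<in> Vi" "Vi \<subseteq> Z" "horizontal M U nabla Vi H" "H p = e i p"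
        using horizontal_local_solution[OF flat F(2), of "axis i 1"] unfolding axis by metis
      obtain Vj K where K: "openin (top_of_set M) Vj" "p \<in> Vj" "Vj \<subseteq> Z" "horizontal M U nabla Vj K" "K p = e j p"
        using horizontal_local_solution[OF flat F(2), of "axis j 1"] unfolding axis by metis
      define V where "V = Vi \<inter> Vj"
      have V: "openin (top_of_set M) V" "p \<in> V" "V \<subseteq> U"
        using openin_Int[OF H(1) K(1)] H K ZU by (auto simp: V_def)
      have HV: "horizontal M U nabla V H" and KV: "horizontal M U nabla V K"
        using horizontal_subset[OF H(4), of V] horizontal_subset[OF K(4), of V] by (auto simp: V_def)
      have "horizontal M U nabla V (lie_bracket M H K)"
        using lie V(1,3) HV KV unfolding lie_connection_def by blast
      then have "frame_covd (lie_bracket M H K) p (X p) = 0"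
        using horizontal_frame_covd V(2) F(2) pX by blast
      \<comment> \<open>\<open>frame_covd_lie_bracket\<close> depends on \<open>H\<close> and
        \<open>K\<close> only through their values at \<open>p\<close>. By \<open>expand\<close> the
        resulting sum is \<open>nabla_torsion\<close> on the regular fields \<open>e i\<close> and
        \<open>e j\<close>.\<close>
      then have "- (\<Sum>a\<in>UNIV. \<Sum>b\<in>UNIV. (e i p $ a * e j p $ b) *s nabla_torsion M nabla X (e a) (e b) p) = 0"
        using frame_covd_lie_bracket[OF V(1) HV KV V(2) W' r(1)] H(5) K(5) by (simp add: sum_negf)
      then show ?thesis
        using expand[OF regular_vf_subset[OF frame_regular W'(2)] regular_vf_subset[OF frame_regular W'(2)], of i j] by simp
    qed
    then show ?thesis using expand[OF r(2,3)] by simp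
  qed
  then have "constant_torsion M U nabla" unfolding constant_torsion_def by (intro allI impI ballI | elim conjE)+
  with flat show "flat M U nabla \<and> constant_torsion M U nabla" by blast
next
  assume "flat M U nabla \<and> constant_torsion M U nabla"
  then show "lie_connection M U nabla"
    unfolding lie_connection_def using linear_connection horizontal_lie_bracket by blast
qed

end

theorem proposition3p10:
  fixes M U :: "(complex^'n) set" and nabla :: "'n covder"
  assumes "smooth_connected_affine_variety M"
    and "regular_connection M nabla \<and> U = M \<or> rational_connection M U nabla"
  shows "(lie_connection M U nabla \<longleftrightarrow> lie_connection M U (reciprocal M nabla)) \<and>
    (lie_connection M U (reciprocal M nabla) \<longleftrightarrow>
       flat M U nabla \<and> constant_torsion M U nabla) \<and>
    (flat M U nabla \<and> constant_torsion M U nabla \<longleftrightarrow>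
       flat M U nabla \<and> flat M U (reciprocal M nabla))"
proof -
  have "linear_connection_on M U nabla"
    using assms(2) by (auto simp: regular_connection_def rational_connection_def)
  then have c: "connection M U nabla"
    using assms(1) by unfold_locales (auto simp: smooth_connected_affine_variety_def)
  have rc: "connection M U (reciprocal M nabla)" by (rule connection.connection_reciprocal[OF c])
  \<comment> \<open>The condition on the right is symmetric under exchanging \<open>nabla\<close>
    with its reciprocal, so the same equivalence for the reciprocal connection closes the
    circle.\<close>
  have "lie_connection M U nabla \<longleftrightarrow> flat M U nabla \<and> flat M U (reciprocal M nabla)"
    using connection.lie_connection_iff[OF c] connection.constant_torsion_iff_flat_reciprocal[OF c] by blast
  moreover have "lie_connection M U (reciprocal M nabla) \<longleftrightarrow> flat M U (reciprocal M nabla) \<and> flat M U nabla"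
    using connection.lie_connection_iff[OF rc] connection.constant_torsion_iff_flat_reciprocal[OF rc]
    unfolding reciprocal_reciprocal by blast
  ultimately show ?thesis
    using connection.constant_torsion_iff_flat_reciprocal[OF c] by blast
qed

end
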